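(* Let $W=\{W_t\}_{t\ge 0}$ be a standard one-dimensional Brownian motion with $W_0=0$. Then $\phi(W)$ is also a standard one-dimensional Brownian motion, where $\phi$ is the quasi-time reversal defined below.
   Context: Let $\mathbb{W}$ be the space of continuous paths $w:[0,\infty)\to\mathbb{R}$. For $w\in\mathbb{W}$ let $\tau(w)=\inf\{t\ge0:|w(t)|=1\}$ (hitting time of $\pm1$) and $g_\tau(w)=\sup\{0\le t<\tau(w): w(t)=0\}$ (last zero before $\tau$). The quasi-time reversal $\phi:\mathbb{W}\to\mathbb{W}$ is defined by $$\phi(w)(t)=\begin{cases} w(t), & 0\le t<g_\tau(w),\\ w(g_\tau+\tau-t)-1, & w(\tau)=1,\ g_\tau(w)\le t<\tau(w),\\ w(g_\tau+\tau-t)+1, & w(\tau)=-1,\ g_\tau(w)\le t<\tau(w),\\ w(t)-2, & w(\tau)=1,\ t\ge\tau(w),\\ w(t)+2, & w(\tau)=-1,\ t\ge \tau(w).\end{cases}$$ (Here $g_\tau,\tau$ stand for $g_\tau(w),\tau(w)$.) *)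

theory Defs
  imports "HOL-Probability.Probability"
begin

text \<open>Hitting time of \<open>\<plusminus>1\<close> (only meaningful when the level set is nonempty).\<close>
definition hit_time :: "(real \<Rightarrow> real) \<Rightarrow> real" where
  "hit_time w = Inf {t. 0 \<le> t \<and> \<bar>w t\<bar> = 1}"

definition last_zero :: "(real \<Rightarrow> real) \<Rightarrow> real" where
  "last_zero w = Sup {t. 0 \<le> t \<and> t < hit_time w \<and> w t = 0}"

text \<open>Quasi-time reversal. Convention: if the path never hits \<open>\<plusminus>1\<close>
  (so \<open>\<tau> = \<infinity>\<close>), the path is left unchanged.\<close>
definition qtr :: "(real \<Rightarrow> real) \<Rightarrow> (real \<Rightarrow> real)" where
  "qtr w = (if \<exists>t\<ge>0. \<bar>w t\<bar> = 1 then
     (\<lambda>t. let \<tau> = hit_time w; g = last_zero w in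
        if t < g then w t
        else if t < \<tau> then (if w \<tau> = 1 then w (g + \<tau> - t) - 1 else w (g + \<tau> - t) + 1)
        else (if w \<tau> = 1 then w t - 2 else w t + 2))
   else w)"

definition std_brownian_motion :: "'a measure \<Rightarrow> (real \<Rightarrow> 'a \<Rightarrow> real) \<Rightarrow> bool" where
  "std_brownian_motion M X \<longleftrightarrow>
     (\<forall>t\<ge>0. X t \<in> borel_measurable M) \<and>
     (\<forall>\<omega>\<in>space M. X 0 \<omega> = 0 \<and> continuous_on {0..} (\<lambda>t. X t \<omega>)) \<and>
     (\<forall>s t. 0 \<le> s \<and> s < t \<longrightarrow>
        distributed M lborel (\<lambda>\<omega>. X t \<omega> - X s \<omega>) (normal_density 0 (sqrt (t - s)))) \<and>
     (\<forall>(n::nat) (ts::nat \<Rightarrow> real). 0 \<le> ts 0 \<and> (\<forall>i<n. ts i < ts (Suc i)) \<longrightarrow>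
        prob_space.indep_vars M (\<lambda>_. borel) (\<lambda>i \<omega>. X (ts (Suc i)) \<omega> - X (ts i) \<omega>) {..<n})"

end

theory Submission
  imports Defs
begin

text \<open>
  Sample \<open>W\<close> on a grid of mesh \<open>1/n\<close> and start the resulting Gaussian walk at a point
  \<open>\<theta> u\<close>, where \<open>u\<close> is distributed according to Lebesgue measure. Let \<open>b\<close> be the first time
  the walk leaves \<open>(-1, 1)\<close>, let \<open>s\<close> be the sign of its value there, and let \<open>a\<close> be the last
  earlier time at which the walk is not on the side of \<open>s\<close>. Reversing and negating the increments between \<open>a\<close> and \<open>b\<close>
  and shifting the starting point suitably is an involution that preserves the product of Lebesgue
  measure and the law of the increments, because the pair \<open>(a, b)\<close> can be recovered from the image;
  on the small set where this fails, the walk is left unchanged.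
  As the mesh tends to \<open>0\<close>, and \<open>\<theta>\<close> more slowly, the walk converges to \<open>W\<close> and its image to
  \<open>qtr W\<close> for almost every path: almost surely the extrema of \<open>W\<close> over rational
  intervals avoid the levels \<open>0\<close> and \<open>\<plusminus>1\<close>, so the hitting time and the last zero are
  stable. Hence \<open>qtr W\<close> and \<open>W\<close> have the same finite-dimensional distributions.
\<close>

subsection \<open>Reversal of a walk\<close>

text \<open>The last zero before the exit depends on the future, so the piece to be reversed is not
  cut off at stopping times. For a walk, each candidate pair \<open>(a, b)\<close> can be treated as
  fixed, and reversal becomes a signed permutation of i.i.d. symmetric increments. The price is that
  a walk jumps over the levels instead of hitting them. The starting point pays for the overshoot:
  its law has to survive translations by amounts depending on the increments, which is why it is
  Lebesgue measure and not a probability. Two demands fix the scales. The offset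
  \<open>\<theta> * u\<close> must vanish, so \<theta> tends to 0. The move of \<open>u\<close> is
  the overshoot divided by \<theta> and must vanish too, so overshoots are kept below the square of
  \<theta>. Hence the mesh is chosen after \<theta>, by path continuity alone.\<close>

lemma piecewise_involution:
  fixes Q :: "'b measure" and T :: "'i \<Rightarrow> 'b \<Rightarrow> 'b" and D :: "'i \<Rightarrow> 'b set"
  assumes I: "finite I" and \<iota>: "\<And>r. r \<in> I \<Longrightarrow> \<iota> r \<in> I" "\<And>r. r \<in> I \<Longrightarrow> \<iota> (\<iota> r) = r"
    and T: "\<And>r. r \<in> I \<Longrightarrow> T r \<in> measurable Q Q" "\<And>r. r \<in> I \<Longrightarrow> distr Q Q (T r) = Q"
    and D: "\<And>r. r \<in> I \<Longrightarrow> D r \<in> sets Q" "disjoint_family_on D I"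
    and TD: "\<And>r z. r \<in> I \<Longrightarrow> z \<in> D r \<Longrightarrow> T r z \<in> D (\<iota> r)"
    and TT: "\<And>r z. r \<in> I \<Longrightarrow> z \<in> space Q \<Longrightarrow> T (\<iota> r) (T r z) = z"
  obtains \<Phi> where "\<Phi> \<in> measurable Q Q" "distr Q Q \<Phi> = Q" "\<And>z. z \<in> space Q \<Longrightarrow> \<Phi> (\<Phi> z) = z"
    "\<And>r z. r \<in> I \<Longrightarrow> z \<in> D r \<Longrightarrow> \<Phi> z = T r z" "\<And>z. (\<And>r. r \<in> I \<Longrightarrow> z \<notin> D r) \<Longrightarrow> \<Phi> z = z"
proof -
  define \<Phi> where "\<Phi> z = (if \<exists>r\<in>I. z \<in> D r then T (THE r. r \<in> I \<and> z \<in> D r) z else z)" for z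
  have dis: "r = r'" if "r \<in> I" "r' \<in> I" "z \<in> D r" "z \<in> D r'" for r r' z
    using D(2) that by (auto simp: disjoint_family_on_def)
  have \<Phi>1: "\<Phi> z = T r z" if "r \<in> I" "z \<in> D r" for r z
  proof -
    have "(THE r. r \<in> I \<and> z \<in> D r) = r" using that dis by (intro the_equality) auto
    then show ?thesis unfolding \<Phi>_def using that by auto
  qed
  have \<Phi>0: "\<Phi> z = z" if "\<And>r. r \<in> I \<Longrightarrow> z \<notin> D r" for z unfolding \<Phi>_def using that by auto
  have Dsp: "D r \<subseteq> space Q" if "r \<in> I" for r using D(1)[OF that] sets.sets_into_space by auto
  define U where "U = space Q - (\<Union>r\<in>I. D r)"
  have U: "U \<in> sets Q" unfolding U_def using D(1) I by auto
  \<comment> \<open>A point sent by \<open>T r\<close> into \<open>D (\<iota> r)\<close> must come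
    from \<open>D r\<close>, as \<open>T (\<iota> r)\<close> shows. So the part of the preimage of
    \<open>A\<close> in \<open>D r\<close> is a full preimage under the measure-preserving
    \<open>T r\<close>, and has the measure of \<open>D (\<iota> r) \<inter> A\<close>. Since
    \<iota> permutes \<open>I\<close>, these measures add up to those of the sets
    \<open>D r \<inter> A\<close>.\<close>
  have inv: "{z\<in>D r. T r z \<in> A} = T r -` (D (\<iota> r) \<inter> A) \<inter> space Q" if r: "r \<in> I" for r A
  proof (intro set_eqI iffI; clarsimp)
    fix z assume "z \<in> D r" "T r z \<in> A" then show "T r z \<in> D (\<iota> r) \<and> z \<in> space Q" using TD r Dsp by blast
  next
    fix z assume z: "T r z \<in> D (\<iota> r)" "z \<in> space Q" "T r z \<in> A"
    show "z \<in> D r" using TD[OF \<iota>(1)[OF r] z(1)] TT[OF r z(2)] \<iota>(2)[OF r] by auto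
  qed
  have vim: "\<Phi> -` A \<inter> space Q = (\<Union>r\<in>I. {z\<in>D r. T r z \<in> A}) \<union> (A \<inter> U)" for A
  proof (intro set_eqI iffI)
    fix z assume z: "z \<in> \<Phi> -` A \<inter> space Q"
    then show "z \<in> (\<Union>r\<in>I. {z\<in>D r. T r z \<in> A}) \<union> (A \<inter> U)"
      using \<Phi>1[of _ z] \<Phi>0[of z] by (cases "\<exists>r\<in>I. z \<in> D r") (auto simp: U_def)
  next
    fix z assume "z \<in> (\<Union>r\<in>I. {z\<in>D r. T r z \<in> A}) \<union> (A \<inter> U)"
    then show "z \<in> \<Phi> -` A \<inter> space Q" using \<Phi>1[of _ z] \<Phi>0[of z] Dsp by (auto simp: U_def)
  qed
  have piece: "{z\<in>D r. T r z \<in> A} \<in> sets Q" "emeasure Q {z\<in>D r. T r z \<in> A} = emeasure Q (D (\<iota> r) \<inter> A)"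
    if r: "r \<in> I" and A: "A \<in> sets Q" for r A
  proof -
    have DA: "D (\<iota> r) \<inter> A \<in> sets Q" using D(1)[OF \<iota>(1)[OF r]] A by auto
    show "{z\<in>D r. T r z \<in> A} \<in> sets Q" unfolding inv[OF r] using T(1)[OF r] DA by (rule measurable_sets)
    show "emeasure Q {z\<in>D r. T r z \<in> A} = emeasure Q (D (\<iota> r) \<inter> A)" unfolding inv[OF r]
      using emeasure_distr[OF T(1)[OF r] DA] T(2)[OF r] by simp
  qed
  have sp: "\<Phi> z \<in> space Q" if "z \<in> space Q" for z
    using vim[of "space Q"] that U_def TD Dsp \<iota>(1)
    by (smt (verit, best) \<Phi>0 \<Phi>1 subsetD)
  have meas: "\<Phi> \<in> measurable Q Q"
  proof (rule measurableI[OF sp])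
    fix A assume A: "A \<in> sets Q"
    show "\<Phi> -` A \<inter> space Q \<in> sets Q" unfolding vim using piece(1)[OF _ A] I U A by (intro sets.Un sets.finite_UN) auto
  qed
  have "distr Q Q \<Phi> = Q"
  proof (rule measure_eqI)
    fix A assume "A \<in> sets (distr Q Q \<Phi>)"
    then have A: "A \<in> sets Q" by simp
    have dj: "disjoint_family_on (\<lambda>r. {z\<in>D r. T r z \<in> A}) I" using D(2) by (auto simp: disjoint_family_on_def)
    have dj2: "disjoint_family_on (\<lambda>r. D r \<inter> A) I" using D(2) by (auto simp: disjoint_family_on_def)
    have bij: "bij_betw \<iota> I I" by (rule bij_betw_byWitness[of _ \<iota>]) (use \<iota> in auto)
    have "emeasure (distr Q Q \<Phi>) A = emeasure Q ((\<Union>r\<in>I. {z\<in>D r. T r z \<in> A}) \<union> (A \<inter> U))"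
      using emeasure_distr[OF meas A] vim by simp
    also have "\<dots> = emeasure Q (\<Union>r\<in>I. {z\<in>D r. T r z \<in> A}) + emeasure Q (A \<inter> U)"
      using piece(1)[OF _ A] I A U by (intro plus_emeasure[symmetric]) (auto simp: U_def)
    also have "emeasure Q (\<Union>r\<in>I. {z\<in>D r. T r z \<in> A}) = (\<Sum>r\<in>I. emeasure Q {z\<in>D r. T r z \<in> A})"
      using piece(1)[OF _ A] I dj by (intro sum_emeasure[symmetric]) auto
    also have "\<dots> = (\<Sum>r\<in>I. emeasure Q (D (\<iota> r) \<inter> A))" using piece(2)[OF _ A] by simp
    also have "\<dots> = (\<Sum>r\<in>I. emeasure Q (D r \<inter> A))" by (rule sum.reindex_bij_betw[OF bij])
    also have "\<dots> = emeasure Q (\<Union>r\<in>I. D r \<inter> A)" using D(1) A I dj2 by (intro sum_emeasure) blast+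
    also have "\<dots> + emeasure Q (A \<inter> U) = emeasure Q ((\<Union>r\<in>I. D r \<inter> A) \<union> (A \<inter> U))"
      using D(1) A I U by (intro plus_emeasure sets.finite_UN) (auto simp: U_def)
    also have "(\<Union>r\<in>I. D r \<inter> A) \<union> (A \<inter> U) = A" using sets.sets_into_space[OF A] by (auto simp: U_def)
    finally show "emeasure (distr Q Q \<Phi>) A = emeasure Q A" .
  qed simp
  moreover have "\<Phi> (\<Phi> z) = z" if z: "z \<in> space Q" for z
  proof (cases "\<exists>r\<in>I. z \<in> D r")
    case True
    then obtain r where r: "r \<in> I" "z \<in> D r" by auto
    then show ?thesis using \<Phi>1[OF r] \<Phi>1[OF \<iota>(1)[OF r(1)] TD[OF r]] TT[OF r(1) z] by simp
  next
    case False then show ?thesis using \<Phi>0[of z] by auto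
  qed
  ultimately show ?thesis using that meas \<Phi>1 \<Phi>0 by blast
qed

section \<open>Crossings and flips of a walk\<close>

definition walk :: "real \<Rightarrow> real \<times> (nat \<Rightarrow> real) \<Rightarrow> nat \<Rightarrow> real" where
  "walk \<theta> z j = \<theta> * fst z + (\<Sum>i<j. snd z i)"

definition crossing :: "(nat \<Rightarrow> real) \<Rightarrow> nat \<Rightarrow> nat \<Rightarrow> real \<Rightarrow> bool" where
  "crossing Y a b s \<longleftrightarrow> a < b \<and> (s = 1 \<or> s = -1) \<and> (\<forall>j<b. \<bar>Y j\<bar> < 1) \<and> 1 \<le> s * Y b \<and>
     s * Y a \<le> 0 \<and> (\<forall>j. a < j \<and> j < b \<longrightarrow> 0 < s * Y j)"

text \<open>The increments on \<open>[a, b)\<close> are reversed and negated, and the starting point is moved by just as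
  much as is needed for the new walk on \<open>[a, b]\<close> to be \<open>j \<mapsto> walk (a + b - j) - s\<close>. The
  move absorbs the overshoot of the walk at the levels \<open>0\<close> and \<open>s\<close>, which is what makes
  the discrete reversal an exact involution.\<close>
definition flip :: "real \<Rightarrow> nat \<Rightarrow> nat \<Rightarrow> nat \<Rightarrow> real \<Rightarrow> real \<times> (nat \<Rightarrow> real) \<Rightarrow> real \<times> (nat \<Rightarrow> real)" where
  "flip \<theta> N a b s z = (fst z - (s + walk \<theta> z a - walk \<theta> z b) / \<theta>,
     \<lambda>i\<in>{..<N}. if a \<le> i \<and> i < b then - snd z (a + b - 1 - i) else snd z i)"

text \<open>The flip translates the walk before \<open>a\<close>, which could push it out of
  \<open>(-1, 1)\<close> and hide \<open>(a, b)\<close> from the image. Requiring the image to be a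
  crossing as well makes the condition symmetric under the flip. The bound \<kappa> on the
  correction is symmetric too, because the correction only changes sign.\<close>

definition flippable :: "real \<Rightarrow> real \<Rightarrow> nat \<Rightarrow> nat \<Rightarrow> nat \<Rightarrow> real \<Rightarrow> real \<times> (nat \<Rightarrow> real) \<Rightarrow> bool" where
  "flippable \<theta> \<kappa> N a b s z \<longleftrightarrow> b \<le> N \<and> crossing (walk \<theta> z) a b s \<and>
     crossing (walk \<theta> (flip \<theta> N a b s z)) a b (-s) \<and> \<bar>s + walk \<theta> z a - walk \<theta> z b\<bar> \<le> \<kappa>"

text \<open>The index \<open>b\<close> is the first one with modulus at least 1, the value there
  determines \<open>s\<close>, and \<open>a\<close> is the last earlier index with
  \<open>s * Y a \<le> 0\<close>. This makes the domains of different flips disjoint.\<close>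

lemma crossing_unique:
  assumes "crossing Y a b s" "crossing Y a' b' s'"
  shows "a = a' \<and> b = b' \<and> s = s'"
proof -
  have ge: "\<bar>Y b\<bar> \<ge> 1" "\<bar>Y b'\<bar> \<ge> 1" using assms by (auto simp: crossing_def)
  have b: "b = b'"
  proof (rule linorder_cases[of b b'])
    assume "b < b'" then show ?thesis using assms(2) ge(1) by (auto simp: crossing_def)
  next
    assume "b' < b" then show ?thesis using assms(1) ge(2) by (auto simp: crossing_def)
  qed
  have s: "s = s'" using assms b by (auto simp: crossing_def)
  have "a = a'"
  proof (rule linorder_cases[of a a'])
    assume "a < a'" then show ?thesis using assms b s unfolding crossing_def by (meson linorder_not_less)
  next
    assume "a' < a" then show ?thesis using assms b s unfolding crossing_def by (meson linorder_not_less)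
  qed
  then show ?thesis using b s by simp
qed

lemma walk_Suc: "walk \<theta> z (Suc j) = walk \<theta> z j + snd z j"
  by (simp add: walk_def)

text \<open>The correction at the start translates everything up to \<open>a\<close> so that the new
  walk has the value \<open>walk \<theta> z b - s\<close> there; from then on it reads the old walk
  backwards down to \<open>a\<close>, and afterwards it is parallel to the old walk.\<close>

lemma walk_flip:
  assumes "\<theta> \<noteq> 0" "a < b" "b \<le> N" "j \<le> N"
  shows "walk \<theta> (flip \<theta> N a b s z) j =
    (if j \<le> a then walk \<theta> z j - (s + walk \<theta> z a - walk \<theta> z b)
     else if j \<le> b then walk \<theta> z (a + b - j) - s
     else walk \<theta> z j + walk \<theta> z a - walk \<theta> z b - s)"
  using assms(4)
proof (induction j)
  case 0 then show ?case using assms(1) by (simp add: walk_def flip_def field_simps)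
next
  case (Suc j)
  have IH: "walk \<theta> (flip \<theta> N a b s z) j =
    (if j \<le> a then walk \<theta> z j - (s + walk \<theta> z a - walk \<theta> z b)
     else if j \<le> b then walk \<theta> z (a + b - j) - s
     else walk \<theta> z j + walk \<theta> z a - walk \<theta> z b - s)" using Suc by simp
  have st: "walk \<theta> (flip \<theta> N a b s z) (Suc j) = walk \<theta> (flip \<theta> N a b s z) j +
     (if a \<le> j \<and> j < b then - snd z (a + b - 1 - j) else snd z j)"
    using Suc.prems by (simp add: walk_Suc) (simp add: flip_def)
  consider "j < a" | "a \<le> j" "j < b" | "b \<le> j" by linarith
  then show ?case
  proof cases
    case 1 then show ?thesis using IH st assms by (simp add: walk_Suc)
  next
    case 2
    \<comment> \<open>The new increment at \<open>j\<close> is minus the old increment that leads to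
      index \<open>a + b - j\<close>, so the new walk steps from the value at
      \<open>a + b - j\<close> back to the value at \<open>a + b - Suc j\<close>.\<close>
    then have "a + b - j = Suc (a + b - 1 - j)" by simp
    then have "walk \<theta> z (a + b - j) = walk \<theta> z (a + b - Suc j) + snd z (a + b - 1 - j)"
      using walk_Suc[of \<theta> z "a + b - 1 - j"] by simp
    moreover have "walk \<theta> (flip \<theta> N a b s z) j = walk \<theta> z (a + b - j) - s"
      using 2 IH by (cases "j = a") auto
    ultimately show ?thesis using 2 st by simp
  next
    case 3
    have "walk \<theta> (flip \<theta> N a b s z) j = walk \<theta> z j + walk \<theta> z a - walk \<theta> z b - s"
      using 3 IH assms by (cases "j = b") auto
    then show ?thesis using 3 st assms by (simp add: walk_Suc)
  qed
qed

text \<open>The end values are exchanged up to \<open>s\<close>, so the correction for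
  \<open>-s\<close> on the image is the negative of the first one. Extensionality fixes the
  coordinates outside \<open>{..<N}\<close>, which \<open>flip\<close> overwrites.\<close>

lemma flip_flip:
  assumes "\<theta> \<noteq> 0" "a < b" "b \<le> N" "snd z \<in> extensional {..<N}"
  shows "flip \<theta> N a b (-s) (flip \<theta> N a b s z) = z"
proof (rule prod_eqI)
  let ?z = "flip \<theta> N a b s z"
  have ends: "walk \<theta> ?z a = walk \<theta> z b - s" "walk \<theta> ?z b = walk \<theta> z a - s"
    using walk_flip[OF assms(1-3), of a s z] walk_flip[OF assms(1-3), of b s z] assms by auto
  have fst: "fst (flip \<theta> N a b t y) = fst y - (t + walk \<theta> y a - walk \<theta> y b) / \<theta>" for t y
    by (simp add: flip_def)
  show "fst (flip \<theta> N a b (-s) ?z) = fst z"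
    unfolding fst[of "-s"] ends unfolding fst[of s] by (simp add: diff_divide_distrib add_divide_distrib)
  show "snd (flip \<theta> N a b (-s) ?z) = snd z"
  proof
    fix i
    show "snd (flip \<theta> N a b (-s) ?z) i = snd z i"
    proof (cases "i < N")
      case True
      show ?thesis using True assms by (auto simp: flip_def)
    next
      case False then show ?thesis using assms(4) by (auto simp: flip_def extensional_def)
    qed
  qed
qed

text \<open>The inequalities in \<open>crossing\<close> are exchanged in pairs by the map from
  \<open>y\<close> to \<open>y - s\<close> together with the change of sign:
  \<open>1 \<le> s * Y b\<close> becomes the condition at \<open>a\<close>,
  \<open>s * Y a \<le> 0\<close> the one at \<open>b\<close>, and \<open>0 < s * Y j\<close> and
  \<open>\<bar>Y j\<bar> < 1\<close> exchange roles in between. What remains is the translated part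
  before \<open>a\<close> and the value at \<open>a\<close> itself, which the last two hypotheses
  control.\<close>

lemma crossing_flip:
  assumes \<theta>: "\<theta> \<noteq> 0" and b: "b \<le> N" and c: "crossing (walk \<theta> z) a b s"
    and small: "\<And>j. j < a \<Longrightarrow> \<bar>walk \<theta> z j - (s + walk \<theta> z a - walk \<theta> z b)\<bar> < 1"
    and ab: "\<bar>walk \<theta> z b - s\<bar> < 1"
  shows "crossing (walk \<theta> (flip \<theta> N a b s z)) a b (-s)"
proof -
  let ?Y = "walk \<theta> z"
  let ?Y' = "walk \<theta> (flip \<theta> N a b s z)"
  have lt: "a < b" and s: "s = 1 \<or> s = -1" and ya: "s * ?Y a \<le> 0" and yb: "1 \<le> s * ?Y b"
    and mid: "\<And>j. a < j \<Longrightarrow> j < b \<Longrightarrow> 0 < s * ?Y j" and in1: "\<And>j. j < b \<Longrightarrow> \<bar>?Y j\<bar> < 1"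
    using c by (auto simp: crossing_def)
  note wf = walk_flip[OF \<theta> lt b]
  have a': "?Y' a = ?Y b - s" and b': "?Y' b = ?Y a - s" using wf[of a] wf[of b] lt b by auto
  have m': "?Y' j = ?Y (a + b - j) - s" if "a < j" "j < b" for j using wf[of j] that b by auto
  have m'': "- s * ?Y' j > 0 \<and> \<bar>?Y' j\<bar> < 1" if "a < j" "j < b" for j
  proof -
    have "a < a + b - j" "a + b - j < b" using that by auto
    then show ?thesis using m'[OF that] mid[of "a + b - j"] in1[of "a + b - j"] s by auto
  qed
  have "\<bar>?Y' j\<bar> < 1" if j: "j < b" for j
  proof -
    consider "j < a" | "j = a" | "a < j" by linarith
    then show ?thesis
    proof cases
      case 1 then show ?thesis using wf[of j] lt b small by auto
    next
      case 2 then show ?thesis using a' ab by auto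
    next
      case 3 then show ?thesis using m'' j by auto
    qed
  qed
  then show ?thesis unfolding crossing_def using lt s a' b' ya yb m'' by auto
qed

lemma flippable_flip:
  assumes \<theta>: "\<theta> \<noteq> 0" and z: "snd z \<in> extensional {..<N}" and f: "flippable \<theta> \<kappa> N a b s z"
  shows "flippable \<theta> \<kappa> N a b (-s) (flip \<theta> N a b s z)"
proof -
  have lt: "a < b" and b: "b \<le> N" using f by (auto simp: flippable_def crossing_def)
  have "walk \<theta> (flip \<theta> N a b s z) a = walk \<theta> z b - s" "walk \<theta> (flip \<theta> N a b s z) b = walk \<theta> z a - s"
    using walk_flip[OF \<theta> lt b, of a s z] walk_flip[OF \<theta> lt b, of b s z] lt b by auto
  then show ?thesis using f flip_flip[OF \<theta> lt b z, of s] by (auto simp: flippable_def)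
qed

text \<open>A product measure is determined by boxes, and the preimage of a box is again a box, with
  its sides permuted and some of them reflected. Symmetry of \<nu> leaves the measures of the sides
  unchanged.\<close>

lemma distr_signed_involution:
  fixes \<nu> :: "real measure" and \<sigma> :: "'i \<Rightarrow> 'i" and J :: "'i set"
  assumes I: "finite I" and \<nu>: "prob_space \<nu>" "sets \<nu> = sets borel" "distr \<nu> \<nu> uminus = \<nu>"
    and \<sigma>: "\<And>i. i \<in> I \<Longrightarrow> \<sigma> i \<in> I" "\<And>i. i \<in> I \<Longrightarrow> \<sigma> (\<sigma> i) = i"
  defines "T \<equiv> \<lambda>x. \<lambda>i\<in>I. if i \<in> J then - x (\<sigma> i) else x (\<sigma> i)"
  shows "T \<in> measurable (PiM I (\<lambda>_. \<nu>)) (PiM I (\<lambda>_. \<nu>))"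
    "distr (PiM I (\<lambda>_. \<nu>)) (PiM I (\<lambda>_. \<nu>)) T = PiM I (\<lambda>_. \<nu>)"
proof -
  interpret \<nu>: prob_space \<nu> by fact
  interpret product_sigma_finite "\<lambda>_::'i. \<nu>" ..
  have sp: "space \<nu> = UNIV" using sets_eq_imp_space_eq[OF \<nu>(2)] by simp
  have um[measurable]: "uminus \<in> measurable \<nu> \<nu>" unfolding measurable_cong_sets[OF \<nu>(2,2)] by measurable
  show T: "T \<in> measurable (PiM I (\<lambda>_. \<nu>)) (PiM I (\<lambda>_. \<nu>))"
    unfolding T_def using \<sigma>(1) by (intro measurable_restrict) (auto intro!: measurable_compose[OF _ um])
  show "distr (PiM I (\<lambda>_. \<nu>)) (PiM I (\<lambda>_. \<nu>)) T = PiM I (\<lambda>_. \<nu>)"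
  proof (rule PiM_eqI[OF I])
    fix A assume A: "\<And>i. i \<in> I \<Longrightarrow> A i \<in> sets \<nu>"
    \<comment> \<open>Coordinate \<open>j\<close> of the argument feeds coordinate
      \<open>\<sigma> j\<close> of the image, because \<sigma> is its own inverse.\<close>
    define B where "B j = (if \<sigma> j \<in> J then uminus -` A (\<sigma> j) else A (\<sigma> j))" for j
    have B: "B j \<in> sets \<nu> \<and> emeasure \<nu> (B j) = emeasure \<nu> (A (\<sigma> j))" if "j \<in> I" for j
    proof -
      have As: "A (\<sigma> j) \<in> sets \<nu>" using A \<sigma> that by auto
      have "uminus -` A (\<sigma> j) \<in> sets \<nu>" using measurable_sets[OF um As] sp by simp
      moreover have "emeasure \<nu> (uminus -` A (\<sigma> j)) = emeasure \<nu> (A (\<sigma> j))"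
        using emeasure_distr[OF um As] \<nu>(3) sp by simp
      ultimately show ?thesis using As by (auto simp: B_def)
    qed
    have pre: "T -` Pi\<^sub>E I A \<inter> space (PiM I (\<lambda>_. \<nu>)) = Pi\<^sub>E I B"
    proof (intro set_eqI iffI)
      fix x assume x: "x \<in> T -` Pi\<^sub>E I A \<inter> space (PiM I (\<lambda>_. \<nu>))"
      then have TA: "T x i \<in> A i" if "i \<in> I" for i using that by (auto simp: PiE_iff)
      have "x j \<in> B j" if "j \<in> I" for j
        using TA[OF \<sigma>(1)[OF that]] \<sigma>(1)[OF that] \<sigma>(2)[OF that] by (auto simp: T_def B_def split: if_splits)
      then show "x \<in> Pi\<^sub>E I B" using x by (auto simp: PiE_iff space_PiM)
    next
      fix x assume x: "x \<in> Pi\<^sub>E I B"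
      have "T x i \<in> A i" if "i \<in> I" for i
        using PiE_mem[OF x \<sigma>(1)[OF that]] that \<sigma>(2)[OF that] by (auto simp: T_def B_def split: if_splits)
      then show "x \<in> T -` Pi\<^sub>E I A \<inter> space (PiM I (\<lambda>_. \<nu>))" using x sp by (auto simp: PiE_iff space_PiM T_def)
    qed
    have "Pi\<^sub>E I A \<in> sets (PiM I (\<lambda>_. \<nu>))" using A I by (intro sets_PiM_I_finite) auto
    then have "emeasure (distr (PiM I (\<lambda>_. \<nu>)) (PiM I (\<lambda>_. \<nu>)) T) (Pi\<^sub>E I A) = emeasure (PiM I (\<lambda>_. \<nu>)) (Pi\<^sub>E I B)"
      using emeasure_distr[OF T] pre by simp
    also have "\<dots> = (\<Prod>j\<in>I. emeasure \<nu> (B j))" using B I by (intro emeasure_PiM) auto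
    also have "\<dots> = (\<Prod>j\<in>I. emeasure \<nu> (A (\<sigma> j)))" using B by (intro prod.cong) auto
    also have "\<dots> = (\<Prod>j\<in>I. emeasure \<nu> (A j))"
      by (rule prod.reindex_bij_betw[OF bij_betw_byWitness[of _ \<sigma>]]) (use \<sigma> in auto)
    finally show "emeasure (distr (PiM I (\<lambda>_. \<nu>)) (PiM I (\<lambda>_. \<nu>)) T) (Pi\<^sub>E I A) = (\<Prod>j\<in>I. emeasure \<nu> (A j))" .
  qed simp
qed

text \<open>For fixed \<open>x\<close> the first coordinate is merely translated by
  \<open>\<psi> x\<close>, which Lebesgue measure does not notice; integrating over \<open>u\<close>
  first leaves only the action of \<open>T\<close> on \<open>P\<close>.\<close>

lemma distr_translate:
  fixes P :: "'b measure" and \<psi> :: "'b \<Rightarrow> real"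
  assumes P: "sigma_finite_measure P" and T[measurable]: "T \<in> measurable P P" and d: "distr P P T = P"
    and \<psi>[measurable]: "\<psi> \<in> borel_measurable P"
  shows "distr (lborel \<Otimes>\<^sub>M P) (lborel \<Otimes>\<^sub>M P) (\<lambda>(u, x). (u + \<psi> x, T x)) = lborel \<Otimes>\<^sub>M P"
proof -
  interpret P: sigma_finite_measure P by fact
  interpret pair_sigma_finite "lborel :: real measure" P ..
  show ?thesis
  proof (rule measure_eqI)
    fix A assume "A \<in> sets (distr (lborel \<Otimes>\<^sub>M P) (lborel \<Otimes>\<^sub>M P) (\<lambda>(u, x). (u + \<psi> x, T x)))"
    then have A[measurable]: "A \<in> sets (lborel \<Otimes>\<^sub>M P)" by (simp only: sets_distr)
    have "emeasure (distr (lborel \<Otimes>\<^sub>M P) (lborel \<Otimes>\<^sub>M P) (\<lambda>(u, x). (u + \<psi> x, T x))) A =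
        (\<integral>\<^sup>+z. indicator A (fst z + \<psi> (snd z), T (snd z)) \<partial>(lborel \<Otimes>\<^sub>M P))"
    proof -
      have "emeasure (distr (lborel \<Otimes>\<^sub>M P) (lborel \<Otimes>\<^sub>M P) (\<lambda>(u, x). (u + \<psi> x, T x))) A =
          (\<integral>\<^sup>+z. indicator A z \<partial>distr (lborel \<Otimes>\<^sub>M P) (lborel \<Otimes>\<^sub>M P) (\<lambda>(u, x). (u + \<psi> x, T x)))"
        using A by (intro nn_integral_indicator[symmetric]) simp
      also have "\<dots> = (\<integral>\<^sup>+z. indicator A (case z of (u, x) \<Rightarrow> (u + \<psi> x, T x)) \<partial>(lborel \<Otimes>\<^sub>M P))"
        by (rule nn_integral_distr) auto
      finally show ?thesis by (simp add: split_beta')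
    qed
    also have "\<dots> = (\<integral>\<^sup>+x. (\<integral>\<^sup>+u. indicator A (u + \<psi> x, T x) \<partial>lborel) \<partial>P)"
      by (subst nn_integral_snd[symmetric]) auto
    also have "\<dots> = (\<integral>\<^sup>+x. (\<integral>\<^sup>+u. indicator A (u, T x) \<partial>lborel) \<partial>P)"
    proof (rule nn_integral_cong)
      fix x assume x: "x \<in> space P"
      then have [measurable]: "(\<lambda>u. indicator A (u, T x) :: ennreal) \<in> borel_measurable borel"
        using measurable_space[OF T x] by measurable
      show "(\<integral>\<^sup>+u. indicator A (u + \<psi> x, T x) \<partial>lborel) = (\<integral>\<^sup>+u. indicator A (u, T x) \<partial>lborel)"
        by (subst nn_integral_real_affine[where c=1 and t="\<psi> x" and f="\<lambda>u. indicator A (u, T x)"]) (auto simp: add.commute)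
    qed
    also have "\<dots> = (\<integral>\<^sup>+x. (\<integral>\<^sup>+u. indicator A (u, x) \<partial>lborel) \<partial>distr P P T)"
      by (subst nn_integral_distr) auto
    also have "\<dots> = emeasure (lborel \<Otimes>\<^sub>M P) A" unfolding d
      by (subst nn_integral_snd) (use nn_integral_indicator[OF A] in auto)
    finally show "emeasure (distr (lborel \<Otimes>\<^sub>M P) (lborel \<Otimes>\<^sub>M P) (\<lambda>(u, x). (u + \<psi> x, T x))) A = emeasure (lborel \<Otimes>\<^sub>M P) A" .
  qed simp
qed

lemma walk_measurable:
  assumes "sets \<nu> = sets borel" "j \<le> N"
  shows "(\<lambda>z. walk \<theta> z j) \<in> borel_measurable (lborel \<Otimes>\<^sub>M PiM {..<N} (\<lambda>_. \<nu>))"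
proof -
  have "(\<lambda>x. x i) \<in> borel_measurable (PiM {..<N} (\<lambda>_. \<nu>))" if "i < N" for i
    using measurable_component_singleton[of i "{..<N}" "\<lambda>_. \<nu>"] that
    unfolding measurable_cong_sets[OF refl assms(1)] by simp
  then have "(\<lambda>z. snd z i) \<in> borel_measurable ((lborel :: real measure) \<Otimes>\<^sub>M PiM {..<N} (\<lambda>_. \<nu>))" if "i < N" for i
    using that by (intro measurable_compose[OF measurable_snd]) auto
  then show ?thesis unfolding walk_def using assms(2)
    by (intro borel_measurable_add borel_measurable_times borel_measurable_sum) auto
qed

section \<open>Measure preservation and the glued involution\<close>

context
  fixes \<nu> :: "real measure" and N :: nat and \<theta> :: real
  assumes \<nu>: "prob_space \<nu>" "sets \<nu> = sets borel" "distr \<nu> \<nu> uminus = \<nu>" and \<theta>: "\<theta> \<noteq> 0"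
begin

text \<open>The start cancels in \<open>walk \<theta> z a - walk \<theta> z b\<close>, so the
  correction is a function of the increments alone and the flip is a translation of \<open>u\<close>
  over a signed reversal of coordinates.\<close>

lemma flip_measure_preserving:
  assumes b: "a < b" "b \<le> N"
  defines "Q \<equiv> lborel \<Otimes>\<^sub>M PiM {..<N} (\<lambda>_. \<nu>)"
  shows "flip \<theta> N a b s \<in> measurable Q Q" "distr Q Q (flip \<theta> N a b s) = Q"
proof -
  interpret \<nu>: prob_space \<nu> by fact
  have P: "sigma_finite_measure (PiM {..<N} (\<lambda>_. \<nu>))"
    by (intro prob_space_imp_sigma_finite prob_space_PiM \<nu>)
  define \<sigma> where "\<sigma> i = (if a \<le> i \<and> i < b then a + b - 1 - i else i)" for i
  define T where "T = (\<lambda>x::nat\<Rightarrow>real. \<lambda>i\<in>{..<N}. if i \<in> {a..<b} then - x (\<sigma> i) else x (\<sigma> i))"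
  define \<psi> where "\<psi> x = ((\<Sum>i<b. x i) - (\<Sum>i<a. x i) - s) / \<theta>" for x :: "nat \<Rightarrow> real"
  have T: "T \<in> measurable (PiM {..<N} (\<lambda>_. \<nu>)) (PiM {..<N} (\<lambda>_. \<nu>))"
    "distr (PiM {..<N} (\<lambda>_. \<nu>)) (PiM {..<N} (\<lambda>_. \<nu>)) T = PiM {..<N} (\<lambda>_. \<nu>)"
    unfolding T_def by (rule distr_signed_involution[OF _ \<nu>]; use b in \<open>auto simp: \<sigma>_def\<close>)+
  have fl: "flip \<theta> N a b s = (\<lambda>(u, x). (u + \<psi> x, T x))"
    by (auto simp: fun_eq_iff flip_def T_def \<sigma>_def \<psi>_def walk_def diff_divide_distrib add_divide_distrib)
  have x: "(\<lambda>x. x i) \<in> borel_measurable (PiM {..<N} (\<lambda>_. \<nu>))" if "i < N" for i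
    using measurable_component_singleton[of i "{..<N}" "\<lambda>_. \<nu>"] that
    unfolding measurable_cong_sets[OF refl \<nu>(2)] by simp
  have \<psi>[measurable]: "\<psi> \<in> borel_measurable (PiM {..<N} (\<lambda>_. \<nu>))"
    unfolding \<psi>_def using b
    by (intro borel_measurable_divide borel_measurable_diff borel_measurable_sum x) auto
  note T(1)[measurable]
  show "flip \<theta> N a b s \<in> measurable Q Q" unfolding fl Q_def by measurable
  show "distr Q Q (flip \<theta> N a b s) = Q" unfolding fl Q_def
    by (rule distr_translate[OF P T \<psi>])
qed

lemma flippable_measurable:
  assumes b: "a < b" "b \<le> N"
  defines "Q \<equiv> lborel \<Otimes>\<^sub>M PiM {..<N} (\<lambda>_. \<nu>)"
  shows "{z \<in> space Q. flippable \<theta> \<kappa> N a b s z} \<in> sets Q"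
proof -
  have w: "(\<lambda>z. walk \<theta> z j) \<in> borel_measurable Q" if "j \<le> N" for j
    unfolding Q_def using walk_measurable[OF \<nu>(2) that] .
  have cr: "Measurable.pred Q (\<lambda>z. crossing (\<lambda>j. f z j) a b t)" if f: "\<And>j. j \<le> N \<Longrightarrow> (\<lambda>z. f z j) \<in> borel_measurable Q" for f t
  proof -
    have eq: "crossing (\<lambda>j. f z j) a b t \<longleftrightarrow> a < b \<and> (t = 1 \<or> t = -1) \<and> (\<forall>j\<in>{..<b}. \<bar>f z j\<bar> < 1) \<and> 1 \<le> t * f z b \<and>
       t * f z a \<le> 0 \<and> (\<forall>j\<in>{a<..<b}. 0 < t * f z j)" for z by (auto simp: crossing_def)
    have lt: "Measurable.pred Q (\<lambda>z. g z < h z)" and le: "Measurable.pred Q (\<lambda>z. g z \<le> h z)"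
      if [measurable]: "g \<in> borel_measurable Q" "h \<in> borel_measurable Q" for g h :: "_ \<Rightarrow> real" by measurable
    show ?thesis unfolding eq
      by (intro pred_intros_logic pred_intros_finite lt le
          borel_measurable_abs borel_measurable_times f borel_measurable_const) (use b in auto)
  qed
  have fl: "(\<lambda>z. walk \<theta> (flip \<theta> N a b s z) j) \<in> borel_measurable Q" if "j \<le> N" for j
    using measurable_compose[OF flip_measure_preserving(1)[OF b, folded Q_def] w[OF that]] by simp
  have "Measurable.pred Q (\<lambda>z. \<bar>s + walk \<theta> z a - walk \<theta> z b\<bar> \<le> \<kappa>)"
    using w[of a, measurable] w[of b, measurable] b by auto
  then have "Measurable.pred Q (flippable \<theta> \<kappa> N a b s)"
    unfolding flippable_def using cr[OF w] cr[OF fl] by (intro pred_intros_logic) auto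
  then show ?thesis by (simp add: pred_def)
qed

lemma reversal_involution:
  defines "Q \<equiv> lborel \<Otimes>\<^sub>M PiM {..<N} (\<lambda>_. \<nu>)"
  obtains \<Phi> where "\<Phi> \<in> measurable Q Q" "distr Q Q \<Phi> = Q" "\<And>z. z \<in> space Q \<Longrightarrow> \<Phi> (\<Phi> z) = z"
    "\<And>a b s z. z \<in> space Q \<Longrightarrow> flippable \<theta> \<kappa> N a b s z \<Longrightarrow> \<Phi> z = flip \<theta> N a b s z"
    "\<And>z. \<theta> * \<bar>fst (\<Phi> z) - fst z\<bar> \<le> \<bar>\<kappa>\<bar>"
proof -
  \<comment> \<open>The finite box adds no restriction; it makes finiteness of the index set
    evident.\<close>
  define I where "I = {(a, b, s). a < b \<and> b \<le> N \<and> (s = 1 \<or> s = -1)} \<inter> ({..N} \<times> {..N} \<times> {1, -1::real})"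
  define T where "T = (\<lambda>(a, b, s). flip \<theta> N a b s)"
  define D where "D = (\<lambda>(a, b, s). {z \<in> space Q. flippable \<theta> \<kappa> N a b s z})"
  define \<iota> where "\<iota> = (\<lambda>(a::nat, b::nat, s::real). (a, b, -s))"
  have ext: "snd z \<in> extensional {..<N}" if "z \<in> space Q" for z
    using that by (auto simp: Q_def space_pair_measure space_PiM PiE_def)
  have memI: "(a, b, s) \<in> I" if "flippable \<theta> \<kappa> N a b s z" for a b s z
    using that by (auto simp: I_def flippable_def crossing_def)
  obtain \<Phi> where \<Phi>: "\<Phi> \<in> measurable Q Q" "distr Q Q \<Phi> = Q" "\<And>z. z \<in> space Q \<Longrightarrow> \<Phi> (\<Phi> z) = z"
    "\<And>r z. r \<in> I \<Longrightarrow> z \<in> D r \<Longrightarrow> \<Phi> z = T r z" "\<And>z. (\<And>r. r \<in> I \<Longrightarrow> z \<notin> D r) \<Longrightarrow> \<Phi> z = z"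
  proof (rule piecewise_involution[of I \<iota> T Q D])
    show "finite I" unfolding I_def by auto
    show "\<And>r. r \<in> I \<Longrightarrow> \<iota> r \<in> I" "\<And>r. r \<in> I \<Longrightarrow> \<iota> (\<iota> r) = r" by (auto simp: I_def \<iota>_def)
    show "T r \<in> measurable Q Q" "distr Q Q (T r) = Q" if "r \<in> I" for r
      using that flip_measure_preserving by (auto simp: I_def T_def Q_def)
    show "D r \<in> sets Q" if "r \<in> I" for r
      using that flippable_measurable by (auto simp: I_def D_def Q_def)
    show "disjoint_family_on D I"
      unfolding disjoint_family_on_def D_def using crossing_unique by (auto simp: flippable_def)
    show "T r z \<in> D (\<iota> r)" if r: "r \<in> I" and z: "z \<in> D r" for r z
    proof -
      obtain a b s where abs: "r = (a, b, s)" by (cases r)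
      have zs: "z \<in> space Q" and f: "flippable \<theta> \<kappa> N a b s z" using z by (auto simp: D_def abs)
      have "flip \<theta> N a b s z \<in> space Q"
        using measurable_space[OF flip_measure_preserving(1)] zs r by (auto simp: I_def abs Q_def)
      then show ?thesis using flippable_flip[OF \<theta> ext[OF zs] f] by (auto simp: D_def T_def \<iota>_def abs)
    qed
    show "T (\<iota> r) (T r z) = z" if "r \<in> I" "z \<in> space Q" for r z
      using that flip_flip[OF \<theta> _ _ ext[OF that(2)]] by (auto simp: I_def T_def \<iota>_def)
  qed blast
  show ?thesis
  proof (rule that[OF \<Phi>(1-3)])
    show *: "\<Phi> z = flip \<theta> N a b s z" if "z \<in> space Q" "flippable \<theta> \<kappa> N a b s z" for a b s z
      using \<Phi>(4)[OF memI[OF that(2)]] that by (auto simp: D_def T_def)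
    show "\<theta> * \<bar>fst (\<Phi> z) - fst z\<bar> \<le> \<bar>\<kappa>\<bar>" for z
    proof (cases "\<exists>r\<in>I. z \<in> D r")
      case True
      then obtain a b s where f: "flippable \<theta> \<kappa> N a b s z" "z \<in> space Q" by (auto simp: D_def)
      have "\<theta> * \<bar>fst (\<Phi> z) - fst z\<bar> = \<theta> / \<bar>\<theta>\<bar> * \<bar>s + walk \<theta> z a - walk \<theta> z b\<bar>"
        unfolding *[OF f(2,1)] flip_def by (simp add: abs_divide)
      also have "\<dots> \<le> 1 * \<bar>s + walk \<theta> z a - walk \<theta> z b\<bar>"
        by (rule mult_right_mono) (auto simp: divide_le_eq)
      also have "\<dots> \<le> \<bar>\<kappa>\<bar>" using f by (auto simp: flippable_def)
      finally show ?thesis .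
    next
      case False then show ?thesis using \<Phi>(5)[of z] by force
    qed
  qed
qed

end

subsection \<open>Stability of the reversal\<close>

lemma compact_interval_less:
  fixes f :: "real \<Rightarrow> real"
  assumes "continuous_on {a..b} f" "\<And>t. t \<in> {a..b} \<Longrightarrow> f t < K"
  obtains m where "m < K" "\<And>t. t \<in> {a..b} \<Longrightarrow> f t \<le> m"
proof (cases "a \<le> b")
  case True
  then obtain x where "x \<in> {a..b}" "\<And>y. y \<in> {a..b} \<Longrightarrow> f y \<le> f x"
    using continuous_attains_sup[OF compact_Icc _ assms(1)] by auto
  then show ?thesis using that[of "f x"] assms(2) by auto
next
  case False then show ?thesis using that[of "K - 1"] by auto
qed

lemma grid_tendsto:
  fixes n :: "nat \<Rightarrow> nat"
  assumes n: "filterlim n at_top sequentially" and t: "0 \<le> t"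
  shows "(\<lambda>k. real (nat \<lfloor>real (n k) * t\<rfloor>) / real (n k)) \<longlonglongrightarrow> t"
proof (rule tendsto_sandwich)
  have inv: "(\<lambda>k. 1 / real (n k)) \<longlonglongrightarrow> 0"
    by (rule filterlim_compose[OF lim_1_over_n n])
  show "(\<lambda>k. t - 1 / real (n k)) \<longlonglongrightarrow> t" using tendsto_diff[OF tendsto_const inv, of t] by simp
  show "(\<lambda>k. t) \<longlonglongrightarrow> t" by simp
  have "\<forall>\<^sub>F k in sequentially. 1 \<le> n k" using n unfolding filterlim_at_top by blast
  then have pos: "\<forall>\<^sub>F k in sequentially. n k > 0" by eventually_elim simp
  show "\<forall>\<^sub>F k in sequentially. t - 1 / real (n k) \<le> real (nat \<lfloor>real (n k) * t\<rfloor>) / real (n k)"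
    using pos
  proof eventually_elim
    case (elim k)
    have "real (n k) * t - 1 \<le> real (nat \<lfloor>real (n k) * t\<rfloor>)" using t by linarith
    then have "(real (n k) * t - 1) / real (n k) \<le> real (nat \<lfloor>real (n k) * t\<rfloor>) / real (n k)"
      by (rule divide_right_mono) simp
    then show ?case using elim by (simp add: diff_divide_distrib)
  qed
  show "\<forall>\<^sub>F k in sequentially. real (nat \<lfloor>real (n k) * t\<rfloor>) / real (n k) \<le> t"
    using pos
  proof eventually_elim
    case (elim k)
    have "0 \<le> real (n k) * t" using t by simp
    then have "real (nat \<lfloor>real (n k) * t\<rfloor>) \<le> real (n k) * t" by linarith
    then show ?case using elim by (simp add: field_simps)
  qed
qed

section \<open>Hitting time and last zero of a continuous path\<close>

context
  fixes w :: "real \<Rightarrow> real"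
  assumes cont: "continuous_on {0..} w" and w0: "w 0 = 0" and hits: "\<exists>t\<ge>0. \<bar>w t\<bar> = 1"
begin

lemma cont_on: "0 \<le> a \<Longrightarrow> continuous_on {a..b} w"
  using cont by (rule continuous_on_subset) auto

lemma hit_time_props:
  shows "0 < hit_time w" "\<bar>w (hit_time w)\<bar> = 1" "\<And>t. 0 \<le> t \<Longrightarrow> t < hit_time w \<Longrightarrow> \<bar>w t\<bar> < 1"
proof -
  let ?S = "{t. 0 \<le> t \<and> \<bar>w t\<bar> = 1}"
  have S: "?S = {0..} \<inter> (\<lambda>t. \<bar>w t\<bar>) -` {1}" by auto
  have cl: "closed ?S" unfolding S by (intro continuous_closed_preimage continuous_intros cont)
  have ne: "?S \<noteq> {}" using hits by auto
  have bd: "bdd_below ?S" by (rule bdd_belowI[of _ 0]) auto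
  have mem: "hit_time w \<in> ?S" unfolding hit_time_def by (rule closed_contains_Inf[OF ne bd cl])
  then show 1: "\<bar>w (hit_time w)\<bar> = 1" by auto
  show "0 < hit_time w" using mem w0 by (cases "hit_time w = 0") auto
  show "\<bar>w t\<bar> < 1" if t: "0 \<le> t" "t < hit_time w" for t
  proof (rule ccontr)
    assume "\<not> \<bar>w t\<bar> < 1"
    then have "\<exists>x\<ge>0. x \<le> t \<and> \<bar>w x\<bar> = 1"
      by (intro IVT' t continuous_intros cont_on) (use w0 in auto)
    then obtain x where "x \<in> ?S" "x \<le> t" by auto
    then have "hit_time w \<le> t" unfolding hit_time_def using cInf_lower[OF _ bd] by force
    then show False using t by simp
  qed
qed

lemma last_zero_props:
  shows "0 \<le> last_zero w" "last_zero w < hit_time w" "w (last_zero w) = 0"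
    "\<And>t. last_zero w < t \<Longrightarrow> t \<le> hit_time w \<Longrightarrow> 0 < w (hit_time w) * w t"
proof -
  let ?\<tau> = "hit_time w"
  let ?Z = "{t. 0 \<le> t \<and> t < ?\<tau> \<and> w t = 0}"
  note h = hit_time_props
  \<comment> \<open>Although the set asks for \<open>t < ?\<tau>\<close>, it is closed: the path has
    modulus 1 at \<open>?\<tau>\<close>, so closing the interval adds no zero.\<close>
  have Z: "?Z = {0..?\<tau>} \<inter> w -` {0}" using h(2) by (auto simp: less_le)
  have cl: "closed ?Z" unfolding Z by (intro continuous_closed_preimage cont_on) auto
  have ne: "0 \<in> ?Z" using h(1) w0 by auto
  have bd: "bdd_above ?Z" by (rule bdd_aboveI[of _ ?\<tau>]) auto
  have mem: "last_zero w \<in> ?Z" unfolding last_zero_def using closed_contains_Sup[OF _ bd cl] ne by blast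
  then show a: "0 \<le> last_zero w" and "last_zero w < ?\<tau>" "w (last_zero w) = 0" by auto
  show "0 < w ?\<tau> * w t" if t: "last_zero w < t" "t \<le> ?\<tau>" for t
  proof (rule ccontr)
    assume n: "\<not> 0 < w ?\<tau> * w t"
    have "w ?\<tau> * w ?\<tau> = 1" using h(2) by (auto simp: abs_if split: if_splits)
    then have "\<exists>x\<ge>t. x \<le> ?\<tau> \<and> w ?\<tau> * w x = 0" using n t a
      by (intro IVT' continuous_intros cont_on) auto
    then obtain x where x: "t \<le> x" "x \<le> ?\<tau>" "w x = 0" using h(2) by auto
    then have "x \<in> ?Z" using t a Z by auto
    then have "x \<le> last_zero w" unfolding last_zero_def by (rule cSup_upper[OF _ bd])
    then show False using x t by simp
  qed
qed

end

text \<open>The paths at which the hitting time and the last zero are stable under small perturbations.\<close>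
definition good_path :: "(real \<Rightarrow> real) \<Rightarrow> bool" where
  "good_path w \<longleftrightarrow> continuous_on {0..} w \<and> w 0 = 0 \<and> (\<exists>t\<ge>0. \<bar>w t\<bar> = 1) \<and> 0 < last_zero w \<and>
     (\<forall>\<epsilon>>0. \<exists>t. hit_time w < t \<and> t < hit_time w + \<epsilon> \<and> 1 < w (hit_time w) * w t) \<and>
     (\<forall>\<epsilon>>0. \<exists>t\<ge>0. last_zero w - \<epsilon> < t \<and> t < last_zero w \<and> w (hit_time w) * w t < 0)"

section \<open>Grid samples of a good path with a vanishing offset\<close>

context
  fixes w :: "real \<Rightarrow> real" and n :: "nat \<Rightarrow> nat" and c :: "nat \<Rightarrow> real" and \<tau> g s :: real and y :: "nat \<Rightarrow> nat \<Rightarrow> real"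
  assumes good: "good_path w" and n: "filterlim n at_top sequentially" and c: "c \<longlonglongrightarrow> 0"
  defines "\<tau> \<equiv> hit_time w" and "g \<equiv> last_zero w" and "s \<equiv> w (hit_time w)"
    and "y \<equiv> \<lambda>k j. w (real j / real (n k)) + c k"
begin

lemma good_facts:
  shows "continuous_on {0..} w" "w 0 = 0" "\<exists>t\<ge>0. \<bar>w t\<bar> = 1" "0 < g" "g < \<tau>" "s = 1 \<or> s = -1"
    "w \<tau> = s" "w g = 0" "\<And>t. 0 \<le> t \<Longrightarrow> t < \<tau> \<Longrightarrow> \<bar>w t\<bar> < 1" "\<And>t. g < t \<Longrightarrow> t \<le> \<tau> \<Longrightarrow> 0 < s * w t"
proof -
  show 1: "continuous_on {0..} w" "w 0 = 0" "\<exists>t\<ge>0. \<bar>w t\<bar> = 1" "0 < g"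
    using good by (auto simp: good_path_def g_def)
  note h = hit_time_props[OF 1(1-3)] and l = last_zero_props[OF 1(1-3)]
  show "g < \<tau>" "s = 1 \<or> s = -1"
    "w \<tau> = s" "w g = 0" "\<And>t. 0 \<le> t \<Longrightarrow> t < \<tau> \<Longrightarrow> \<bar>w t\<bar> < 1" "\<And>t. g < t \<Longrightarrow> t \<le> \<tau> \<Longrightarrow> 0 < s * w t"
    using h l by (auto simp: g_def \<tau>_def s_def)
qed

lemma n_pos: "\<forall>\<^sub>F k in sequentially. 0 < n k"
proof -
  have "\<forall>\<^sub>F k in sequentially. 1 \<le> n k" using n unfolding filterlim_at_top by blast
  then show ?thesis by eventually_elim simp
qed

lemma y_tendsto:
  assumes "(\<lambda>k. real (j k) / real (n k)) \<longlonglongrightarrow> t"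
  shows "(\<lambda>k. y k (j k)) \<longlonglongrightarrow> w t"
proof -
  have t: "0 \<le> t" using assms by (rule LIMSEQ_le_const) auto
  have "(\<lambda>k. w (real (j k) / real (n k))) \<longlonglongrightarrow> w t"
    by (rule continuous_on_tendsto_compose[OF good_facts(1) assms]) (use t in auto)
  then show ?thesis unfolding y_def using tendsto_add[OF _ c] by fastforce
qed

text \<open>A strict inequality on a compact interval leaves a uniform gap, which eventually exceeds
  the offset \<open>c k\<close> and so passes to all grid points of the interval at once. The factor
  \<open>f\<close> serves to choose a sign.\<close>

lemma y_bound:
  assumes "\<And>t. t \<in> {p..q} \<Longrightarrow> f t * w t < K" "continuous_on {p..q} f" "0 \<le> p" "\<And>t. \<bar>f t\<bar> \<le> 1"
  shows "\<forall>\<^sub>F k in sequentially. \<forall>j. p \<le> real j / real (n k) \<and> real j / real (n k) \<le> q \<longrightarrow> f (real j / real (n k)) * y k j < K"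
proof -
  have cw: "continuous_on {p..q} w" using good_facts(1) by (rule continuous_on_subset) (use assms in auto)
  obtain m where m: "m < K" "\<And>t. t \<in> {p..q} \<Longrightarrow> f t * w t \<le> m"
    using compact_interval_less[of p q "\<lambda>t. f t * w t" K] assms cw by (auto intro: continuous_intros)
  have "\<forall>\<^sub>F k in sequentially. dist (c k) 0 < K - m" by (rule tendstoD[OF c]) (use m in auto)
  then show ?thesis
  proof eventually_elim
    case (elim k)
    have "f (real j / real (n k)) * y k j < K" if j: "p \<le> real j / real (n k)" "real j / real (n k) \<le> q" for j
    proof -
      have "\<bar>f (real j / real (n k)) * c k\<bar> \<le> 1 * \<bar>c k\<bar>" unfolding abs_mult by (intro mult_right_mono assms) auto
      then show ?thesis using m(2)[of "real j / real (n k)"] j elim by (simp add: y_def algebra_simps)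
    qed
    then show ?case by auto
  qed
qed

lemma y_abs_less:
  assumes "q < \<tau>"
  shows "\<forall>\<^sub>F k in sequentially. \<forall>j. real j / real (n k) \<le> q \<longrightarrow> \<bar>y k j\<bar> < 1"
proof -
  have "\<forall>\<^sub>F k in sequentially. \<forall>j. 0 \<le> real j / real (n k) \<and> real j / real (n k) \<le> q \<longrightarrow> 1 * y k j < 1"
    by (rule y_bound[where f="\<lambda>_. 1"]) (use good_facts(9) assms in \<open>auto simp: abs_less_iff\<close>)
  moreover have "\<forall>\<^sub>F k in sequentially. \<forall>j. 0 \<le> real j / real (n k) \<and> real j / real (n k) \<le> q \<longrightarrow> (-1) * y k j < 1"
    by (rule y_bound[where f="\<lambda>_. -1"]) (use good_facts(9) assms in \<open>auto simp: abs_less_iff\<close>)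
  ultimately show ?thesis by eventually_elim (auto simp: abs_less_iff)
qed

text \<open>Neither this index nor the next one is meaningful unless a witness exists, so what is
  known about them holds only for large \<open>k\<close>.\<close>

definition cross_end :: "nat \<Rightarrow> nat" where "cross_end k = (LEAST j. 1 \<le> \<bar>y k j\<bar>)"
definition cross_start :: "nat \<Rightarrow> nat" where "cross_start k = (GREATEST j. j < cross_end k \<and> s * y k j \<le> 0)"

text \<open>Shortly after \<tau> a good path lies strictly beyond the level, so a nearby grid sample
  is beyond it despite the offset; mere contact at \<tau> could be missed by the grid. Before
  \<open>\<tau> - \<epsilon>\<close> the modulus is bounded away from 1, which excludes an earlier
  exit.\<close>

lemma cross_end_ev:
  assumes "0 < \<epsilon>"
  shows "\<forall>\<^sub>F k in sequentially. 1 \<le> \<bar>y k (cross_end k)\<bar> \<and> \<tau> - \<epsilon> < real (cross_end k) / real (n k) \<and> real (cross_end k) / real (n k) < \<tau> + \<epsilon>"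
proof -
  obtain t where t: "\<tau> < t" "t < \<tau> + \<epsilon>" "1 < s * w t"
    using good assms unfolding good_path_def \<tau>_def s_def by blast
  define j where "j k = nat \<lfloor>real (n k) * t\<rfloor>" for k
  have t0: "0 \<le> t" using t good_facts by auto
  have jt: "(\<lambda>k. real (j k) / real (n k)) \<longlonglongrightarrow> t" unfolding j_def by (rule grid_tendsto[OF n t0])
  have "\<forall>\<^sub>F k in sequentially. 1 < s * y k (j k)"
    by (rule order_tendstoD(1)[OF tendsto_mult[OF tendsto_const y_tendsto[OF jt]]]) (use t in auto)
  moreover have "\<forall>\<^sub>F k in sequentially. real (j k) / real (n k) < \<tau> + \<epsilon>"
    by (rule order_tendstoD(2)[OF jt]) (use t in auto)
  moreover have "\<forall>\<^sub>F k in sequentially. \<forall>j. real j / real (n k) \<le> \<tau> - \<epsilon> \<longrightarrow> \<bar>y k j\<bar> < 1"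
    by (rule y_abs_less) (use assms in auto)
  ultimately show ?thesis using n_pos
  proof eventually_elim
    case (elim k)
    have j1: "1 \<le> \<bar>y k (j k)\<bar>" using elim(1) good_facts(6) by auto
    have b1: "1 \<le> \<bar>y k (cross_end k)\<bar>" unfolding cross_end_def by (rule LeastI[of _ "j k"]) (rule j1)
    have "cross_end k \<le> j k" unfolding cross_end_def by (rule Least_le) (rule j1)
    then have "real (cross_end k) / real (n k) \<le> real (j k) / real (n k)" using elim by (simp add: divide_right_mono)
    then show ?case using elim b1 by (meson not_less le_less_trans)
  qed
qed

lemma cross_end_tendsto: "(\<lambda>k. real (cross_end k) / real (n k)) \<longlonglongrightarrow> \<tau>"
proof (rule tendstoI)
  fix e :: real assume "0 < e"
  from cross_end_ev[OF this] show "\<forall>\<^sub>F k in sequentially. dist (real (cross_end k) / real (n k)) \<tau> < e"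
    by eventually_elim (auto simp: dist_real_def abs_less_iff)
qed

text \<open>Shortly before \<open>g\<close> a good path is strictly on the side opposite to
  \<open>s\<close>, which supplies a grid index with \<open>s * y k j < 0\<close>. From
  \<open>g + \<epsilon>\<close> onwards \<open>s * w\<close> is bounded away from 0 up to the exit,
  so no later index qualifies.\<close>

lemma cross_start_ev:
  assumes "0 < \<epsilon>"
  shows "\<forall>\<^sub>F k in sequentially. cross_start k < cross_end k \<and> s * y k (cross_start k) \<le> 0 \<and> (\<forall>j. cross_start k < j \<and> j < cross_end k \<longrightarrow> 0 < s * y k j) \<and>
     g - \<epsilon> < real (cross_start k) / real (n k) \<and> real (cross_start k) / real (n k) < g + \<epsilon>"
proof -
  obtain t where t: "0 \<le> t" "g - \<epsilon> < t" "t < g" "s * w t < 0"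
    using good assms unfolding good_path_def g_def s_def by blast
  define j where "j k = nat \<lfloor>real (n k) * t\<rfloor>" for k
  have jt: "(\<lambda>k. real (j k) / real (n k)) \<longlonglongrightarrow> t" unfolding j_def by (rule grid_tendsto[OF n t(1)])
  have "\<forall>\<^sub>F k in sequentially. s * y k (j k) < 0"
    by (rule order_tendstoD(2)[OF tendsto_mult[OF tendsto_const y_tendsto[OF jt]]]) (use t in auto)
  moreover have "\<forall>\<^sub>F k in sequentially. g - \<epsilon> < real (j k) / real (n k)"
    by (rule order_tendstoD(1)[OF jt]) (use t in auto)
  moreover have "\<forall>\<^sub>F k in sequentially. real (j k) / real (n k) < g"
    by (rule order_tendstoD(2)[OF jt]) (use t in auto)
  moreover have "\<forall>\<^sub>F k in sequentially. g < real (cross_end k) / real (n k)"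
    by (rule order_tendstoD(1)[OF cross_end_tendsto]) (use good_facts in auto)
  \<comment> \<open>The exit index of the samples may lie slightly to the right of \<tau>, so
    positivity is needed a little beyond \<tau>.\<close>
  moreover have "\<exists>\<eta>>0. \<forall>t\<in>{g+\<epsilon>..\<tau>+\<eta>}. 0 < s * w t"
  proof -
    have "continuous_on {0..} (\<lambda>t. s * w t)" by (intro continuous_intros good_facts(1))
    moreover have "\<tau> \<in> {0..}" "0 < s * w \<tau>" using good_facts by auto
    ultimately obtain d where d: "d > 0" "\<And>t. t \<in> {0..} \<Longrightarrow> dist t \<tau> < d \<Longrightarrow> dist (s * w t) (s * w \<tau>) < s * w \<tau>"
      unfolding continuous_on_iff by blast
    have "0 < s * w t" if t: "t \<in> {g+\<epsilon>..\<tau>+d/2}" for t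
    proof (cases "t \<le> \<tau>")
      case True then show ?thesis using good_facts(10) t assms by auto
    next
      case False
      then have "dist (s * w t) (s * w \<tau>) < s * w \<tau>" using d t good_facts by (intro d) (auto simp: dist_real_def)
      then show ?thesis by (auto simp: dist_real_def)
    qed
    then show ?thesis using d(1) by (intro exI[of _ "d/2"]) auto
  qed
  then obtain \<eta> where \<eta>: "\<eta> > 0" "\<And>t. t \<in> {g+\<epsilon>..\<tau>+\<eta>} \<Longrightarrow> 0 < s * w t" by blast
  have "\<forall>\<^sub>F k in sequentially. \<forall>j. g + \<epsilon> \<le> real j / real (n k) \<and> real j / real (n k) \<le> \<tau> + \<eta> \<longrightarrow> (- s) * y k j < 0"
    by (rule y_bound[where f="\<lambda>_. -s"]) (use \<eta> good_facts assms in auto)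
  moreover have "\<forall>\<^sub>F k in sequentially. real (cross_end k) / real (n k) < \<tau> + \<eta>"
    by (rule order_tendstoD(2)[OF cross_end_tendsto]) (use \<eta> in auto)
  ultimately show ?thesis using n_pos
  proof eventually_elim
    case (elim k)
    have np: "0 < real (n k)" using elim by simp
    have "real (j k) / real (n k) < real (cross_end k) / real (n k)" using elim by linarith
    then have jb: "j k < cross_end k" using np by (simp add: divide_less_cancel)
    let ?P = "\<lambda>j. j < cross_end k \<and> s * y k j \<le> 0"
    have Pj: "?P (j k)" using jb elim by auto
    have Pa: "?P (cross_start k)" unfolding cross_start_def by (rule GreatestI_nat[of ?P _ "cross_end k", OF Pj]) auto
    have mx: "j \<le> cross_start k" if "?P j" for j unfolding cross_start_def by (rule Greatest_le_nat[of ?P _ "cross_end k", OF that]) auto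
    have "real (j k) / real (n k) \<le> real (cross_start k) / real (n k)" using mx[OF Pj] np by (simp add: divide_right_mono)
    moreover have "real (cross_start k) / real (n k) < g + \<epsilon>"
    proof (rule ccontr)
      assume "\<not> real (cross_start k) / real (n k) < g + \<epsilon>"
      moreover have "real (cross_start k) / real (n k) \<le> real (cross_end k) / real (n k)" using Pa np by (simp add: divide_right_mono)
      ultimately have "(- s) * y k (cross_start k) < 0" using elim by (meson le_less_trans less_imp_le not_le)
      then show False using Pa by auto
    qed
    ultimately show ?case using Pa mx elim by (meson not_le less_le_trans)
  qed
qed

lemma cross_start_tendsto: "(\<lambda>k. real (cross_start k) / real (n k)) \<longlonglongrightarrow> g"
proof (rule tendstoI)
  fix e :: real assume "0 < e"
  from cross_start_ev[OF this] show "\<forall>\<^sub>F k in sequentially. dist (real (cross_start k) / real (n k)) g < e"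
    by eventually_elim (auto simp: dist_real_def abs_less_iff)
qed

lemma crossing_ev: "\<forall>\<^sub>F k in sequentially. crossing (y k) (cross_start k) (cross_end k) s"
proof -
  \<comment> \<open>This fixes the side of the exit: the sampled values there converge to
    \<open>w \<tau> = s\<close>, so the samples cannot leave through \<open>-s\<close>.\<close>
  have "\<forall>\<^sub>F k in sequentially. 0 < s * y k (cross_end k)"
    by (rule order_tendstoD(1)[OF tendsto_mult[OF tendsto_const y_tendsto[OF cross_end_tendsto]]]) (use good_facts in auto)
  then show ?thesis using cross_start_ev[OF zero_less_one] cross_end_ev[OF zero_less_one]
  proof eventually_elim
    case (elim k)
    have "\<bar>y k j\<bar> < 1" if "j < cross_end k" for j using not_less_Least[of j "\<lambda>j. 1 \<le> \<bar>y k j\<bar>"] that by (auto simp: cross_end_def)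
    moreover have "1 \<le> s * y k (cross_end k)" using elim good_facts(6) by auto
    ultimately show ?case using elim good_facts(6) unfolding crossing_def by auto
  qed
qed

lemma shift_tendsto: "(\<lambda>k. s + y k (cross_start k) - y k (cross_end k)) \<longlonglongrightarrow> 0"
proof -
  have "(\<lambda>k. s + y k (cross_start k) - y k (cross_end k)) \<longlonglongrightarrow> s + w g - w \<tau>"
    by (intro tendsto_intros y_tendsto cross_start_tendsto cross_end_tendsto)
  then show ?thesis using good_facts by simp
qed

text \<open>These are the two smallness conditions of \<open>crossing_flip\<close>. Indices before
  \<open>cross_start\<close> correspond to times below the midpoint \<open>q\<close> of
  \<open>g\<close> and \<tau>, where the modulus stays at most some \<open>m < 1\<close>; the gap
  absorbs the offset and the vanishing correction.\<close>

lemma shifted_ev: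
  "\<forall>\<^sub>F k in sequentially. (\<forall>j<cross_start k. \<bar>y k j - (s + y k (cross_start k) - y k (cross_end k))\<bar> < 1) \<and> \<bar>y k (cross_end k) - s\<bar> < 1"
proof -
  define q where "q = (g + \<tau>) / 2"
  have q: "g < q" "q < \<tau>" using good_facts by (auto simp: q_def)
  have cw: "continuous_on {0..q} (\<lambda>t. \<bar>w t\<bar>)"
    by (intro continuous_intros continuous_on_subset[OF good_facts(1)]) auto
  obtain m where m: "m < 1" "\<And>t. t \<in> {0..q} \<Longrightarrow> \<bar>w t\<bar> \<le> m"
    using compact_interval_less[OF cw, of 1] good_facts(9) q by auto
  have "\<forall>\<^sub>F k in sequentially. \<bar>c k - (s + y k (cross_start k) - y k (cross_end k))\<bar> < 1 - m"
    using order_tendstoD(2)[OF tendsto_rabs[OF tendsto_diff[OF c shift_tendsto]], of "1 - m"] m by simp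
  moreover have "\<forall>\<^sub>F k in sequentially. real (cross_start k) / real (n k) < q"
    by (rule order_tendstoD(2)[OF cross_start_tendsto q(1)])
  moreover have "\<forall>\<^sub>F k in sequentially. \<bar>y k (cross_end k) - s\<bar> < 1"
    using order_tendstoD(2)[OF tendsto_rabs[OF tendsto_diff[OF y_tendsto[OF cross_end_tendsto] tendsto_const]], of s 1] good_facts by simp
  ultimately show ?thesis using n_pos
  proof eventually_elim
    case (elim k)
    have "\<bar>y k j - (s + y k (cross_start k) - y k (cross_end k))\<bar> < 1" if "j < cross_start k" for j
    proof -
      have "real j / real (n k) \<le> real (cross_start k) / real (n k)" using that elim by (simp add: divide_right_mono)
      then have "\<bar>w (real j / real (n k))\<bar> \<le> m" using elim by (intro m) auto
      then show ?thesis using elim(1) unfolding y_def by linarith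
    qed
    then show ?case using elim by auto
  qed
qed

text \<open>The sequence is the formula of \<open>walk_flip\<close>. At \<open>t = g\<close> and
  \<open>t = \<tau>\<close> the active branch may change infinitely often with \<open>k\<close>, but
  the two adjacent branches then have the same limit.\<close>

lemma reversed_tendsto:
  assumes t: "0 \<le> t"
  defines "J \<equiv> \<lambda>k. nat \<lfloor>real (n k) * t\<rfloor>"
  shows "(\<lambda>k. if J k \<le> cross_start k then y k (J k) - (s + y k (cross_start k) - y k (cross_end k))
     else if J k \<le> cross_end k then y k (cross_start k + cross_end k - J k) - s
     else y k (J k) + y k (cross_start k) - y k (cross_end k) - s) \<longlonglongrightarrow> qtr w t" (is "?f \<longlonglongrightarrow> _")
proof -
  have Jt: "(\<lambda>k. real (J k) / real (n k)) \<longlonglongrightarrow> t" unfolding J_def by (rule grid_tendsto[OF n t])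
  have qtr: "qtr w t = (if t < g then w t else if t < \<tau> then w (g + \<tau> - t) - s else w t - 2 * s)"
    using good_facts(3,6) unfolding qtr_def Let_def g_def \<tau>_def s_def by auto
  let ?f1 = "\<lambda>k. y k (J k) - (s + y k (cross_start k) - y k (cross_end k))"
  let ?f2 = "\<lambda>k. y k (cross_start k + cross_end k - J k) - s"
  let ?f3 = "\<lambda>k. y k (J k) + y k (cross_start k) - y k (cross_end k) - s"
  have f1: "?f1 \<longlonglongrightarrow> w t" using tendsto_diff[OF y_tendsto[OF Jt] shift_tendsto] by simp
  have f3: "?f3 \<longlonglongrightarrow> w t - 2 * s"
  proof -
    have "?f3 \<longlonglongrightarrow> w t + w g - w \<tau> - s" by (intro tendsto_intros y_tendsto Jt cross_start_tendsto cross_end_tendsto)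
    then show ?thesis using good_facts by simp
  qed
  have f2: "?f2 \<longlonglongrightarrow> w (g + \<tau> - t) - s" if "t \<le> \<tau>"
  proof (intro tendsto_intros y_tendsto)
    \<comment> \<open>The maximum with 0 reproduces the truncated subtraction of natural numbers; it
      is inactive in the limit since \<open>t \<le> \<tau>\<close>.\<close>
    have "(\<lambda>k. max 0 (real (cross_start k) / real (n k) + real (cross_end k) / real (n k) - real (J k) / real (n k))) \<longlonglongrightarrow> max 0 (g + \<tau> - t)"
      by (intro tendsto_intros cross_start_tendsto cross_end_tendsto Jt)
    also have "max 0 (g + \<tau> - t) = g + \<tau> - t" using that good_facts by auto
    also have "(\<lambda>k. max 0 (real (cross_start k) / real (n k) + real (cross_end k) / real (n k) - real (J k) / real (n k))) =
        (\<lambda>k. real (cross_start k + cross_end k - J k) / real (n k))"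
    proof
      fix k
      show "max 0 (real (cross_start k) / real (n k) + real (cross_end k) / real (n k) - real (J k) / real (n k)) = real (cross_start k + cross_end k - J k) / real (n k)"
        by (cases "J k \<le> cross_start k + cross_end k")
          (simp_all add: of_nat_diff max_def add_divide_distrib[symmetric] diff_divide_distrib[symmetric] divide_le_0_iff zero_le_divide_iff)
    qed
    finally show "(\<lambda>k. real (cross_start k + cross_end k - J k) / real (n k)) \<longlonglongrightarrow> g + \<tau> - t" .
  qed
  have lt: "\<forall>\<^sub>F k in sequentially. i k < j k"
    if "(\<lambda>k. real (i k) / real (n k)) \<longlonglongrightarrow> p" "(\<lambda>k. real (j k) / real (n k)) \<longlonglongrightarrow> q" "p < q" for i j :: "nat \<Rightarrow> nat" and p q
  proof -
    have "\<forall>\<^sub>F k in sequentially. 0 < real (j k) / real (n k) - real (i k) / real (n k)"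
      using order_tendstoD(1)[OF tendsto_diff[OF that(2,1)], of 0] that(3) by simp
    then show ?thesis using n_pos by eventually_elim (auto simp: divide_less_cancel)
  qed
  have two: "f \<longlonglongrightarrow> l" if "u \<longlonglongrightarrow> l" "v \<longlonglongrightarrow> l" "\<forall>\<^sub>F k in sequentially. f k = u k \<or> f k = v k"
    for f u v :: "nat \<Rightarrow> real" and l
  proof (rule tendstoI)
    fix e :: real assume e: "0 < e"
    show "\<forall>\<^sub>F k in sequentially. dist (f k) l < e"
      using tendstoD[OF that(1) e] tendstoD[OF that(2) e] that(3)
    proof eventually_elim
      case (elim k) then show ?case by auto
    qed
  qed
  have ab: "\<forall>\<^sub>F k in sequentially. cross_start k < cross_end k" by (rule lt[OF cross_start_tendsto cross_end_tendsto]) (use good_facts in auto)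
  consider "t < g" | "t = g" | "g < t" "t < \<tau>" | "t = \<tau>" | "\<tau> < t" by linarith
  then show ?thesis
  proof cases
    case 1
    have "\<forall>\<^sub>F k in sequentially. ?f k = ?f1 k \<or> ?f k = ?f1 k" using lt[OF Jt cross_start_tendsto 1] by eventually_elim auto
    then have "?f \<longlonglongrightarrow> w t" by (rule two[OF f1 f1])
    then show ?thesis unfolding qtr using 1 by simp
  next
    case 2
    have "t < \<tau>" using 2 good_facts by simp
    have ev: "\<forall>\<^sub>F k in sequentially. ?f k = ?f1 k \<or> ?f k = ?f2 k" using lt[OF Jt cross_end_tendsto \<open>t < \<tau>\<close>] by eventually_elim auto
    have "?f2 \<longlonglongrightarrow> w t" using f2 \<open>t < \<tau>\<close> 2 good_facts by simp
    then have "?f \<longlonglongrightarrow> w t" by (rule two[OF f1 _ ev])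
    then show ?thesis unfolding qtr using 2 good_facts by simp
  next
    case 3
    have "\<forall>\<^sub>F k in sequentially. ?f k = ?f2 k \<or> ?f k = ?f2 k"
      using lt[OF Jt cross_end_tendsto 3(2)] lt[OF cross_start_tendsto Jt 3(1)] by eventually_elim auto
    then have "?f \<longlonglongrightarrow> w (g + \<tau> - t) - s" using 3 by (intro two[OF f2 f2]) auto
    then show ?thesis unfolding qtr using 3 by simp
  next
    case 4
    have "g < t" using 4 good_facts by simp
    have ev: "\<forall>\<^sub>F k in sequentially. ?f k = ?f2 k \<or> ?f k = ?f3 k" using lt[OF cross_start_tendsto Jt \<open>g < t\<close>] by eventually_elim auto
    have "?f2 \<longlonglongrightarrow> w t - 2 * s" using f2 4 good_facts by simp
    then have "?f \<longlonglongrightarrow> w t - 2 * s" by (rule two[OF _ f3 ev])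
    then show ?thesis unfolding qtr using 4 good_facts by simp
  next
    case 5
    have "\<forall>\<^sub>F k in sequentially. ?f k = ?f3 k \<or> ?f k = ?f3 k"
      using lt[OF cross_end_tendsto Jt 5] ab by eventually_elim auto
    then have "?f \<longlonglongrightarrow> w t - 2 * s" by (rule two[OF f3 f3])
    then show ?thesis unfolding qtr using 5 good_facts by simp
  qed
qed

end

subsection \<open>Almost sure path properties\<close>

context prob_space
begin

text \<open>Measurable covers of small probability handle exceptional sets that are described by
  quantifiers over a continuum of times.\<close>

lemma AE_smallI:
  assumes "\<And>e. 0 < e \<Longrightarrow> \<exists>A\<in>events. prob A \<le> e \<and> {\<omega>\<in>space M. \<not> P \<omega>} \<subseteq> A"
  shows "AE \<omega> in M. P \<omega>"
proof -
  have "\<forall>n. \<exists>A. A \<in> events \<and> prob A \<le> 1 / real (Suc n) \<and> {\<omega>\<in>space M. \<not> P \<omega>} \<subseteq> A"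
    using assms[of "1 / real (Suc _)"] by (metis of_nat_0_less_iff zero_less_Suc zero_less_divide_1_iff)
  then obtain A where A: "\<And>n. A n \<in> events" "\<And>n. prob (A n) \<le> 1 / real (Suc n)" "\<And>n. {\<omega>\<in>space M. \<not> P \<omega>} \<subseteq> A n"
    by metis
  have ev: "(\<Inter>n. A n) \<in> events" using A by auto
  have "prob (\<Inter>n. A n) \<le> 0"
  proof (rule LIMSEQ_le_const[OF LIMSEQ_inverse_real_of_nat], intro exI allI impI)
    fix n
    have "prob (\<Inter>n. A n) \<le> prob (A n)" using A by (intro finite_measure_mono) auto
    then show "prob (\<Inter>n. A n) \<le> inverse (real (Suc n))" using A(2)[of n] by (simp add: inverse_eq_divide)
  qed
  then have "prob (\<Inter>n. A n) = 0" using measure_nonneg[of M "\<Inter>n. A n"] by linarith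
  then have "emeasure M (\<Inter>n. A n) = 0" by (simp add: emeasure_eq_measure)
  then show ?thesis using ev A(3) by (intro AE_I[of _ _ "\<Inter>n. A n"]) auto
qed

section \<open>Gaussian anticoncentration and approximation of maxima\<close>

lemma normal_density_le: 
  assumes "0 < \<sigma>" shows "normal_density \<mu> \<sigma> x \<le> 1 / \<sigma>"
proof -
  have "1 * \<sigma>\<^sup>2 \<le> (2 * pi) * \<sigma>\<^sup>2" using pi_gt3 by (intro mult_right_mono) auto
  then have "sqrt (\<sigma>\<^sup>2) \<le> sqrt (2 * pi * \<sigma>\<^sup>2)" by (intro real_sqrt_le_mono) simp
  then have "1 / sqrt (2 * pi * \<sigma>\<^sup>2) \<le> 1 / \<sigma>" using assms by (intro divide_left_mono) auto
  moreover have "exp (-(x-\<mu>)\<^sup>2/(2 * \<sigma>\<^sup>2)) \<le> 1" by (simp add: divide_nonneg_nonneg)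
  then have "normal_density \<mu> \<sigma> x \<le> 1 / sqrt (2 * pi * \<sigma>\<^sup>2) * 1"
    unfolding normal_density_def by (intro mult_left_mono) auto
  ultimately show ?thesis by simp
qed

lemma normal_interval_bound:
  assumes \<sigma>: "0 < \<sigma>" and X: "distributed M lborel X (normal_density 0 \<sigma>)" and e: "0 \<le> e"
  shows "emeasure (distr M borel X) {l - e..l + e} \<le> ennreal (2 * e / \<sigma>)"
proof -
  have "distr M borel X = distr M lborel X" by (rule distr_cong) auto
  then have "distr M borel X = density lborel (normal_density 0 \<sigma>)" using X by (simp add: distributed_distr_eq_density)
  then have "emeasure (distr M borel X) {l - e..l + e} =
      (\<integral>\<^sup>+x. ennreal (normal_density 0 \<sigma> x) * indicator {l - e..l + e} x \<partial>lborel)"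
    by (simp add: emeasure_density)
  also have "\<dots> \<le> (\<integral>\<^sup>+x. ennreal (1 / \<sigma>) * indicator {l - e..l + e} x \<partial>lborel)"
    using normal_density_le[OF \<sigma>] by (intro nn_integral_mono mult_right_mono ennreal_leI) auto
  also have "\<dots> = ennreal (1 / \<sigma>) * emeasure lborel {l - e..l + e}" by (rule nn_integral_cmult_indicator) simp
  also have "\<dots> = ennreal (2 * e / \<sigma>)" using e \<sigma> by (simp flip: ennreal_mult)
  finally show ?thesis .
qed

text \<open>Given \<open>Z\<close>, the variable \<open>X\<close> has to fall into an interval of
  length \<open>2 * e\<close>, and its density is at most \<open>1 / \<sigma>\<close> there. Adding
  an independent variable therefore cannot create atoms.\<close>

lemma indep_normal_bound:
  assumes \<sigma>: "0 < \<sigma>" and X: "distributed M lborel X (normal_density 0 \<sigma>)" and e: "0 \<le> e"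
    and ind: "indep_var borel X borel Z"
  shows "prob {\<omega>\<in>space M. \<bar>X \<omega> + Z \<omega> - l\<bar> \<le> e} \<le> 2 * e / \<sigma>"
proof -
  have rv[measurable]: "X \<in> borel_measurable M" "Z \<in> borel_measurable M"
    using indep_var_rv1[OF ind] indep_var_rv2[OF ind] by auto
  interpret DX: prob_space "distr M borel X" by (rule prob_space_distr) simp
  interpret DZ: prob_space "distr M borel Z" by (rule prob_space_distr) simp
  interpret pair_sigma_finite "distr M borel X" "distr M borel Z" ..
  let ?A = "{z::real\<times>real. \<bar>fst z + snd z - l\<bar> \<le> e}"
  have "closed ?A" by (intro closed_Collect_le continuous_intros)
  then have A: "?A \<in> sets borel" by auto
  have A2: "?A \<in> sets (borel \<Otimes>\<^sub>M borel)" by (subst borel_prod) (rule A)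
  have A': "?A \<in> sets (distr M borel X \<Otimes>\<^sub>M distr M borel Z)"
    using A2 by (simp cong: sets_pair_measure_cong)
  have "emeasure M {\<omega>\<in>space M. \<bar>X \<omega> + Z \<omega> - l\<bar> \<le> e} = emeasure (distr M (borel \<Otimes>\<^sub>M borel) (\<lambda>\<omega>. (X \<omega>, Z \<omega>))) ?A"
    using A2 by (subst emeasure_distr) (auto intro!: arg_cong[where f="emeasure M"])
  also have "distr M (borel \<Otimes>\<^sub>M borel) (\<lambda>\<omega>. (X \<omega>, Z \<omega>)) = distr M borel X \<Otimes>\<^sub>M distr M borel Z"
    using ind by (simp add: indep_var_distribution_eq)
  also have "emeasure \<dots> ?A = (\<integral>\<^sup>+z. emeasure (distr M borel X) ((\<lambda>x. (x, z)) -` ?A) \<partial>distr M borel Z)"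
    by (rule emeasure_pair_measure_alt2[OF A'])
  also have "\<dots> \<le> (\<integral>\<^sup>+z. ennreal (2 * e / \<sigma>) \<partial>distr M borel Z)"
  proof (rule nn_integral_mono)
    fix z
    have "(\<lambda>x. (x, z)) -` ?A = {(l - z) - e..(l - z) + e}" by (auto simp: abs_le_iff)
    then show "emeasure (distr M borel X) ((\<lambda>x. (x, z)) -` ?A) \<le> ennreal (2 * e / \<sigma>)"
      using normal_interval_bound[OF \<sigma> X e] by simp
  qed
  also have "\<dots> = ennreal (2 * e / \<sigma>)" using DZ.emeasure_space_1 by simp
  finally show ?thesis using e \<sigma> by (simp add: emeasure_eq_measure)
qed

text \<open>The limit inferior of the events is an increasing union of tail intersections, each
  contained in a single \<open>A k\<close>.\<close>

lemma prob_eventually_le: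
  fixes A :: "nat \<Rightarrow> 'a set"
  assumes A: "\<And>m. A m \<in> events" "\<And>m. prob (A m) \<le> c"
  shows "(\<Union>k. \<Inter>m\<in>{k..}. A m) \<in> events" "prob (\<Union>k. \<Inter>m\<in>{k..}. A m) \<le> c"
proof -
  have ev: "(\<Inter>m\<in>{k..}. A m) \<in> events" for k using A by auto
  then show "(\<Union>k. \<Inter>m\<in>{k..}. A m) \<in> events" by auto
  have "(\<lambda>k. prob (\<Inter>m\<in>{k..}. A m)) \<longlonglongrightarrow> prob (\<Union>k. \<Inter>m\<in>{k..}. A m)"
    using ev by (intro finite_Lim_measure_incseq) (auto simp: incseq_def)
  moreover have "prob (\<Inter>m\<in>{k..}. A m) \<le> c" for k
    using finite_measure_mono[OF _ A(1)[of k], of "\<Inter>m\<in>{k..}. A m"] A(2)[of k] by (force intro: order_trans)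
  ultimately show "prob (\<Union>k. \<Inter>m\<in>{k..}. A m) \<le> c" by (intro LIMSEQ_le_const2) auto
qed

end

lemma continuous_Max_grid:
  fixes f :: "real \<Rightarrow> real"
  assumes f: "continuous_on {p..q} f" and pq: "p < q" and le: "\<And>t. t \<in> {p..q} \<Longrightarrow> f t \<le> l" and ex: "\<exists>t\<in>{p..q}. f t = l"
  shows "(\<lambda>m. Max ((\<lambda>i. f (p + (q - p) * real i / real (Suc m))) ` {..m})) \<longlonglongrightarrow> l"
proof (rule tendstoI)
  fix e :: real assume e: "0 < e"
  obtain t where t: "t \<in> {p..q}" "f t = l" using ex by auto
  obtain d where d: "d > 0" "\<And>x. x \<in> {p..q} \<Longrightarrow> dist x t < d \<Longrightarrow> dist (f x) (f t) < e"
    using f t e unfolding continuous_on_iff by blast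
  have "\<forall>\<^sub>F m in sequentially. (q - p) / real (Suc m) < d"
  proof -
    have "(\<lambda>m. (q - p) * inverse (real (Suc m))) \<longlonglongrightarrow> (q - p) * 0" by (intro tendsto_intros LIMSEQ_inverse_real_of_nat)
    then show ?thesis using d(1) by (auto dest!: order_tendstoD(2)[of _ _ _ d] simp: divide_inverse)
  qed
  then show "\<forall>\<^sub>F m in sequentially. dist (Max ((\<lambda>i. f (p + (q - p) * real i / real (Suc m))) ` {..m})) l < e"
  proof eventually_elim
    case (elim m)
    define x where "x i = p + (q - p) * real i / real (Suc m)" for i
    have xin: "x i \<in> {p..q}" if "i \<le> m" for i
    proof -
      have "(q - p) * real i / real (Suc m) \<le> (q - p) * 1"
        using pq that unfolding times_divide_eq_right[symmetric] by (intro mult_left_mono) auto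
      then show ?thesis using pq by (auto simp: x_def)
    qed
    have up: "Max ((\<lambda>i. f (x i)) ` {..m}) \<le> l" using le xin by (intro Max.boundedI) auto
    have "\<exists>i\<le>m. dist (x i) t < d"
    proof -
      define r where "r = (t - p) / (q - p) * real (Suc m)"
      have r: "0 \<le> r" "r \<le> real (Suc m)" using t pq by (auto simp: r_def divide_le_eq mult_left_le_one_le mult_right_le_one_le)
      \<comment> \<open>The grid stops one step short of \<open>q\<close>, so for
        \<open>t = q\<close> the index is cut back to \<open>m\<close>, at a distance of exactly one
        step.\<close>
      define i where "i = min m (nat \<lfloor>r\<rfloor>)"
      have "\<bar>r - real i\<bar> \<le> 1"
      proof (cases "nat \<lfloor>r\<rfloor> \<le> m")
        case True then show ?thesis using r unfolding i_def by (simp add: min_def) linarith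
      next
        case False
        then have "real (Suc m) \<le> real (nat \<lfloor>r\<rfloor>)" by (simp del: of_nat_Suc)
        then have "r = real (Suc m)" using r by linarith
        then show ?thesis using False by (simp add: i_def min_def)
      qed
      have "t = p + (q - p) * r / real (Suc m)" using pq by (simp add: r_def)
      then have "t - x i = (q - p) / real (Suc m) * (r - real i)" unfolding x_def by (simp add: field_simps)
      then have "\<bar>t - x i\<bar> = (q - p) / real (Suc m) * \<bar>r - real i\<bar>" using pq by (simp add: abs_mult)
      also have "\<dots> \<le> (q - p) / real (Suc m) * 1" using pq \<open>\<bar>r - real i\<bar> \<le> 1\<close> by (intro mult_left_mono) auto
      finally show ?thesis using elim by (intro exI[of _ i]) (auto simp: dist_real_def i_def)
    qed
    then obtain i where i: "i \<le> m" "dist (x i) t < d" by auto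
    then have "dist (f (x i)) l < e" using d(2)[OF xin[OF i(1)]] t by simp
    moreover have "f (x i) \<le> Max ((\<lambda>i. f (x i)) ` {..m})" using i by (intro Max_ge) auto
    ultimately show ?case using up unfolding x_def dist_real_def by linarith
  qed
qed

section \<open>Extrema and oscillation of Brownian paths\<close>

locale std_bm = prob_space M for M :: "'a measure" +
  fixes W :: "real \<Rightarrow> 'a \<Rightarrow> real"
  assumes bm: "std_brownian_motion M W"
begin

lemma W_meas: "0 \<le> t \<Longrightarrow> W t \<in> borel_measurable M"
  and W_0: "\<omega> \<in> space M \<Longrightarrow> W 0 \<omega> = 0"
  and W_cont: "\<omega> \<in> space M \<Longrightarrow> continuous_on {0..} (\<lambda>t. W t \<omega>)"
  and W_dist: "0 \<le> s \<Longrightarrow> s < t \<Longrightarrow> distributed M lborel (\<lambda>\<omega>. W t \<omega> - W s \<omega>) (normal_density 0 (sqrt (t - s)))"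
  and W_indep: "0 \<le> ts (0::nat) \<Longrightarrow> (\<And>i. i < n \<Longrightarrow> ts i < ts (Suc i)) \<Longrightarrow>
     indep_vars (\<lambda>_. borel) (\<lambda>i \<omega>. W (ts (Suc i)) \<omega> - W (ts i) \<omega>) {..<n}"
  using bm unfolding std_brownian_motion_def by auto

text \<open>By this symmetry, facts about upper levels and positive values carry over to lower
  levels and negative values; it also yields the symmetry of the step law.\<close>

lemma uminus_bm: "std_bm M (\<lambda>t \<omega>. - W t \<omega>)"
proof unfold_locales
  show "std_brownian_motion M (\<lambda>t \<omega>. - W t \<omega>)"
    unfolding std_brownian_motion_def
  proof (intro conjI allI impI ballI)
    show "(\<lambda>\<omega>. - W t \<omega>) \<in> borel_measurable M" if "0 \<le> t" for t using W_meas[OF that] by simp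
    show "- W 0 \<omega> = 0" "continuous_on {0..} (\<lambda>t. - W t \<omega>)" if "\<omega> \<in> space M" for \<omega>
      using W_0 W_cont that by (auto intro: continuous_intros)
    show "distributed M lborel (\<lambda>\<omega>. - W t \<omega> - - W s \<omega>) (normal_density 0 (sqrt (t - s)))" if "0 \<le> s \<and> s < t" for s t
      using normal_density_affine[OF W_dist[of s t], of "-1" 0] that by simp
    show "indep_vars (\<lambda>_. borel) (\<lambda>i \<omega>. - W (ts (Suc i)) \<omega> - - W (ts i) \<omega>) {..<n}"
      if "0 \<le> ts 0 \<and> (\<forall>i<n. ts i < ts (Suc i))" for n :: nat and ts :: "nat \<Rightarrow> real"
    proof -
      have "indep_vars (\<lambda>_. borel) (\<lambda>i \<omega>. - (W (ts (Suc i)) \<omega> - W (ts i) \<omega>)) {..<n}"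
        using indep_vars_compose2[OF W_indep[of ts n], of "\<lambda>_. uminus" "\<lambda>_. borel"] that by simp
      then show ?thesis by (simp add: algebra_simps)
    qed
  qed
qed

lemma AE_hits: "AE \<omega> in M. \<exists>t\<ge>0. \<bar>W t \<omega>\<bar> = 1"
proof (rule AE_smallI)
  fix e :: real assume e: "0 < e"
  \<comment> \<open>A path that never meets the levels is inside \<open>(-1, 1)\<close> at time
    \<open>T\<close>, which has probability at most \<open>2 / sqrt T\<close>; this \<open>T\<close>
    makes the bound equal to \<open>e\<close>.\<close>
  define T where "T = (2 / e)\<^sup>2"
  have T: "0 < T" "sqrt T = 2 / e" using e by (auto simp: T_def)
  let ?A = "{\<omega>\<in>space M. W T \<omega> - W 0 \<omega> \<in> {0 - 1..0 + 1}}"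
  have [measurable]: "W T \<in> borel_measurable M" "W 0 \<in> borel_measurable M" using W_meas T by auto
  have A: "?A \<in> events" by measurable
  have "emeasure M ?A = emeasure (distr M borel (\<lambda>\<omega>. W T \<omega> - W 0 \<omega>)) {0 - 1..0 + 1}"
    using T by (subst emeasure_distr) (auto intro!: arg_cong[where f="emeasure M"])
  also have "\<dots> \<le> ennreal (2 * 1 / sqrt (T - 0))"
    by (rule normal_interval_bound) (use e T W_dist[of 0 T] in auto)
  finally have "prob ?A \<le> e" using T e by (simp add: emeasure_eq_measure)
  moreover have "{\<omega>\<in>space M. \<not> (\<exists>t\<ge>0. \<bar>W t \<omega>\<bar> = 1)} \<subseteq> ?A"
  proof
    fix \<omega> assume \<omega>: "\<omega> \<in> {\<omega>\<in>space M. \<not> (\<exists>t\<ge>0. \<bar>W t \<omega>\<bar> = 1)}"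
    have "\<bar>W T \<omega>\<bar> < 1"
    proof (rule ccontr)
      assume "\<not> \<bar>W T \<omega>\<bar> < 1"
      then have "\<exists>x\<ge>0. x \<le> T \<and> \<bar>W x \<omega>\<bar> = 1"
        by (intro IVT' continuous_intros continuous_on_subset[OF W_cont]) (use W_0 \<omega> T in auto)
      then show False using \<omega> by auto
    qed
    then show "\<omega> \<in> ?A" using \<omega> W_0 by (auto simp: abs_less_iff)
  qed
  ultimately show "\<exists>A\<in>events. prob A \<le> e \<and> {\<omega>\<in>space M. \<not> (\<exists>t\<ge>0. \<bar>W t \<omega>\<bar> = 1)} \<subseteq> A" using A by blast
qed

text \<open>The maximum over \<open>[p, q]\<close> is the sum of \<open>W p\<close>, which has a bounded density, and of
  a function of the later increments, so it has no atoms.\<close>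
lemma AE_no_max_at:
  assumes p: "0 < p" "p < q"
  shows "AE \<omega> in M. (\<forall>t\<in>{p..q}. W t \<omega> \<le> l) \<longrightarrow> (\<forall>t\<in>{p..q}. W t \<omega> \<noteq> l)"
proof (rule AE_smallI)
  fix e :: real assume e: "0 < e"
  \<comment> \<open>The anticoncentration bound for the variance \<open>p\<close> is
    \<open>2 * \<delta> / sqrt p\<close>, which equals \<open>e\<close> for this choice.\<close>
  define \<delta> where "\<delta> = e * sqrt p / 2"
  have \<delta>: "0 < \<delta>" using e p by (simp add: \<delta>_def)
  define x where "x m i = p + (q - p) * real i / real (Suc m)" for m i
  have xpos: "0 < x m i" for m i using p by (auto simp: x_def intro!: add_pos_nonneg)
  define Z where "Z m \<omega> = Max ((\<lambda>i. W (x m i) \<omega> - W p \<omega>) ` {..m})" for m \<omega>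
  define A where "A m = {\<omega>\<in>space M. \<bar>(W p \<omega> - W 0 \<omega>) + Z m \<omega> - l\<bar> \<le> \<delta>}" for m
  have Wx: "(\<lambda>\<omega>. W (x m i) \<omega>) \<in> borel_measurable M" for m i using W_meas xpos less_imp_le by blast
  have Wp: "W p \<in> borel_measurable M" "W 0 \<in> borel_measurable M" using W_meas p by auto
  have Zm[measurable]: "Z m \<in> borel_measurable M" for m
    unfolding Z_def using Wx Wp by (intro borel_measurable_Max) auto
  have Aev: "A m \<in> events" for m unfolding A_def using Wp by measurable
  have PA: "prob (A m) \<le> e" for m
  proof -
    \<comment> \<open>Prepending time 0 makes increment number 0 equal to \<open>W p - W 0\<close>,
      while \<open>Z m\<close> is a function of the increments \<open>1..m\<close> and hence
      independent of it.\<close>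
    define ts where "ts i = (case i of 0 \<Rightarrow> 0 | Suc j \<Rightarrow> x m j)" for i
    define X where "X i \<omega> = W (ts (Suc i)) \<omega> - W (ts i) \<omega>" for i \<omega>
    have inc: "ts i < ts (Suc i)" for i
    proof (cases i)
      case 0 then show ?thesis using xpos by (simp add: ts_def)
    next
      case (Suc j)
      then show ?thesis using p by (simp add: ts_def x_def divide_strict_right_mono)
    qed
    have ind: "indep_vars (\<lambda>_. borel) X {..<Suc m}" unfolding X_def by (rule W_indep) (use inc in \<open>auto simp: ts_def\<close>)
    define F where "F y = Max ((\<lambda>i. \<Sum>j\<in>{1..i}. y j) ` {..m})" for y :: "nat \<Rightarrow> real"
    have Fm: "F \<in> borel_measurable (PiM {1..m} (\<lambda>_. borel))"
      unfolding F_def by (intro borel_measurable_Max borel_measurable_sum measurable_component_singleton) auto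
    have "indep_var (PiM {0} (\<lambda>_. borel)) (\<lambda>\<omega>. restrict (\<lambda>i. X i \<omega>) {0}) (PiM {1..m} (\<lambda>_. borel)) (\<lambda>\<omega>. restrict (\<lambda>i. X i \<omega>) {1..m})"
      by (rule indep_var_restrict[OF ind]) auto
    from indep_var_compose[OF this, of "\<lambda>y. y 0" borel F borel]
    have "indep_var borel (\<lambda>\<omega>. X 0 \<omega>) borel (\<lambda>\<omega>. F (restrict (\<lambda>i. X i \<omega>) {1..m}))"
      using Fm by (simp add: comp_def)
    moreover have "F (restrict (\<lambda>i. X i \<omega>) {1..m}) = Z m \<omega>" for \<omega>
    proof -
      have "(\<Sum>j\<in>{1..i}. X j \<omega>) = W (x m i) \<omega> - W p \<omega>" for i
      proof (induction i)
        case 0 then show ?case by (simp add: x_def)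
      next
        case (Suc i) then show ?case by (simp add: X_def ts_def)
      qed
      then show ?thesis unfolding F_def Z_def by (intro arg_cong[where f=Max] image_cong refl) (auto intro!: sum.cong)
    qed
    moreover have "X 0 = (\<lambda>\<omega>. W p \<omega> - W 0 \<omega>)" by (auto simp: X_def ts_def x_def)
    ultimately have i2: "indep_var borel (\<lambda>\<omega>. W p \<omega> - W 0 \<omega>) borel (Z m)" by simp
    have "prob (A m) \<le> 2 * \<delta> / sqrt (p - 0)" unfolding A_def
      by (rule indep_normal_bound[OF _ _ _ i2]) (use p \<delta> W_dist[of 0 p] in auto)
    then show ?thesis using p by (simp add: \<delta>_def)
  qed
  \<comment> \<open>If the maximum is exactly \<open>l\<close>, the grid maxima are eventually
    within \<delta> of \<open>l\<close>, so \<omega> lies in all \<open>A m\<close> from some index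
    on.\<close>
  have "{\<omega>\<in>space M. \<not> ((\<forall>t\<in>{p..q}. W t \<omega> \<le> l) \<longrightarrow> (\<forall>t\<in>{p..q}. W t \<omega> \<noteq> l))} \<subseteq> (\<Union>k. \<Inter>m\<in>{k..}. A m)"
  proof
    fix \<omega> assume "\<omega> \<in> {\<omega>\<in>space M. \<not> ((\<forall>t\<in>{p..q}. W t \<omega> \<le> l) \<longrightarrow> (\<forall>t\<in>{p..q}. W t \<omega> \<noteq> l))}"
    then have \<omega>: "\<omega> \<in> space M" "\<And>t. t \<in> {p..q} \<Longrightarrow> W t \<omega> \<le> l" "\<exists>t\<in>{p..q}. W t \<omega> = l" by auto
    have "(\<lambda>m. Max ((\<lambda>i. W (x m i) \<omega>) ` {..m})) \<longlonglongrightarrow> l" unfolding x_def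
      by (rule continuous_Max_grid[OF continuous_on_subset[OF W_cont]]) (use \<omega> p in auto)
    from tendstoD[OF this \<delta>] obtain k where k: "\<And>m. k \<le> m \<Longrightarrow> dist (Max ((\<lambda>i. W (x m i) \<omega>) ` {..m})) l < \<delta>"
      unfolding eventually_sequentially by blast
    have "\<omega> \<in> A m" if "k \<le> m" for m
    proof -
      have "Z m \<omega> = Max ((\<lambda>y. - W p \<omega> + y) ` (\<lambda>i. W (x m i) \<omega>) ` {..m})"
        unfolding Z_def image_image by simp
      also have "\<dots> = - W p \<omega> + Max ((\<lambda>i. W (x m i) \<omega>) ` {..m})"
        by (rule mono_Max_commute[symmetric]) (auto simp: mono_def)
      finally show ?thesis using k[OF that] \<omega>(1) W_0 by (auto simp: A_def dist_real_def)
    qed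
    then show "\<omega> \<in> (\<Union>k. \<Inter>m\<in>{k..}. A m)" by blast
  qed
  then show "\<exists>A\<in>events. prob A \<le> e \<and> {\<omega>\<in>space M. \<not> ((\<forall>t\<in>{p..q}. W t \<omega> \<le> l) \<longrightarrow> (\<forall>t\<in>{p..q}. W t \<omega> \<noteq> l))} \<subseteq> A"
    using prob_eventually_le[of A e, OF Aev PA] by blast
qed

lemma prob_le_normal:
  assumes "0 \<le> s" "s < t"
  shows "prob {\<omega>\<in>space M. W t \<omega> - W s \<omega> \<le> x * sqrt (t - s)} = cdf (density lborel std_normal_density) x"
proof -
  define X where "X \<omega> = (W t \<omega> - W s \<omega> - 0) / sqrt (t - s)" for \<omega>
  have X: "distributed M lborel X std_normal_density" unfolding X_def
    using W_dist[OF assms] assms by (subst normal_standard_normal_convert[symmetric]) auto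
  then have [measurable]: "X \<in> borel_measurable M" by (auto dest: distributed_measurable)
  have "{\<omega>\<in>space M. W t \<omega> - W s \<omega> \<le> x * sqrt (t - s)} = X -` {..x} \<inter> space M"
    using assms by (auto simp: X_def field_simps)
  then have "prob {\<omega>\<in>space M. W t \<omega> - W s \<omega> \<le> x * sqrt (t - s)} = measure (distr M lborel X) {..x}"
    by (simp add: measure_distr)
  then show ?thesis using X by (simp add: distributed_distr_eq_density cdf_def)
qed

text \<open>Along a geometric sequence of times with a large ratio, the increments dominate the previous
  values of \<open>W\<close> with high probability; being independent, they are not all small.\<close>
lemma AE_immediately_positive:
  assumes \<epsilon>: "0 < \<epsilon>"
  shows "AE \<omega> in M. \<exists>t. 0 < t \<and> t < \<epsilon> \<and> 0 < W t \<omega>"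
proof (rule AE_smallI)
  fix e :: real assume e: "0 < e"
  let ?N = "density lborel std_normal_density"
  interpret N: prob_space ?N by (rule prob_space_normal_density) simp
  interpret N: real_distribution ?N by unfold_locales simp
  define \<rho> where "\<rho> = cdf ?N 1"
  have "\<rho> < 1"
  proof (rule ccontr)
    assume "\<not> \<rho> < 1"
    then have "measure ?N {..1} = 1" using N.prob_le_1[of "{..1}"] by (simp add: \<rho>_def cdf_def)
    then have "AE x in ?N. x \<in> {..1}" by (intro N.AE_prob_1) simp
    then have "AE x in lborel. x \<in> {..1::real}" by (simp add: AE_density std_normal_density_def)
    then have "emeasure lborel {(1::real)<..} = 0"
      by (subst (asm) AE_iff_measurable[of "{1<..}"]) auto
    moreover have "emeasure lborel {1<..2::real} \<le> emeasure lborel {(1::real)<..}" by (intro emeasure_mono) auto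
    ultimately have "emeasure lborel {1<..2::real} = 0" by simp
    then show False by simp
  qed
  moreover have "0 \<le> \<rho>" by (simp add: \<rho>_def cdf_def)
  ultimately have "(\<lambda>K. \<rho> ^ K) \<longlonglongrightarrow> 0" by (intro LIMSEQ_power_zero) simp
  from order_tendstoD(2)[OF this, of "e / 2"] obtain K0 where "\<rho> ^ K0 < e / 2"
    using e by (auto simp: eventually_sequentially)
  \<comment> \<open>The successor keeps \<open>K\<close> positive, as the division by
    \<open>K\<close> and the finite intersection over \<open>{..<K}\<close> require.\<close>
  moreover define K where "K = Suc K0"
  moreover have "\<rho> ^ K \<le> \<rho> ^ K0" unfolding K_def using \<open>0 \<le> \<rho>\<close> \<open>\<rho> < 1\<close> by (intro power_decreasing) auto
  ultimately have K: "\<rho> ^ K < e / 2" "0 < K" by auto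
  have "\<forall>\<^sub>F x in at_bot. cdf ?N x < e / (2 * real K)"
    by (rule order_tendstoD(2)[OF N.cdf_lim_at_bot]) (use e K in auto)
  then obtain x0 where x0: "\<And>x. x \<le> x0 \<Longrightarrow> cdf ?N x < e / (2 * real K)" by (auto simp: eventually_at_bot_linorder)
  define A where "A = max 1 (- x0)"
  have A: "1 \<le> A" "cdf ?N (- A) < e / (2 * real K)" using x0[of "- A"] by (auto simp: A_def)
  \<comment> \<open>With this ratio the standard deviation of the increment after
    \<open>ts i\<close> is exactly \<open>A\<close> times that of \<open>W (ts i)\<close>.\<close>
  define q where "q = A\<^sup>2 + 1"
  have q: "1 < q" using A by (auto simp: q_def)
  \<comment> \<open>The scale places all times up to index \<open>K\<close> within
    \<open>\<epsilon> / 2\<close>.\<close>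
  define ts where "ts i = \<epsilon> / 2 / q ^ K * q ^ i" for i
  have ts0: "0 < ts i" for i using \<epsilon> q by (auto simp: ts_def)
  have tsS: "ts i < ts (Suc i)" for i
  proof -
    have "ts (Suc i) = ts i * q" by (simp add: ts_def)
    then show ?thesis using ts0[of i] q by simp
  qed
  have tsK: "ts i < \<epsilon>" if "i \<le> K" for i
  proof -
    have "q ^ i \<le> q ^ K" using q that by (intro power_increasing) auto
    then have "ts i \<le> \<epsilon> / 2" using \<epsilon> q by (simp add: ts_def divide_le_eq mult_left_mono)
    then show ?thesis using \<epsilon> by simp
  qed
  have tsd: "sqrt (ts (Suc i) - ts i) = A * sqrt (ts i)" for i
  proof -
    have "ts (Suc i) - ts i = A\<^sup>2 * ts i" by (simp add: ts_def q_def algebra_simps)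
    then show ?thesis using A by (simp add: real_sqrt_mult)
  qed
  have Wm[measurable]: "W (ts i) \<in> borel_measurable M" "W 0 \<in> borel_measurable M" for i
    using W_meas less_imp_le[OF ts0] by auto
  define B where "B i = {\<omega>\<in>space M. W (ts i) \<omega> - W 0 \<omega> \<le> (- A) * sqrt (ts i - 0)}" for i
  define C where "C i = {\<omega>\<in>space M. W (ts (Suc i)) \<omega> - W (ts i) \<omega> \<le> 1 * sqrt (ts (Suc i) - ts i)}" for i
  have ev: "B i \<in> events" "C i \<in> events" for i unfolding B_def C_def by measurable
  have pB: "prob (B i) \<le> e / (2 * real K)" for i
    unfolding B_def using prob_le_normal[of 0 "ts i" "- A"] ts0[of i] A by simp
  have pC: "prob (C i) = \<rho>" for i
    unfolding C_def \<rho>_def by (rule prob_le_normal) (use ts0[of i] tsS[of i] in auto)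
  have "prob (\<Union>i<K. B i) \<le> (\<Sum>i<K. prob (B i))" using ev by (intro finite_measure_subadditive_finite) auto
  also have "\<dots> \<le> (\<Sum>i<K. e / (2 * real K))" by (intro sum_mono pB)
  also have "\<dots> = e / 2" using K by simp
  finally have pB': "prob (\<Union>i<K. B i) \<le> e / 2" .
  have "prob (\<Inter>i\<in>{..<K}. C i) = (\<Prod>i<K. prob (C i))"
  proof (rule indep_setsD)
    show "indep_sets (\<lambda>i. {(\<lambda>\<omega>. W (ts (Suc i)) \<omega> - W (ts i) \<omega>) -` A \<inter> space M | A. A \<in> sets borel}) {..<K}"
      using W_indep[of ts K] ts0[of 0] tsS unfolding indep_vars_def2 by auto
    show "\<forall>j\<in>{..<K}. C j \<in> {(\<lambda>\<omega>. W (ts (Suc j)) \<omega> - W (ts j) \<omega>) -` A \<inter> space M | A. A \<in> sets borel}"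
    proof
      fix j
      show "C j \<in> {(\<lambda>\<omega>. W (ts (Suc j)) \<omega> - W (ts j) \<omega>) -` A \<inter> space M | A. A \<in> sets borel}"
        unfolding C_def by (rule CollectI, rule exI[of _ "{.. 1 * sqrt (ts (Suc j) - ts j)}"]) auto
    qed
  qed (use K in auto)
  then have pC': "prob (\<Inter>i\<in>{..<K}. C i) < e / 2" using K pC by simp
  have ev': "(\<Inter>i\<in>{..<K}. C i) \<in> events" using ev K by (intro sets.finite_INT) auto
  have "prob ((\<Union>i<K. B i) \<union> (\<Inter>i\<in>{..<K}. C i)) \<le> prob (\<Union>i<K. B i) + prob (\<Inter>i\<in>{..<K}. C i)"
    using ev ev' by (intro measure_Un_le) auto
  then have "prob ((\<Union>i<K. B i) \<union> (\<Inter>i\<in>{..<K}. C i)) \<le> e" using pB' pC' by linarith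
  \<comment> \<open>If the path stays nonpositive and \<open>W (ts i)\<close> is above
    \<open>-A\<close> of its standard deviations, then the next increment is below one of its own
    standard deviations. So outside the sets \<open>B i\<close> all the events \<open>C i\<close>
    occur.\<close>
  moreover have "{\<omega>\<in>space M. \<not> (\<exists>t. 0 < t \<and> t < \<epsilon> \<and> 0 < W t \<omega>)} \<subseteq> (\<Union>i<K. B i) \<union> (\<Inter>i\<in>{..<K}. C i)"
  proof
    fix \<omega> assume "\<omega> \<in> {\<omega>\<in>space M. \<not> (\<exists>t. 0 < t \<and> t < \<epsilon> \<and> 0 < W t \<omega>)}"
    then have \<omega>: "\<omega> \<in> space M" "\<And>t. 0 < t \<Longrightarrow> t < \<epsilon> \<Longrightarrow> W t \<omega> \<le> 0" by force+
    show "\<omega> \<in> (\<Union>i<K. B i) \<union> (\<Inter>i\<in>{..<K}. C i)"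
    proof (cases "\<omega> \<in> (\<Union>i<K. B i)")
      case False
      have "\<omega> \<in> C i" if i: "i < K" for i
      proof -
        have "\<not> W (ts i) \<omega> \<le> (- A) * sqrt (ts i)" using False i \<omega>(1) W_0 by (auto simp: B_def)
        moreover have "W (ts (Suc i)) \<omega> \<le> 0" using \<omega>(2)[OF ts0 tsK[of "Suc i"]] i by simp
        ultimately show ?thesis unfolding C_def tsd using \<omega>(1) by auto
      qed
      then show ?thesis by auto
    qed auto
  qed
  ultimately show "\<exists>A\<in>events. prob A \<le> e \<and> {\<omega>\<in>space M. \<not> (\<exists>t. 0 < t \<and> t < \<epsilon> \<and> 0 < W t \<omega>)} \<subseteq> A"
    using ev ev' by (intro bexI[of _ "(\<Union>i<K. B i) \<union> (\<Inter>i\<in>{..<K}. C i)"]) auto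
qed

text \<open>Rational endpoints, two levels and the radii \<open>1 / (n + 1)\<close> leave countably
  many exceptional null sets.\<close>

lemma AE_one_sided:
  "AE \<omega> in M. (\<forall>p\<in>\<rat>. \<forall>q\<in>\<rat>. 0 < p \<longrightarrow> p < q \<longrightarrow> (\<forall>l\<in>{0,1}. (\<forall>t\<in>{p..q}. W t \<omega> \<le> l) \<longrightarrow> (\<forall>t\<in>{p..q}. W t \<omega> \<noteq> l)))
     \<and> (\<forall>\<epsilon>>0. \<exists>t. 0 < t \<and> t < \<epsilon> \<and> 0 < W t \<omega>)"
proof (rule AE_conjI)
  have c: "countable (\<rat> :: real set)" by (rule countable_rat)
  show "AE \<omega> in M. \<forall>p\<in>\<rat>. \<forall>q\<in>\<rat>. 0 < p \<longrightarrow> p < q \<longrightarrow> (\<forall>l\<in>{0,1}. (\<forall>t\<in>{p..q}. W t \<omega> \<le> l) \<longrightarrow> (\<forall>t\<in>{p..q}. W t \<omega> \<noteq> l))"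
  proof (rule AE_ball_countable'[OF _ c], rule AE_ball_countable'[OF _ c])
    fix p q :: real
    show "AE \<omega> in M. 0 < p \<longrightarrow> p < q \<longrightarrow> (\<forall>l\<in>{0,1}. (\<forall>t\<in>{p..q}. W t \<omega> \<le> l) \<longrightarrow> (\<forall>t\<in>{p..q}. W t \<omega> \<noteq> l))"
    proof (cases "0 < p \<and> p < q")
      case True
      show ?thesis using AE_no_max_at[of p q 0] AE_no_max_at[of p q 1] True by auto
    qed auto
  qed
  have "AE \<omega> in M. \<forall>n. \<exists>t. 0 < t \<and> t < 1 / real (Suc n) \<and> 0 < W t \<omega>"
    unfolding AE_all_countable by (intro allI AE_immediately_positive) simp
  then show "AE \<omega> in M. \<forall>\<epsilon>>0. \<exists>t. 0 < t \<and> t < \<epsilon> \<and> 0 < W t \<omega>"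
  proof (rule AE_mp, intro AE_I2 impI allI)
    fix \<omega> and \<epsilon> :: real assume a: "\<forall>n. \<exists>t. 0 < t \<and> t < 1 / real (Suc n) \<and> 0 < W t \<omega>" and "0 < \<epsilon>"
    then obtain n where "1 / real (Suc n) < \<epsilon>" using reals_Archimedean by (auto simp: inverse_eq_divide)
    then show "\<exists>t. 0 < t \<and> t < \<epsilon> \<and> 0 < W t \<omega>" using a by (meson less_trans)
  qed
qed

text \<open>A rational interval around the hitting time contains a point where the level is reached,
  so its maximum is not that level and the path exceeds it somewhere; this can only happen after the
  hitting time, since the modulus is below 1 before. The same argument for \<open>- s * w\<close> at
  level 0 yields a point on the opposite side, necessarily before the last zero. If the last zero
  were 0, the path would keep the sign of \<open>s\<close> right after time 0, against the immediate
  visits to both sides.\<close>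

lemma AE_good_path: "AE \<omega> in M. good_path (\<lambda>t. W t \<omega>)"
proof -
  interpret U: std_bm M "\<lambda>t \<omega>. - W t \<omega>" by (rule uminus_bm)
  show ?thesis using AE_hits AE_one_sided U.AE_one_sided
  proof (rule AE_mp[OF _ AE_mp[OF _ AE_mp[OF _ AE_I2]]], intro impI)
    fix \<omega> assume \<omega>: "\<omega> \<in> space M" and hits: "\<exists>t\<ge>0. \<bar>W t \<omega>\<bar> = 1"
      and pos: "(\<forall>p\<in>\<rat>. \<forall>q\<in>\<rat>. 0 < p \<longrightarrow> p < q \<longrightarrow> (\<forall>l\<in>{0,1}. (\<forall>t\<in>{p..q}. W t \<omega> \<le> l) \<longrightarrow> (\<forall>t\<in>{p..q}. W t \<omega> \<noteq> l)))
         \<and> (\<forall>\<epsilon>>0. \<exists>t. 0 < t \<and> t < \<epsilon> \<and> 0 < W t \<omega>)"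
      and neg: "(\<forall>p\<in>\<rat>. \<forall>q\<in>\<rat>. 0 < p \<longrightarrow> p < q \<longrightarrow> (\<forall>l\<in>{0,1}. (\<forall>t\<in>{p..q}. - W t \<omega> \<le> l) \<longrightarrow> (\<forall>t\<in>{p..q}. - W t \<omega> \<noteq> l)))
         \<and> (\<forall>\<epsilon>>0. \<exists>t. 0 < t \<and> t < \<epsilon> \<and> 0 < - W t \<omega>)"
    let ?w = "\<lambda>t. W t \<omega>"
    define \<tau> where "\<tau> = hit_time ?w"
    define g where "g = last_zero ?w"
    define s where "s = ?w \<tau>"
    note h = hit_time_props[OF W_cont[OF \<omega>] W_0[OF \<omega>] hits, folded \<tau>_def]
    note z = last_zero_props[OF W_cont[OF \<omega>] W_0[OF \<omega>] hits, folded \<tau>_def g_def]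
    have s: "s = 1 \<or> s = -1" using h(2) by (auto simp: s_def)
    have nomax: "\<exists>t\<in>{p..q}. r * ?w t > l"
      if "p \<in> \<rat>" "q \<in> \<rat>" "0 < p" "p < q" "l \<in> {0,1}" "r = 1 \<or> r = -1" "\<exists>t\<in>{p..q}. r * ?w t = l" for p q l r
      using that(6)
    proof
      assume r: "r = 1"
      have "(\<forall>t\<in>{p..q}. ?w t \<le> l) \<longrightarrow> (\<forall>t\<in>{p..q}. ?w t \<noteq> l)" using pos that(1-5) by blast
      then show ?thesis using that(7) unfolding r by (metis mult_1 not_le)
    next
      assume r: "r = -1"
      have "(\<forall>t\<in>{p..q}. - ?w t \<le> l) \<longrightarrow> (\<forall>t\<in>{p..q}. - ?w t \<noteq> l)" using neg that(1-5) by blast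
      then show ?thesis using that(7) unfolding r by (metis mult_minus1 not_le)
    qed
    have g0: "0 < g"
    proof (rule ccontr)
      assume "\<not> 0 < g"
      then have g: "g = 0" using z(1) by simp
      have "\<exists>t. 0 < t \<and> t < \<tau> \<and> s * ?w t < 0" using s pos neg h(1) by force
      then show False using z(4)[of _] g by (auto simp: s_def) (meson less_imp_le not_less)
    qed
    have after: "\<exists>t. \<tau> < t \<and> t < \<tau> + \<epsilon> \<and> 1 < s * ?w t" if "0 < \<epsilon>" for \<epsilon>
    proof -
      obtain p where p: "p \<in> \<rat>" "0 < p" "p < \<tau>" using Rats_dense_in_real[OF h(1)] by auto
      obtain q where q: "q \<in> \<rat>" "\<tau> < q" "q < \<tau> + \<epsilon>" using Rats_dense_in_real[of \<tau> "\<tau> + \<epsilon>"] \<open>0 < \<epsilon>\<close> by auto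
      have "\<exists>t\<in>{p..q}. s * ?w t > 1"
        by (rule nomax) (use p q s in \<open>auto simp: s_def intro!: bexI[of _ \<tau>]\<close>)
      then obtain t where t: "p \<le> t" "t \<le> q" "s * ?w t > 1" by auto
      have "\<tau> < t"
      proof (rule ccontr)
        assume "\<not> \<tau> < t"
        then have "\<bar>?w t\<bar> \<le> 1" using h(2) h(3)[of t] t p by (cases "t = \<tau>") auto
        then show False using t s by auto
      qed
      then show ?thesis using t q by force
    qed
    have before: "\<exists>t\<ge>0. g - \<epsilon> < t \<and> t < g \<and> s * ?w t < 0" if "0 < \<epsilon>" for \<epsilon>
    proof -
      obtain p where p: "p \<in> \<rat>" "max 0 (g - \<epsilon>) < p" "p < g" using Rats_dense_in_real[of "max 0 (g - \<epsilon>)" g] g0 \<open>0 < \<epsilon>\<close> by auto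
      obtain q where q: "q \<in> \<rat>" "g < q" "q < \<tau>" using Rats_dense_in_real[OF z(2)] by auto
      have "\<exists>t\<in>{p..q}. (- s) * ?w t > 0"
        by (rule nomax) (use p q s z(3) in \<open>auto intro!: bexI[of _ g]\<close>)
      then obtain t where t: "p \<le> t" "t \<le> q" "s * ?w t < 0" by auto
      have "t < g"
      proof (rule ccontr)
        assume "\<not> t < g"
        then have "0 \<le> s * ?w t" using z(3) z(4)[of t] t q by (cases "t = g") (auto simp: s_def)
        then show False using t by simp
      qed
      then show ?thesis using t p by (intro exI[of _ t]) auto
    qed
    show "good_path ?w" unfolding good_path_def
      using W_cont[OF \<omega>] W_0[OF \<omega>] hits g0 after before by (auto simp: \<tau>_def g_def s_def)
  qed
qed

end

subsection \<open>Measurability and continuity of the reversed process\<close>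

context std_bm
begin

lemma W_random_time_measurable:
  assumes \<sigma>[measurable]: "\<sigma> \<in> borel_measurable M" and nn: "\<And>\<omega>. \<omega> \<in> space M \<Longrightarrow> 0 \<le> \<sigma> \<omega>"
  shows "(\<lambda>\<omega>. W (\<sigma> \<omega>) \<omega>) \<in> borel_measurable M"
proof (rule borel_measurable_LIMSEQ_real)
  fix m :: nat
  have [measurable]: "(\<lambda>\<omega>. nat \<lfloor>real (Suc m) * \<sigma> \<omega>\<rfloor>) \<in> measurable M (count_space UNIV)" by measurable
  show "(\<lambda>\<omega>. W (real (nat \<lfloor>real (Suc m) * \<sigma> \<omega>\<rfloor>) / real (Suc m)) \<omega>) \<in> borel_measurable M"
    by (rule measurable_compose_countable[where f="\<lambda>i. W (real i / real (Suc m))"]) (auto intro: W_meas)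
next
  fix \<omega> assume \<omega>: "\<omega> \<in> space M"
  have "(\<lambda>m. real (nat \<lfloor>real (Suc m) * \<sigma> \<omega>\<rfloor>) / real (Suc m)) \<longlonglongrightarrow> \<sigma> \<omega>"
    by (rule grid_tendsto[OF filterlim_Suc nn[OF \<omega>]])
  then show "(\<lambda>m. W (real (nat \<lfloor>real (Suc m) * \<sigma> \<omega>\<rfloor>) / real (Suc m)) \<omega>) \<longlonglongrightarrow> W (\<sigma> \<omega>) \<omega>"
    by (rule continuous_on_tendsto_compose[OF W_cont[OF \<omega>]]) (use nn[OF \<omega>] in auto)
qed

lemma hitting_event:
  fixes F :: "real \<Rightarrow> real"
  assumes ab: "0 \<le> a" and F: "continuous_on UNIV F"
  shows "{\<omega>\<in>space M. \<exists>s\<in>{a..b}. F (W s \<omega>) = 0} \<in> events"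
proof (cases "a \<le> b")
  case True
  \<comment> \<open>Clamping keeps all sample points in the interval, even if it is shorter than the
    mesh, and still approximates each of its points. By compactness a zero exists iff the samples
    come arbitrarily close to 0.\<close>
  define p where "p i k = min b (max a (real i / real (Suc k)))" for i k :: nat
  have p: "p i k \<in> {a..b}" for i k using True by (auto simp: p_def)
  have Fm[measurable]: "F \<in> borel_measurable borel" using F by (rule borel_measurable_continuous_onI)
  have [measurable]: "W (p i k) \<in> borel_measurable M" for i k using p[of i k] ab by (intro W_meas) auto
  have "{\<omega>\<in>space M. \<exists>s\<in>{a..b}. F (W s \<omega>) = 0} =
      {\<omega>\<in>space M. \<forall>m. \<exists>i k. \<bar>F (W (p i k) \<omega>)\<bar> < 1 / real (Suc m)}"
  proof (intro Collect_cong conj_cong refl)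
    fix \<omega> assume \<omega>: "\<omega> \<in> space M"
    have c: "continuous_on {a..b} (\<lambda>s. F (W s \<omega>))"
      by (rule continuous_on_compose2[OF F continuous_on_subset[OF W_cont[OF \<omega>]]]) (use ab in auto)
    show "(\<exists>s\<in>{a..b}. F (W s \<omega>) = 0) = (\<forall>m. \<exists>i k. \<bar>F (W (p i k) \<omega>)\<bar> < 1 / real (Suc m))"
    proof
      assume "\<exists>s\<in>{a..b}. F (W s \<omega>) = 0"
      then obtain s where s: "s \<in> {a..b}" "F (W s \<omega>) = 0" by auto
      define i where "i k = nat \<lfloor>real (Suc k) * s\<rfloor>" for k
      have "(\<lambda>k. real (i k) / real (Suc k)) \<longlonglongrightarrow> s"
        unfolding i_def by (rule grid_tendsto[OF filterlim_Suc]) (use s ab in auto)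
      then have "(\<lambda>k. p (i k) k) \<longlonglongrightarrow> min b (max a s)" unfolding p_def by (intro tendsto_intros)
      moreover have "min b (max a s) = s" using s by auto
      ultimately have "(\<lambda>k. p (i k) k) \<longlonglongrightarrow> s" by simp
      then have "(\<lambda>k. F (W (p (i k) k) \<omega>)) \<longlonglongrightarrow> F (W s \<omega>)"
        by (rule continuous_on_tendsto_compose[OF c]) (use s p in auto)
      from tendsto_rabs[OF this] have lim: "(\<lambda>k. \<bar>F (W (p (i k) k) \<omega>)\<bar>) \<longlonglongrightarrow> 0" by (simp add: s(2))
      show "\<forall>m. \<exists>i k. \<bar>F (W (p i k) \<omega>)\<bar> < 1 / real (Suc m)"
      proof
        fix m
        from order_tendstoD(2)[OF lim, of "1 / real (Suc m)"]
        show "\<exists>i k. \<bar>F (W (p i k) \<omega>)\<bar> < 1 / real (Suc m)"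
          by (auto simp: eventually_sequentially simp del: of_nat_Suc)
      qed
    next
      assume a: "\<forall>m. \<exists>i k. \<bar>F (W (p i k) \<omega>)\<bar> < 1 / real (Suc m)"
      obtain s where s: "s \<in> {a..b}" "\<And>t. t \<in> {a..b} \<Longrightarrow> \<bar>F (W s \<omega>)\<bar> \<le> \<bar>F (W t \<omega>)\<bar>"
        using continuous_attains_inf[OF compact_Icc _ continuous_on_rabs[OF c]] True by auto
      have "\<bar>F (W s \<omega>)\<bar> \<le> inverse (real (Suc m))" for m
        using a s(2)[OF p] by (metis inverse_eq_divide le_less_trans less_imp_le)
      then have "\<bar>F (W s \<omega>)\<bar> \<le> 0" by (intro LIMSEQ_le_const[OF LIMSEQ_inverse_real_of_nat]) auto
      then show "\<exists>s\<in>{a..b}. F (W s \<omega>) = 0" using s(1) by auto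
    qed
  qed
  also have "\<dots> \<in> events" by measurable
  finally show ?thesis .
qed auto

section \<open>The random times and the regularity of the reversed process\<close>

definition hits :: "'a set" where
  "hits = {\<omega>\<in>space M. \<exists>t\<ge>0. \<bar>W t \<omega>\<bar> = 1}"
text \<open>The value 0 off \<open>hits\<close> replaces an infimum over the empty set, giving a
  nonnegative function at which the process can be evaluated everywhere.\<close>

definition \<tau> :: "'a \<Rightarrow> real" where
  "\<tau> \<omega> = (if \<omega> \<in> hits then hit_time (\<lambda>t. W t \<omega>) else 0)"
definition g :: "'a \<Rightarrow> real" where
  "g \<omega> = (if \<omega> \<in> hits then last_zero (\<lambda>t. W t \<omega>) else 0)"

lemma unit_event: "0 \<le> a \<Longrightarrow> {\<omega>\<in>space M. \<exists>s\<in>{a..b}. \<bar>W s \<omega>\<bar> = 1} \<in> events"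
proof -
  assume a: "0 \<le> a"
  have "continuous_on UNIV (\<lambda>x::real. \<bar>x\<bar> - 1)" by (intro continuous_intros)
  from hitting_event[OF a this] show ?thesis by simp
qed

lemma zero_event: "0 \<le> a \<Longrightarrow> {\<omega>\<in>space M. \<exists>s\<in>{a..b}. W s \<omega> = 0} \<in> events"
  using hitting_event[of a "\<lambda>x. x" b, OF _ continuous_on_id] by simp

lemma hits_event [measurable]: "hits \<in> events"
proof -
  have "hits = (\<Union>n::nat. {\<omega>\<in>space M. \<exists>s\<in>{0..real n}. \<bar>W s \<omega>\<bar> = 1})"
  proof (intro set_eqI iffI)
    fix \<omega> assume "\<omega> \<in> hits"
    then obtain t where t: "\<omega> \<in> space M" "0 \<le> t" "\<bar>W t \<omega>\<bar> = 1" unfolding hits_def by blast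
    obtain n where "t \<le> real n" using real_arch_simple by blast
    then have "t \<in> {0..real n}" using t by simp
    then show "\<omega> \<in> (\<Union>n::nat. {\<omega>\<in>space M. \<exists>s\<in>{0..real n}. \<bar>W s \<omega>\<bar> = 1})" using t by blast
  next
    fix \<omega> assume "\<omega> \<in> (\<Union>n::nat. {\<omega>\<in>space M. \<exists>s\<in>{0..real n}. \<bar>W s \<omega>\<bar> = 1})"
    then obtain n s where "\<omega> \<in> space M" "s \<in> {0..real n}" "\<bar>W s \<omega>\<bar> = 1" by blast
    moreover from this have "0 \<le> s" by simp
    ultimately show "\<omega> \<in> hits" unfolding hits_def by blast
  qed
  then show ?thesis using unit_event[of 0] by auto
qed

lemma hits_props:
  assumes "\<omega> \<in> hits"
  shows "0 < \<tau> \<omega>" "\<bar>W (\<tau> \<omega>) \<omega>\<bar> = 1" "\<And>t. 0 \<le> t \<Longrightarrow> t < \<tau> \<omega> \<Longrightarrow> \<bar>W t \<omega>\<bar> < 1"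
    "0 \<le> g \<omega>" "g \<omega> < \<tau> \<omega>" "W (g \<omega>) \<omega> = 0" "\<And>t. g \<omega> < t \<Longrightarrow> t \<le> \<tau> \<omega> \<Longrightarrow> W t \<omega> \<noteq> 0"
proof -
  have \<omega>: "\<omega> \<in> space M" "\<exists>t\<ge>0. \<bar>W t \<omega>\<bar> = 1" using assms by (auto simp: hits_def)
  note h = hit_time_props[OF W_cont[OF \<omega>(1)] W_0[OF \<omega>(1)] \<omega>(2)]
    and l = last_zero_props[OF W_cont[OF \<omega>(1)] W_0[OF \<omega>(1)] \<omega>(2)]
  have e: "\<tau> \<omega> = hit_time (\<lambda>t. W t \<omega>)" "g \<omega> = last_zero (\<lambda>t. W t \<omega>)" using assms by (auto simp: \<tau>_def g_def)
  show "0 < \<tau> \<omega>" "\<bar>W (\<tau> \<omega>) \<omega>\<bar> = 1" "\<And>t. 0 \<le> t \<Longrightarrow> t < \<tau> \<omega> \<Longrightarrow> \<bar>W t \<omega>\<bar> < 1"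
    "0 \<le> g \<omega>" "g \<omega> < \<tau> \<omega>" "W (g \<omega>) \<omega> = 0" unfolding e using h l by auto
  show "W t \<omega> \<noteq> 0" if "g \<omega> < t" "t \<le> \<tau> \<omega>" for t
    using l(4)[of t] that unfolding e by auto
qed

lemma hit_iff: "\<omega> \<in> hits \<Longrightarrow> 0 \<le> a \<Longrightarrow> \<tau> \<omega> \<le> a \<longleftrightarrow> (\<exists>s\<in>{0..a}. \<bar>W s \<omega>\<bar> = 1)"
  using hits_props[of \<omega>] by (metis atLeastAtMost_iff less_imp_le less_irrefl not_le order_trans)

lemma \<tau>_measurable [measurable]: "\<tau> \<in> borel_measurable M"
  unfolding borel_measurable_iff_le
proof
  fix a
  show "{\<omega>\<in>space M. \<tau> \<omega> \<le> a} \<in> events"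
  proof (cases "0 \<le> a")
    case True
    have "{\<omega>\<in>space M. \<tau> \<omega> \<le> a} = (space M - hits) \<union> (hits \<inter> {\<omega>\<in>space M. \<exists>s\<in>{0..a}. \<bar>W s \<omega>\<bar> = 1})"
      using hit_iff True by (auto simp: \<tau>_def)
    then show ?thesis using unit_event[of 0 a] by auto
  next
    case False
    have "\<tau> \<omega> \<ge> 0" for \<omega> using hits_props(1)[of \<omega>] by (cases "\<omega> \<in> hits") (auto simp: \<tau>_def)
    then have "\<not> \<tau> \<omega> \<le> a" for \<omega> using False order_trans by blast
    then show ?thesis by simp
  qed
qed

lemma g_measurable [measurable]: "g \<in> borel_measurable M"
  unfolding borel_measurable_iff_ge
proof
  fix a
  have g0: "g \<omega> \<ge> 0" for \<omega> using hits_props(4)[of \<omega>] by (cases "\<omega> \<in> hits") (auto simp: g_def)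
  show "{\<omega>\<in>space M. a \<le> g \<omega>} \<in> events"
  proof (cases "a \<le> 0")
    case True
    then have "{\<omega>\<in>space M. a \<le> g \<omega>} = space M" using g0 order_trans by blast
    then show ?thesis by simp
  next
    case False
    \<comment> \<open>A rational \<open>q\<close> strictly between the last zero and the hitting
      time separates the two conditions and turns the event into a countable union.\<close>
    have iff: "a \<le> g \<omega> \<longleftrightarrow> (\<exists>q\<in>\<rat>. (\<exists>s\<in>{a..q}. W s \<omega> = 0) \<and> \<not> (\<exists>s\<in>{0..q}. \<bar>W s \<omega>\<bar> = 1))"
      if h: "\<omega> \<in> hits" for \<omega>
    proof
      assume a: "a \<le> g \<omega>"
      obtain q where q: "q \<in> \<rat>" "g \<omega> < q" "q < \<tau> \<omega>" using Rats_dense_in_real[OF hits_props(5)[OF h]] by auto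
      have "\<not> (\<exists>s\<in>{0..q}. \<bar>W s \<omega>\<bar> = 1)" using hit_iff[OF h, of q] q hits_props(4)[OF h] by auto
      moreover have "\<exists>s\<in>{a..q}. W s \<omega> = 0" using a q hits_props(6)[OF h] by (intro bexI[of _ "g \<omega>"]) auto
      ultimately show "\<exists>q\<in>\<rat>. (\<exists>s\<in>{a..q}. W s \<omega> = 0) \<and> \<not> (\<exists>s\<in>{0..q}. \<bar>W s \<omega>\<bar> = 1)" using q by blast
    next
      assume "\<exists>q\<in>\<rat>. (\<exists>s\<in>{a..q}. W s \<omega> = 0) \<and> \<not> (\<exists>s\<in>{0..q}. \<bar>W s \<omega>\<bar> = 1)"
      then obtain q s where q: "a \<le> s" "s \<le> q" "W s \<omega> = 0" "\<not> (\<exists>s\<in>{0..q}. \<bar>W s \<omega>\<bar> = 1)" by auto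
      then have "q < \<tau> \<omega>" using hit_iff[OF h, of q] False by auto
      then have "s \<le> g \<omega>" using hits_props(7)[OF h, of s] q by force
      then show "a \<le> g \<omega>" using q by simp
    qed
    have "{\<omega>\<in>space M. a \<le> g \<omega>} = (\<Union>q\<in>\<rat>. hits \<inter> ({\<omega>\<in>space M. \<exists>s\<in>{a..q}. W s \<omega> = 0} - {\<omega>\<in>space M. \<exists>s\<in>{0..q}. \<bar>W s \<omega>\<bar> = 1}))"
    proof (intro set_eqI iffI)
      fix \<omega> assume \<omega>: "\<omega> \<in> {\<omega>\<in>space M. a \<le> g \<omega>}"
      then have "\<omega> \<in> hits" using False by (auto simp: g_def split: if_splits)
      then show "\<omega> \<in> (\<Union>q\<in>\<rat>. hits \<inter> ({\<omega>\<in>space M. \<exists>s\<in>{a..q}. W s \<omega> = 0} - {\<omega>\<in>space M. \<exists>s\<in>{0..q}. \<bar>W s \<omega>\<bar> = 1}))"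
        using \<omega> iff by blast
    next
      fix \<omega> assume "\<omega> \<in> (\<Union>q\<in>\<rat>. hits \<inter> ({\<omega>\<in>space M. \<exists>s\<in>{a..q}. W s \<omega> = 0} - {\<omega>\<in>space M. \<exists>s\<in>{0..q}. \<bar>W s \<omega>\<bar> = 1}))"
      then show "\<omega> \<in> {\<omega>\<in>space M. a \<le> g \<omega>}" using iff by blast
    qed
    moreover have "(\<lambda>q. hits \<inter> ({\<omega>\<in>space M. \<exists>s\<in>{a..q}. W s \<omega> = 0} - {\<omega>\<in>space M. \<exists>s\<in>{0..q}. \<bar>W s \<omega>\<bar> = 1})) ` \<rat> \<subseteq> events"
      using False by (intro image_subsetI sets.Int sets.Diff hits_event zero_event unit_event) auto
    then have "(\<Union>q\<in>\<rat>. hits \<inter> ({\<omega>\<in>space M. \<exists>s\<in>{a..q}. W s \<omega> = 0} - {\<omega>\<in>space M. \<exists>s\<in>{0..q}. \<bar>W s \<omega>\<bar> = 1})) \<in> events"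
      by (rule sets.countable_UN'[OF countable_rat])
    ultimately show ?thesis by (simp only:)
  qed
qed

lemma qtr_no_hit:
  assumes "\<omega> \<in> space M" "\<omega> \<notin> hits"
  shows "qtr (\<lambda>s. W s \<omega>) = (\<lambda>s. W s \<omega>)"
proof -
  have "\<not> (\<exists>t\<ge>0. \<bar>W t \<omega>\<bar> = 1)" using assms unfolding hits_def by blast
  then show ?thesis unfolding qtr_def by (rule if_not_P)
qed

text \<open>Adjacent formulas agree at both junctions, because the path is 0 at
  \<open>g \<omega>\<close>: the common value is 0 there and
  \<open>- W (\<tau> \<omega>) \<omega>\<close> at \<open>\<tau> \<omega>\<close>. The weak
  inequalities suit the pasting of continuous functions on closed sets.\<close>

lemma qtr_hit:
  assumes "\<omega> \<in> hits"
  shows "qtr (\<lambda>s. W s \<omega>) t = (if t \<le> g \<omega> then W t \<omega>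
     else if t \<le> \<tau> \<omega> then W (g \<omega> + \<tau> \<omega> - t) \<omega> - W (\<tau> \<omega>) \<omega> else W t \<omega> - 2 * W (\<tau> \<omega>) \<omega>)"
proof -
  note h = hits_props[OF assms]
  have e: "hit_time (\<lambda>t. W t \<omega>) = \<tau> \<omega>" "last_zero (\<lambda>t. W t \<omega>) = g \<omega>" using assms by (auto simp: \<tau>_def g_def)
  have "\<exists>t\<ge>0. \<bar>W t \<omega>\<bar> = 1" using assms unfolding hits_def by blast
  then have eq: "qtr (\<lambda>s. W s \<omega>) t = (if t < g \<omega> then W t \<omega>
     else if t < \<tau> \<omega> then (if W (\<tau> \<omega>) \<omega> = 1 then W (g \<omega> + \<tau> \<omega> - t) \<omega> - 1 else W (g \<omega> + \<tau> \<omega> - t) \<omega> + 1)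
     else (if W (\<tau> \<omega>) \<omega> = 1 then W t \<omega> - 2 else W t \<omega> + 2))"
    unfolding qtr_def Let_def e by (simp only: if_True)
  have "W (\<tau> \<omega>) \<omega> = 1 \<or> W (\<tau> \<omega>) \<omega> = -1" using h(2) by auto
  then show ?thesis unfolding eq using h(5,6)
    by (cases "t = g \<omega>"; cases "t = \<tau> \<omega>") auto
qed

lemma qtr_measurable:
  assumes t: "0 \<le> t"
  shows "(\<lambda>\<omega>. qtr (\<lambda>s. W s \<omega>) t) \<in> borel_measurable M"
proof -
  have \<tau>0: "\<tau> \<omega> \<ge> 0" for \<omega> using hits_props(1)[of \<omega>] by (cases "\<omega> \<in> hits") (auto simp: \<tau>_def)
  have [measurable]: "(\<lambda>\<omega>. W (\<tau> \<omega>) \<omega>) \<in> borel_measurable M" "W t \<in> borel_measurable M"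
    "(\<lambda>\<omega>. W (max 0 (g \<omega> + \<tau> \<omega> - t)) \<omega>) \<in> borel_measurable M"
    using \<tau>0 W_meas[OF t] by (auto intro!: W_random_time_measurable)
  \<comment> \<open>Evaluation at a random time calls for a nonnegative time on the whole space; in
    the branch where the value is used, the maximum with 0 is inactive.\<close>
  let ?X = "\<lambda>\<omega>. if \<omega> \<in> hits then (if t \<le> g \<omega> then W t \<omega> else if t \<le> \<tau> \<omega> then W (max 0 (g \<omega> + \<tau> \<omega> - t)) \<omega> - W (\<tau> \<omega>) \<omega>
      else W t \<omega> - 2 * W (\<tau> \<omega>) \<omega>) else W t \<omega>"
  have "?X \<in> borel_measurable M" by measurable
  moreover have "qtr (\<lambda>s. W s \<omega>) t = ?X \<omega>" if "\<omega> \<in> space M" for \<omega>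
    using qtr_hit[of \<omega> t] qtr_no_hit[OF that] hits_props(4)[of \<omega>] by (cases "\<omega> \<in> hits") auto
  ultimately show ?thesis by (subst measurable_cong[of M _ ?X]) auto
qed

lemma qtr_continuous:
  assumes \<omega>: "\<omega> \<in> space M"
  shows "continuous_on {0..} (qtr (\<lambda>s. W s \<omega>))"
proof (cases "\<omega> \<in> hits")
  case True
  let ?s = "W (\<tau> \<omega>) \<omega>"
  note h = hits_props[OF True]
  have c: "continuous_on S (\<lambda>t. W (f t) \<omega>)" if "continuous_on S f" "f ` S \<subseteq> {0..}" for S and f :: "real \<Rightarrow> real"
    by (rule continuous_on_compose2[OF W_cont[OF \<omega>] that])
  let ?f2 = "\<lambda>t. W (g \<omega> + \<tau> \<omega> - t) \<omega> - ?s"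
  let ?f3 = "\<lambda>t. W t \<omega> - 2 * ?s"
  have c1: "continuous_on {t\<in>{0..}. t \<le> g \<omega>} (\<lambda>t. W t \<omega>)" by (rule c) auto
  have c2: "continuous_on {t\<in>{g \<omega>..}. t \<le> \<tau> \<omega>} ?f2"
    by (rule continuous_on_diff[OF c continuous_on_const]) (use h in \<open>auto intro: continuous_on_diff\<close>)
  have c3: "continuous_on {t\<in>{g \<omega>..}. \<tau> \<omega> \<le> t} ?f3"
    by (rule continuous_on_diff[OF c continuous_on_const]) (use h in auto)
  have c23: "continuous_on {g \<omega>..} (\<lambda>t. if t \<le> \<tau> \<omega> then ?f2 t else ?f3 t)"
    by (rule continuous_on_cases_le[where h="\<lambda>t. t", OF c2 c3 continuous_on_id]) (use h in auto)
  have "continuous_on {0..} (\<lambda>t. if t \<le> g \<omega> then W t \<omega> else if t \<le> \<tau> \<omega> then ?f2 t else ?f3 t)"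
  proof (rule continuous_on_cases_le[where h="\<lambda>t. t", OF c1 _ continuous_on_id])
    show "continuous_on {t\<in>{0..}. g \<omega> \<le> t} (\<lambda>t. if t \<le> \<tau> \<omega> then ?f2 t else ?f3 t)"
      by (rule continuous_on_subset[OF c23]) auto
  qed (use h in auto)
  then show ?thesis unfolding qtr_hit[OF True, abs_def] .
next
  case False
  then show ?thesis using W_cont[OF \<omega>] qtr_no_hit[OF \<omega>] by simp
qed

lemma qtr_0:
  assumes \<omega>: "\<omega> \<in> space M"
  shows "qtr (\<lambda>s. W s \<omega>) 0 = 0"
proof (cases "\<omega> \<in> hits")
  case True
  then show ?thesis using qtr_hit[OF True, of 0] hits_props(4)[OF True] W_0[OF \<omega>] by simp
next
  case False
  then show ?thesis using W_0[OF \<omega>] qtr_no_hit[OF \<omega>] by simp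
qed

end

subsection \<open>Passage to the limit\<close>

lemma crossing_cong:
  assumes "\<And>j. j \<le> b \<Longrightarrow> Y j = Y' j"
  shows "crossing Y a b s \<longleftrightarrow> crossing Y' a b s"
proof -
  have "crossing Y' a b s" if eq: "\<And>j. j \<le> b \<Longrightarrow> Y j = Y' j" and c: "crossing Y a b s" for Y Y' :: "nat \<Rightarrow> real"
  proof -
    have "a < b" using c by (simp add: crossing_def)
    then have "Y' a = Y a" "Y' b = Y b" "\<And>j. j < b \<Longrightarrow> Y' j = Y j" using eq by auto
    then show ?thesis using c unfolding crossing_def by simp
  qed
  from this[of Y Y'] this[of Y' Y] show ?thesis using assms by auto
qed

text \<open>The correction is the sum of two overshoots, each at most one step: the walk enters
  \<open>b\<close> from inside \<open>(-1, 1)\<close>, and it leaves \<open>a\<close> for a point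
  strictly on the side of \<open>s\<close>.\<close>

lemma flippableI:
  assumes \<theta>: "\<theta> \<noteq> 0" and b: "b \<le> N" and c: "crossing (walk \<theta> z) a b s"
    and small: "\<And>j. j < a \<Longrightarrow> \<bar>walk \<theta> z j - (s + walk \<theta> z a - walk \<theta> z b)\<bar> < 1"
    and ab: "\<bar>walk \<theta> z b - s\<bar> < 1"
    and steps: "\<And>i. i < N \<Longrightarrow> \<bar>snd z i\<bar> \<le> \<kappa> / 2"
  shows "flippable \<theta> \<kappa> N a b s z"
proof -
  let ?Y = "walk \<theta> z"
  have lt: "a < b" and s: "s = 1 \<or> s = -1" and ya: "s * ?Y a \<le> 0" and yb: "1 \<le> s * ?Y b"
    and mid: "\<And>j. a < j \<Longrightarrow> j < b \<Longrightarrow> 0 < s * ?Y j" and in1: "\<And>j. j < b \<Longrightarrow> \<bar>?Y j\<bar> < 1"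
    using c by (auto simp: crossing_def)
  have "?Y b = ?Y (b - 1) + snd z (b - 1)" using walk_Suc[of \<theta> z "b - 1"] lt by simp
  moreover have "\<bar>?Y (b - 1)\<bar> < 1" using in1 lt by auto
  moreover have "\<bar>snd z (b - 1)\<bar> \<le> \<kappa> / 2" using steps lt b by auto
  ultimately have 1: "\<bar>?Y b - s\<bar> \<le> \<kappa> / 2" using s yb by auto
  \<comment> \<open>The case \<open>Suc a = b\<close> is not covered by the condition between
    \<open>a\<close> and \<open>b\<close>; there the exit condition gives the sign.\<close>
  have "0 < s * ?Y (Suc a)" using mid[of "Suc a"] yb lt by (cases "Suc a = b") auto
  moreover have "?Y (Suc a) = ?Y a + snd z a" by (rule walk_Suc)
  moreover have "\<bar>snd z a\<bar> \<le> \<kappa> / 2" using steps lt b by auto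
  ultimately have 2: "\<bar>?Y a\<bar> \<le> \<kappa> / 2" using s ya by auto
  have "\<bar>s + ?Y a - ?Y b\<bar> \<le> \<kappa>" using 1 2 by linarith
  then show ?thesis using b c crossing_flip[OF \<theta> b c small ab] unfolding flippable_def by blast
qed

text \<open>The factor \<open>N\<close> may have infinite mass, like Lebesgue measure here: a
  product with a null set is null because infinity times 0 is 0 in \<open>ennreal\<close>.\<close>

lemma AE_pair_snd:
  assumes "AE \<omega> in M. P \<omega>" "sigma_finite_measure M"
  shows "AE z in N \<Otimes>\<^sub>M M. P (snd z)"
proof -
  interpret sigma_finite_measure M by fact
  obtain A where A: "{\<omega>\<in>space M. \<not> P \<omega>} \<subseteq> A" "A \<in> null_sets M" using assms(1) by (auto simp: eventually_ae_filter)
  have "emeasure (N \<Otimes>\<^sub>M M) (space N \<times> A) = emeasure N (space N) * emeasure M A"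
    using A by (intro emeasure_pair_measure_Times) auto
  then have "space N \<times> A \<in> null_sets (N \<Otimes>\<^sub>M M)" using A by (auto simp: null_sets_def)
  then show ?thesis by (rule AE_I') (use A in \<open>auto simp: space_pair_measure\<close>)
qed

lemma AE_pair_fst:
  assumes "AE u in N. P u" "sigma_finite_measure M"
  shows "AE z in N \<Otimes>\<^sub>M M. P (fst z)"
proof -
  interpret sigma_finite_measure M by fact
  obtain A where A: "{u\<in>space N. \<not> P u} \<subseteq> A" "A \<in> null_sets N" using assms(1) by (auto simp: eventually_ae_filter)
  have "emeasure (N \<Otimes>\<^sub>M M) (A \<times> space M) = emeasure N A * emeasure M (space M)"
    using A by (intro emeasure_pair_measure_Times) auto
  then have "A \<times> space M \<in> null_sets (N \<Otimes>\<^sub>M M)" using A by (auto simp: null_sets_def)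
  then show ?thesis by (rule AE_I') (use A in \<open>auto simp: space_pair_measure\<close>)
qed

section \<open>Grid increments of Brownian motion\<close>

context std_bm
begin

text \<open>Each path is uniformly continuous on \<open>{0..real K}\<close>, so the indicator of the
  event vanishes from some \<open>n\<close> on, and dominated convergence applies.\<close>

lemma grid_steps_small:
  assumes \<delta>: "0 < \<delta>"
  shows "(\<lambda>n. prob {\<omega>\<in>space M. \<exists>j<K * n. \<delta> < \<bar>W (real (Suc j) / real n) \<omega> - W (real j / real n) \<omega>\<bar>}) \<longlonglongrightarrow> 0"
proof -
  define A where "A n = {\<omega>\<in>space M. \<exists>j<K * n. \<delta> < \<bar>W (real (Suc j) / real n) \<omega> - W (real j / real n) \<omega>\<bar>}" for n
  have Wm[measurable]: "W (real j / real n) \<in> borel_measurable M" for j n by (rule W_meas) simp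
  have A[measurable]: "A n \<in> events" for n unfolding A_def by measurable
  have "(\<lambda>n. \<integral>\<omega>. indicator (A n) \<omega> \<partial>M) \<longlonglongrightarrow> (\<integral>\<omega>. 0 \<partial>M :: real)"
  proof (rule integral_dominated_convergence[where w="\<lambda>_. 1"])
    show "AE \<omega> in M. (\<lambda>n. indicator (A n) \<omega>) \<longlonglongrightarrow> (0::real)"
    proof (rule AE_I2)
      fix \<omega> assume \<omega>: "\<omega> \<in> space M"
      have "uniformly_continuous_on {0..real K} (\<lambda>t. W t \<omega>)"
        by (rule compact_uniformly_continuous[OF continuous_on_subset[OF W_cont[OF \<omega>]]]) auto
      then obtain d where d: "0 < d" "\<And>s t. s \<in> {0..real K} \<Longrightarrow> t \<in> {0..real K} \<Longrightarrow> dist s t < d \<Longrightarrow> dist (W s \<omega>) (W t \<omega>) < \<delta>"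
        using \<delta> unfolding uniformly_continuous_on_def by blast
      have "\<forall>\<^sub>F n in sequentially. 1 / real n < d"
        by (rule order_tendstoD(2)[OF lim_1_over_n d(1)])
      then have "\<forall>\<^sub>F n in sequentially. indicator (A n) \<omega> = (0::real)" using eventually_gt_at_top[of 0]
      proof eventually_elim
        case (elim n)
        have "\<not> \<delta> < \<bar>W (real (Suc j) / real n) \<omega> - W (real j / real n) \<omega>\<bar>" if j: "j < K * n" for j
        proof -
          have "real (Suc j) \<le> real (K * n)" using j by (intro of_nat_mono) simp
          then have "real (Suc j) / real n \<in> {0..real K}" "real j / real n \<in> {0..real K}"
            using elim(2) by (auto simp: divide_le_eq)
          moreover have "real (Suc j) / real n - real j / real n = 1 / real n" by (simp add: diff_divide_distrib[symmetric])
          then have "dist (real (Suc j) / real n) (real j / real n) < d" using elim by (simp add: dist_real_def del: of_nat_Suc)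
          ultimately have "dist (W (real (Suc j) / real n) \<omega>) (W (real j / real n) \<omega>) < \<delta>" by (intro d)
          then show ?thesis by (simp add: dist_real_def)
        qed
        then show ?case by (auto simp: A_def indicator_def)
      qed
      then show "(\<lambda>n. indicator (A n) \<omega>) \<longlonglongrightarrow> (0::real)" by (rule tendsto_eventually)
    qed
  qed auto
  moreover have "(\<integral>\<omega>. indicator (A n) \<omega> \<partial>M) = prob (A n)" for n
    using sets.sets_into_space[OF A] by (simp add: Int_absorb2)
  ultimately have "(\<lambda>n. prob (A n)) \<longlonglongrightarrow> 0" by simp
  then show ?thesis unfolding A_def .
qed

definition incr :: "nat \<Rightarrow> nat \<Rightarrow> 'a \<Rightarrow> nat \<Rightarrow> real" where
  "incr n N \<omega> = (\<lambda>i\<in>{..<N}. W (real (Suc i) / real n) \<omega> - W (real i / real n) \<omega>)"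

definition step_law :: "nat \<Rightarrow> real measure" where
  "step_law n = distr M borel (\<lambda>\<omega>. W (1 / real n) \<omega> - W 0 \<omega>)"

lemma step_law_eq:
  assumes "0 < n"
  shows "distr M borel (\<lambda>\<omega>. W (real (Suc i) / real n) \<omega> - W (real i / real n) \<omega>) = step_law n"
proof -
  have *: "distr M borel (\<lambda>\<omega>. W (real (Suc i) / real n) \<omega> - W (real i / real n) \<omega>) =
      density lborel (normal_density 0 (sqrt (1 / real n)))" for i
  proof -
    have "real (Suc i) / real n - real i / real n = 1 / real n" by (simp add: diff_divide_distrib[symmetric])
    moreover have "real i / real n < real (Suc i) / real n" using assms by (intro divide_strict_right_mono) auto
    ultimately have "distributed M lborel (\<lambda>\<omega>. W (real (Suc i) / real n) \<omega> - W (real i / real n) \<omega>) (normal_density 0 (sqrt (1 / real n)))"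
      using W_dist[of "real i / real n" "real (Suc i) / real n"] by simp
    from distributed_distr_eq_density[OF this] show ?thesis by (simp cong: distr_cong)
  qed
  show ?thesis unfolding step_law_def using *[of i] *[of 0] by simp
qed

lemma step_law_props:
  assumes "0 < n"
  shows "prob_space (step_law n)" "sets (step_law n) = sets borel" "distr (step_law n) (step_law n) uminus = step_law n"
proof -
  have rv[measurable]: "W (1 / real n) \<in> borel_measurable M" "W 0 \<in> borel_measurable M" by (auto intro!: W_meas)
  show "prob_space (step_law n)" unfolding step_law_def by (rule prob_space_distr) measurable
  show s: "sets (step_law n) = sets borel" by (simp add: step_law_def)
  interpret U: std_bm M "\<lambda>t \<omega>. - W t \<omega>" by (rule uminus_bm)
  have "distr (step_law n) (step_law n) uminus = distr (step_law n) borel uminus" by (rule distr_cong) (auto simp: s)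
  also have "\<dots> = distr M borel (\<lambda>\<omega>. - W (1 / real n) \<omega> - - W 0 \<omega>)"
    unfolding step_law_def by (subst distr_distr) (auto simp: comp_def)
  also have "\<dots> = density lborel (normal_density 0 (sqrt (1 / real n - 0)))"
    using distributed_distr_eq_density[OF U.W_dist[of 0 "1 / real n"]] assms by (simp cong: distr_cong)
  also have "\<dots> = step_law n" unfolding step_law_def
    using distributed_distr_eq_density[OF W_dist[of 0 "1 / real n"]] assms by (simp cong: distr_cong)
  finally show "distr (step_law n) (step_law n) uminus = step_law n" .
qed

lemma incr_measurable:
  shows "incr n N \<in> measurable M (PiM {..<N} (\<lambda>_. step_law n))"
proof -
  have "incr n N \<in> measurable M (PiM {..<N} (\<lambda>_. borel))"
    unfolding incr_def by (intro measurable_restrict borel_measurable_diff W_meas) auto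
  also have "measurable M (PiM {..<N} (\<lambda>_. borel)) = measurable M (PiM {..<N} (\<lambda>_. step_law n))"
    by (intro measurable_cong_sets sets_PiM_cong) (auto simp: step_law_def)
  finally show ?thesis .
qed

lemma incr_distr:
  assumes "0 < n" "0 < N"
  shows "distr M (PiM {..<N} (\<lambda>_. step_law n)) (incr n N) = PiM {..<N} (\<lambda>_. step_law n)"
proof -
  let ?X = "\<lambda>i \<omega>. W (real (Suc i) / real n) \<omega> - W (real i / real n) \<omega>"
  have "indep_vars (\<lambda>_. borel) ?X {..<N}"
    using W_indep[of "\<lambda>i. real i / real n" N] assms by (simp add: divide_strict_right_mono del: of_nat_Suc)
  then have "distr M (PiM {..<N} (\<lambda>_. borel)) (incr n N) = PiM {..<N} (\<lambda>i. distr M borel (?X i))"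
    unfolding incr_def using assms
    by (subst (asm) indep_vars_iff_distr_eq_PiM') (auto intro!: borel_measurable_diff W_meas)
  also have "\<dots> = PiM {..<N} (\<lambda>_. step_law n)" using step_law_eq[OF assms(1)] by simp
  also have "distr M (PiM {..<N} (\<lambda>_. borel)) (incr n N) = distr M (PiM {..<N} (\<lambda>_. step_law n)) (incr n N)"
    by (intro distr_cong sets_PiM_cong) (auto simp: step_law_def)
  finally show ?thesis .
qed

lemma walk_incr:
  assumes "\<omega> \<in> space M" "j \<le> N"
  shows "walk \<theta> (u, incr n N \<omega>) j = W (real j / real n) \<omega> + \<theta> * u"
proof -
  have "(\<Sum>i<j. incr n N \<omega> i) = (\<Sum>i<j. W (real (Suc i) / real n) \<omega> - W (real i / real n) \<omega>)"
    using assms(2) by (intro sum.cong) (auto simp: incr_def)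
  also have "\<dots> = W (real j / real n) \<omega> - W 0 \<omega>" by (subst sum_lessThan_telescope) simp
  finally show ?thesis using W_0[OF assms(1)] by (simp add: walk_def)
qed

end

section \<open>Exchange identity and limit of expectations\<close>

context std_bm
begin

text \<open>The mesh is chosen after \<open>\<delta> k\<close>, so fine that a step above
  \<open>\<delta> k\<close> before time \<open>k + 1\<close> has probability below
  \<open>(1 / 2) ^ k\<close>; Borel-Cantelli does the rest. The horizon grows with \<open>k\<close>
  so as to contain any fixed time eventually.\<close>

lemma fine_mesh:
  fixes \<delta> :: "nat \<Rightarrow> real"
  assumes \<delta>: "\<And>k. 0 < \<delta> k"
  obtains n :: "nat \<Rightarrow> nat" where "\<And>k. k < n k"
    "AE \<omega> in M. \<forall>\<^sub>F k in sequentially. \<forall>j<Suc k * n k.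
       \<bar>W (real (Suc j) / real (n k)) \<omega> - W (real j / real (n k)) \<omega>\<bar> \<le> \<delta> k"
proof -
  define A where "A k n = {\<omega>\<in>space M. \<exists>j<Suc k * n. \<delta> k < \<bar>W (real (Suc j) / real n) \<omega> - W (real j / real n) \<omega>\<bar>}" for k n
  have Wm[measurable]: "W (real j / real n) \<in> borel_measurable M" for j n by (rule W_meas) simp
  have A[measurable]: "A k n \<in> events" for k n unfolding A_def by measurable
  have "\<exists>n. k < n \<and> prob (A k n) < (1 / 2) ^ k" for k
  proof -
    have "\<forall>\<^sub>F n in sequentially. prob (A k n) < (1 / 2) ^ k" unfolding A_def
      by (rule order_tendstoD(2)[OF grid_steps_small]) (use \<delta> in auto)
    then have "\<forall>\<^sub>F n in sequentially. k < n \<and> prob (A k n) < (1 / 2) ^ k"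
      using eventually_gt_at_top[of k] by eventually_elim auto
    then show ?thesis by (rule eventually_happens'[OF sequentially_bot])
  qed
  then obtain n where n: "\<And>k. k < n k" "\<And>k. prob (A k (n k)) < (1 / 2) ^ k" by metis
  have "summable (\<lambda>k. prob (A k (n k)))"
    by (rule summable_comparison_test'[where g="\<lambda>k. (1 / 2) ^ k" and N=0]) (use n(2) in \<open>auto intro: less_imp_le summable_geometric\<close>)
  then have "AE \<omega> in M. \<forall>\<^sub>F k in sequentially. \<omega> \<in> space M - A k (n k)"
    by (intro borel_cantelli_AE1) (auto simp: emeasure_eq_measure)
  then have "AE \<omega> in M. \<forall>\<^sub>F k in sequentially. \<forall>j<Suc k * n k.
       \<bar>W (real (Suc j) / real (n k)) \<omega> - W (real j / real (n k)) \<omega>\<bar> \<le> \<delta> k"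
  proof eventually_elim
    case (elim \<omega>)
    then show ?case
    proof eventually_elim
      case (elim k) then show ?case unfolding A_def by (blast intro: leI)
    qed
  qed
  with n(1) show ?thesis by (rule that)
qed

lemma emeasure_strip:
  "A \<in> sets borel \<Longrightarrow> emeasure (lborel \<Otimes>\<^sub>M M) ((A :: real set) \<times> space M) = emeasure lborel A"
  using emeasure_pair_measure_Times[of A lborel "space M"] emeasure_space_1 by simp

text \<open>The window has Lebesgue measure 1, so it converts integrals over the infinite product
  back into expectations.\<close>

lemma integral_indicator_times:
  fixes h :: "'a \<Rightarrow> real"
  assumes h[measurable]: "h \<in> borel_measurable M" and b: "\<And>\<omega>. \<bar>h \<omega>\<bar> \<le> 1"
  shows "(\<integral>z. indicator {0..1::real} (fst z) * h (snd z) \<partial>(lborel \<Otimes>\<^sub>M M)) = expectation h"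
proof -
  interpret pair_sigma_finite "lborel :: real measure" M ..
  have fin: "emeasure (lborel \<Otimes>\<^sub>M M) ({0..1::real} \<times> space M) = 1"
    by (simp add: emeasure_strip)
  have "integrable (lborel \<Otimes>\<^sub>M M) (\<lambda>z. indicator ({0..1::real} \<times> space M) z :: real)"
    using fin by (intro integrable_real_indicator) auto
  then have "integrable (lborel \<Otimes>\<^sub>M M) (\<lambda>z. indicator {0..1::real} (fst z) * h (snd z))"
    by (rule Bochner_Integration.integrable_bound)
      (use b in \<open>auto simp: indicator_def abs_mult space_pair_measure intro!: AE_I2\<close>)
  from integral_fst'[OF this]
  have "(\<integral>z. indicator {0..1::real} (fst z) * h (snd z) \<partial>(lborel \<Otimes>\<^sub>M M)) =
      (\<integral>u. indicator {0..1::real} u * expectation h \<partial>lborel)" by simp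
  also have "\<dots> = expectation h" by simp
  finally show ?thesis .
qed

lemma qtr_expectation:
  fixes f :: "nat \<Rightarrow> real \<Rightarrow> real" and ts :: "nat \<Rightarrow> real"
  assumes f: "\<And>i. continuous_on UNIV (f i)" and f0: "\<And>i x. 0 \<le> f i x" and f1: "\<And>i x. f i x \<le> 1"
    and ts: "\<And>i. i \<le> m \<Longrightarrow> 0 \<le> ts i"
  shows "expectation (\<lambda>\<omega>. \<Prod>i<m. f i (qtr (\<lambda>s. W s \<omega>) (ts (Suc i)) - qtr (\<lambda>s. W s \<omega>) (ts i))) =
    expectation (\<lambda>\<omega>. \<Prod>i<m. f i (W (ts (Suc i)) \<omega> - W (ts i) \<omega>))"
proof -
  let ?L = "lborel \<Otimes>\<^sub>M M :: (real \<times> 'a) measure"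
  have sfm: "sigma_finite_measure M" ..
  have fm[measurable]: "f i \<in> borel_measurable borel" for i using f by (rule borel_measurable_continuous_onI)
  define \<theta> where "\<theta> k = 1 / real (Suc k)" for k
  \<comment> \<open>The flip moves \<open>u\<close> by at most
    \<open>\<kappa> k / \<theta> k\<close>, which is \<open>\<theta> k\<close> for this choice and
    thus tends to 0.\<close>
  define \<kappa> where "\<kappa> k = (\<theta> k)\<^sup>2" for k
  have \<theta>: "0 < \<theta> k" "\<theta> k \<noteq> 0" "\<theta> k \<le> 1" for k by (auto simp: \<theta>_def)
  have \<kappa>: "0 < \<kappa> k" for k using \<theta>(1)[of k] by (simp add: \<kappa>_def)
  have \<theta>0: "\<theta> \<longlonglongrightarrow> 0" unfolding \<theta>_def using LIMSEQ_inverse_real_of_nat by (simp add: inverse_eq_divide)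
  obtain n where n: "\<And>k. k < n k" and mesh: "AE \<omega> in M. \<forall>\<^sub>F k in sequentially. \<forall>j<Suc k * n k.
       \<bar>W (real (Suc j) / real (n k)) \<omega> - W (real j / real (n k)) \<omega>\<bar> \<le> \<kappa> k / 2"
    using fine_mesh[of "\<lambda>k. \<kappa> k / 2"] \<kappa> by auto
  have n0: "0 < n k" for k using n[of k] by simp
  have ninf: "filterlim n at_top sequentially"
    by (rule filterlim_at_top_mono[OF filterlim_ident]) (use n in \<open>auto intro!: always_eventually less_imp_le\<close>)
  define N where "N k = Suc k * n k" for k
  have N0: "0 < N k" for k using n0[of k] by (simp add: N_def)
  define J where "J k t = min (N k) (nat \<lfloor>real (n k) * t\<rfloor>)" for k t
  define Q where "Q k = (lborel :: real measure) \<Otimes>\<^sub>M PiM {..<N k} (\<lambda>_. step_law (n k))" for k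
  define Z where "Z k = (\<lambda>z :: real \<times> 'a. (fst z, incr (n k) (N k) (snd z)))" for k
  have Zm[measurable]: "Z k \<in> measurable ?L (Q k)" for k
    unfolding Z_def Q_def using incr_measurable by measurable
  have Zd: "distr ?L (Q k) (Z k) = Q k" for k
  proof -
    have P: "prob_space (PiM {..<N k} (\<lambda>_. step_law (n k)))"
      by (intro prob_space_PiM step_law_props n0)
    have "distr lborel lborel (\<lambda>x. x) \<Otimes>\<^sub>M distr M (PiM {..<N k} (\<lambda>_. step_law (n k))) (incr (n k) (N k)) =
        distr ?L (Q k) (\<lambda>(x, y). (x, incr (n k) (N k) y))" unfolding Q_def
      by (rule pair_measure_distr)
        (use prob_space_imp_sigma_finite[OF P] in \<open>auto simp: incr_distr[OF n0 N0] incr_measurable\<close>)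
    then show ?thesis by (simp add: distr_id incr_distr[OF n0 N0] Q_def Z_def split_beta')
  qed
  have "\<exists>\<Phi>. \<Phi> \<in> measurable (Q k) (Q k) \<and> distr (Q k) (Q k) \<Phi> = Q k \<and> (\<forall>z\<in>space (Q k). \<Phi> (\<Phi> z) = z) \<and>
      (\<forall>a b s. \<forall>z\<in>space (Q k). flippable (\<theta> k) (\<kappa> k) (N k) a b s z \<longrightarrow> \<Phi> z = flip (\<theta> k) (N k) a b s z) \<and>
      (\<forall>z. \<theta> k * \<bar>fst (\<Phi> z) - fst z\<bar> \<le> \<bar>\<kappa> k\<bar>)" for k
    unfolding Q_def
    by (rule reversal_involution[OF step_law_props[OF n0[of k]] \<theta>(2)[of k], where N="N k" and \<kappa>="\<kappa> k"]) blast
  then obtain \<Phi> where \<Phi>: "\<And>k. \<Phi> k \<in> measurable (Q k) (Q k)" "\<And>k. distr (Q k) (Q k) (\<Phi> k) = Q k"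
    "\<And>k z. z \<in> space (Q k) \<Longrightarrow> \<Phi> k (\<Phi> k z) = z"
    "\<And>k a b s z. z \<in> space (Q k) \<Longrightarrow> flippable (\<theta> k) (\<kappa> k) (N k) a b s z \<Longrightarrow> \<Phi> k z = flip (\<theta> k) (N k) a b s z"
    "\<And>k z. \<theta> k * \<bar>fst (\<Phi> k z) - fst z\<bar> \<le> \<bar>\<kappa> k\<bar>" by metis
  note \<Phi>(1)[measurable]
  have shift: "\<bar>fst (\<Phi> k z) - fst z\<bar> \<le> \<theta> k" for k z
  proof -
    have "\<theta> k * \<bar>fst (\<Phi> k z) - fst z\<bar> \<le> \<theta> k * \<theta> k" using \<Phi>(5)[of k z] by (simp add: \<kappa>_def power2_eq_square)
    then show ?thesis using \<theta>(1)[of k] by simp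
  qed
  \<comment> \<open>\<open>J k t\<close> is capped at \<open>N k\<close> only to keep \<open>H k\<close> measurable; the cap is eventually inactive.\<close>
  define H where "H k z = (\<Prod>i<m. f i (walk (\<theta> k) z (J k (ts (Suc i))) - walk (\<theta> k) z (J k (ts i))))" for k z
  have wm[measurable]: "(\<lambda>z. walk (\<theta> k) z (J k t)) \<in> borel_measurable (Q k)" for k t
    unfolding Q_def by (rule walk_measurable) (auto simp: J_def step_law_def)
  have Hm[measurable]: "H k \<in> borel_measurable (Q k)" for k unfolding H_def by measurable
  have fst[measurable]: "fst \<in> borel_measurable (Q k)" for k unfolding Q_def by measurable
  have prod01: "0 \<le> (\<Prod>i<m. f i (x i))" "(\<Prod>i<m. f i (x i)) \<le> 1" for x
    using f0 f1 by (auto intro: prod_nonneg prod_le_1)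
  have H01: "0 \<le> H k z" "H k z \<le> 1" for k z unfolding H_def using prod01 by auto
  let ?I = "indicator {0..1::real} :: real \<Rightarrow> real"
  \<comment> \<open>Both the involution property and the invariance of \<open>Q k\<close> enter: the
    window variable is written as \<open>fst (\<Phi> k (\<Phi> k z))\<close>, and then
    \<open>\<Phi> k z\<close> is renamed to \<open>z\<close>.\<close>
  have exchange: "(\<integral>z. ?I (fst z) * H k (\<Phi> k (Z k z)) \<partial>?L) = (\<integral>z. ?I (fst (\<Phi> k (Z k z))) * H k (Z k z) \<partial>?L)" for k
  proof -
    have "(\<integral>z. ?I (fst z) * H k (\<Phi> k (Z k z)) \<partial>?L) = (\<integral>z. ?I (fst (Z k z)) * H k (\<Phi> k (Z k z)) \<partial>?L)" by (simp add: Z_def)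
    also have "\<dots> = (\<integral>z. ?I (fst z) * H k (\<Phi> k z) \<partial>distr ?L (Q k) (Z k))"
      by (rule integral_distr[symmetric]) measurable
    also have "\<dots> = (\<integral>z. ?I (fst (\<Phi> k (\<Phi> k z))) * H k (\<Phi> k z) \<partial>Q k)"
      unfolding Zd by (intro Bochner_Integration.integral_cong) (auto simp: \<Phi>(3))
    also have "\<dots> = (\<integral>z. ?I (fst (\<Phi> k z)) * H k z \<partial>distr (Q k) (Q k) (\<Phi> k))"
      by (rule integral_distr[symmetric]) measurable
    also have "\<dots> = (\<integral>z. ?I (fst (\<Phi> k z)) * H k z \<partial>distr ?L (Q k) (Z k))" unfolding Zd \<Phi>(2) ..
    also have "\<dots> = (\<integral>z. ?I (fst (\<Phi> k (Z k z))) * H k (Z k z) \<partial>?L)"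
      by (rule integral_distr) measurable
    finally show ?thesis .
  qed
  define h where "h \<omega> = (\<Prod>i<m. f i (W (ts (Suc i)) \<omega> - W (ts i) \<omega>))" for \<omega>
  define hq where "hq \<omega> = (\<Prod>i<m. f i (qtr (\<lambda>s. W s \<omega>) (ts (Suc i)) - qtr (\<lambda>s. W s \<omega>) (ts i)))" for \<omega>
  have hm[measurable]: "h \<in> borel_measurable M" unfolding h_def
    by (intro borel_measurable_prod measurable_compose[OF _ fm] borel_measurable_diff W_meas ts) auto
  have hqm[measurable]: "hq \<in> borel_measurable M" unfolding hq_def
    by (intro borel_measurable_prod measurable_compose[OF _ fm] borel_measurable_diff qtr_measurable ts) auto
  have lims: "(\<lambda>k. H k (\<Phi> k (Z k z))) \<longlonglongrightarrow> hq (snd z) \<and> (\<lambda>k. H k (Z k z)) \<longlonglongrightarrow> h (snd z)"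
    if good: "good_path (\<lambda>t. W t (snd z))" and small: "\<forall>\<^sub>F k in sequentially. \<forall>j<Suc k * n k.
       \<bar>W (real (Suc j) / real (n k)) (snd z) - W (real j / real (n k)) (snd z)\<bar> \<le> \<kappa> k / 2"
      and zsp: "z \<in> space ?L" for z
  proof -
    define u where "u = fst z"
    define \<omega> where "\<omega> = snd z"
    have \<omega>: "\<omega> \<in> space M" using zsp by (auto simp: \<omega>_def space_pair_measure)
    define w where "w t = W t \<omega>" for t
    have good: "good_path w" using good by (simp add: w_def[abs_def] \<omega>_def)
    define c where "c k = \<theta> k * u" for k
    have c: "c \<longlonglongrightarrow> 0" unfolding c_def using tendsto_mult_left_zero[OF \<theta>0] by blast
    define y where "y k j = w (real j / real (n k)) + c k" for k j
    define a where "a = cross_start w n c"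
    define b where "b = cross_end w n c"
    define s where "s = w (hit_time w)"
    note lem = good ninf c
    have Zw: "walk (\<theta> k) (Z k z) j = y k j" if "j \<le> N k" for k j
      using walk_incr[OF \<omega> that, of "\<theta> k" u "n k"] by (simp add: Z_def y_def w_def c_def u_def \<omega>_def)
    have bN: "\<forall>\<^sub>F k in sequentially. b k \<le> N k"
    proof -
      have "\<forall>\<^sub>F k in sequentially. real (b k) / real (n k) < hit_time w + 1"
        using order_tendstoD(2)[OF cross_end_tendsto[OF lem], of "hit_time w + 1"] by (simp add: b_def)
      moreover have "\<forall>\<^sub>F k in sequentially. hit_time w + 1 \<le> real k"
        using filterlim_real_sequentially by (simp add: filterlim_at_top)
      ultimately show ?thesis
      proof eventually_elim
        case (elim k)
        have "real (b k) / real (n k) \<le> real (Suc k)" using elim by simp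
        then have "real (b k) \<le> real (Suc k * n k)" using n0[of k] by (simp add: divide_le_eq distrib_right)
        then show ?case unfolding N_def by linarith
      qed
    qed
    have JN: "\<forall>\<^sub>F k in sequentially. J k t = nat \<lfloor>real (n k) * t\<rfloor>" if t: "0 \<le> t" for t
    proof -
      have "\<forall>\<^sub>F k in sequentially. t \<le> real k"
        using filterlim_real_sequentially by (simp add: filterlim_at_top)
      then show ?thesis
      proof eventually_elim
        case (elim k)
        have "real (n k) * t \<le> real (n k) * real (Suc k)" using elim by (intro mult_left_mono) auto
        then have "real (n k) * t \<le> real (N k)" by (simp add: N_def algebra_simps)
        then have "nat \<lfloor>real (n k) * t\<rfloor> \<le> N k" by linarith
        then show ?case by (simp add: J_def)
      qed
    qed
    \<comment> \<open>From some \<open>k\<close> on, the glued map acts on this sample as the one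
      flip at its own crossing, so the limit of the explicit formula applies.\<close>
    have flipped: "\<forall>\<^sub>F k in sequentially. \<Phi> k (Z k z) = flip (\<theta> k) (N k) (a k) (b k) s (Z k z) \<and> a k < b k \<and> b k \<le> N k"
      using crossing_ev[OF lem] shifted_ev[OF lem] bN small
    proof eventually_elim
      case (elim k)
      have cr: "crossing (y k) (a k) (b k) s"
        using elim(1) by (simp add: y_def[abs_def] a_def b_def s_def)
      then have ab: "a k < b k" by (simp add: crossing_def)
      have "flippable (\<theta> k) (\<kappa> k) (N k) (a k) (b k) s (Z k z)"
      proof (rule flippableI[OF \<theta>(2) elim(3)])
        show "crossing (walk (\<theta> k) (Z k z)) (a k) (b k) s"
          using cr crossing_cong[of "b k" "walk (\<theta> k) (Z k z)" "y k"] Zw elim(3) by simp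
        show "\<bar>walk (\<theta> k) (Z k z) j - (s + walk (\<theta> k) (Z k z) (a k) - walk (\<theta> k) (Z k z) (b k))\<bar> < 1" if "j < a k" for j
          using elim(2) that ab elim(3) by (simp add: Zw) (simp add: y_def a_def b_def s_def)
        show "\<bar>walk (\<theta> k) (Z k z) (b k) - s\<bar> < 1"
          using elim(2,3) by (simp add: Zw) (simp add: y_def a_def b_def s_def)
        show "\<bar>snd (Z k z) i\<bar> \<le> \<kappa> k / 2" if "i < N k" for i
          using elim(4) that by (simp add: Z_def incr_def N_def)
      qed
      then have "\<Phi> k (Z k z) = flip (\<theta> k) (N k) (a k) (b k) s (Z k z)"
        using measurable_space[OF Zm zsp] by (rule \<Phi>(4)[rotated])
      then show ?case using ab elim(3) by simp
    qed
    have lim1: "(\<lambda>k. walk (\<theta> k) (\<Phi> k (Z k z)) (J k t)) \<longlonglongrightarrow> qtr w t" if t: "0 \<le> t" for t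
    proof (rule Lim_transform_eventually[OF reversed_tendsto[OF lem t]])
      show "\<forall>\<^sub>F k in sequentially.
        (if nat \<lfloor>real (n k) * t\<rfloor> \<le> cross_start w n c k
         then w (real (nat \<lfloor>real (n k) * t\<rfloor>) / real (n k)) + c k - (w (hit_time w) + (w (real (cross_start w n c k) / real (n k)) + c k) - (w (real (cross_end w n c k) / real (n k)) + c k))
         else if nat \<lfloor>real (n k) * t\<rfloor> \<le> cross_end w n c k then w (real (cross_start w n c k + cross_end w n c k - nat \<lfloor>real (n k) * t\<rfloor>) / real (n k)) + c k - w (hit_time w)
         else w (real (nat \<lfloor>real (n k) * t\<rfloor>) / real (n k)) + c k + (w (real (cross_start w n c k) / real (n k)) + c k) - (w (real (cross_end w n c k) / real (n k)) + c k) - w (hit_time w)) =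
         walk (\<theta> k) (\<Phi> k (Z k z)) (J k t)"
        using flipped JN[OF t]
      proof eventually_elim
        case (elim k)
        have J: "J k t \<le> N k" by (simp add: J_def)
        have "walk (\<theta> k) (\<Phi> k (Z k z)) (J k t) =
          (if J k t \<le> a k then y k (J k t) - (s + y k (a k) - y k (b k))
           else if J k t \<le> b k then y k (a k + b k - J k t) - s
           else y k (J k t) + y k (a k) - y k (b k) - s)"
        proof -
          \<comment> \<open>Beyond \<open>a k\<close> the reflected index is below
            \<open>b k\<close>, hence within the range of the sampled increments.\<close>
          have "walk (\<theta> k) (Z k z) (a k + b k - J k t) = y k (a k + b k - J k t)" if "\<not> J k t \<le> a k"
            using that elim(1) by (intro Zw) auto
          moreover have "walk (\<theta> k) (Z k z) (a k) = y k (a k)" "walk (\<theta> k) (Z k z) (b k) = y k (b k)"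
            using elim(1) by (auto intro!: Zw)
          ultimately show ?thesis
            using elim(1) walk_flip[OF \<theta>(2), of "a k" "b k" "N k" "J k t" k s "Z k z"] J Zw[OF J] by auto
        qed
        then show ?case unfolding elim(2) y_def a_def b_def s_def by simp
      qed
    qed
    have lim2: "(\<lambda>k. walk (\<theta> k) (Z k z) (J k t)) \<longlonglongrightarrow> w t" if t: "0 \<le> t" for t
    proof (rule Lim_transform_eventually[OF y_tendsto[OF lem grid_tendsto[OF ninf t]]])
      show "\<forall>\<^sub>F k in sequentially. w (real (nat \<lfloor>real (n k) * t\<rfloor>) / real (n k)) + c k = walk (\<theta> k) (Z k z) (J k t)"
        using JN[OF t]
      proof eventually_elim
        case (elim k)
        have "J k t \<le> N k" by (simp add: J_def)
        from Zw[OF this] show ?case unfolding elim y_def by simp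
      qed
    qed
    have fl: "(\<lambda>k. f i (x k)) \<longlonglongrightarrow> f i l" if "x \<longlonglongrightarrow> l" for i x l
      by (rule continuous_on_tendsto_compose[OF f that]) auto
    have "(\<lambda>k. H k (\<Phi> k (Z k z))) \<longlonglongrightarrow> (\<Prod>i<m. f i (qtr w (ts (Suc i)) - qtr w (ts i)))"
      unfolding H_def by (intro tendsto_prod fl tendsto_diff lim1 ts) auto
    moreover have "(\<lambda>k. H k (Z k z)) \<longlonglongrightarrow> (\<Prod>i<m. f i (w (ts (Suc i)) - w (ts i)))"
      unfolding H_def by (intro tendsto_prod fl tendsto_diff lim2 ts) auto
    ultimately show ?thesis by (simp add: h_def hq_def w_def[abs_def] \<omega>_def)
  qed
  have lims_AE: "AE z in ?L. (\<lambda>k. H k (\<Phi> k (Z k z))) \<longlonglongrightarrow> hq (snd z) \<and> (\<lambda>k. H k (Z k z)) \<longlonglongrightarrow> h (snd z)"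
    using AE_pair_snd[OF AE_good_path sfm, of lborel]
      AE_pair_snd[OF mesh sfm, of lborel] AE_space
    by eventually_elim (rule lims)
  \<comment> \<open>The shift of \<open>u\<close> is at most \<open>\<theta> k \<le> 1\<close>, so
    an image in the window forces \<open>u\<close> into \<open>{-1..2}\<close>; this enlarged strip
    dominates both integrands.\<close>
  have int_I: "integrable ?L (\<lambda>z. indicator ({-1..2::real} \<times> space M) z :: real)"
  proof (rule integrable_real_indicator)
    show "emeasure ?L ({-1..2} \<times> space M) < \<infinity>"
      by (simp add: emeasure_strip)
  qed auto
  have "(\<lambda>k. \<integral>z. ?I (fst z) * H k (\<Phi> k (Z k z)) \<partial>?L) \<longlonglongrightarrow> (\<integral>z. ?I (fst z) * hq (snd z) \<partial>?L)"
  proof (rule integral_dominated_convergence[OF _ _ int_I])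
    show "AE z in ?L. (\<lambda>k. ?I (fst z) * H k (\<Phi> k (Z k z))) \<longlonglongrightarrow> ?I (fst z) * hq (snd z)"
      using lims_AE by eventually_elim (auto intro: tendsto_mult)
    show "AE z in ?L. norm (?I (fst z) * H k (\<Phi> k (Z k z))) \<le> indicator ({-1..2::real} \<times> space M) z" for k
      using H01 by (intro AE_I2) (auto simp: indicator_def space_pair_measure)
  qed measurable
  moreover have "(\<lambda>k. \<integral>z. ?I (fst (\<Phi> k (Z k z))) * H k (Z k z) \<partial>?L) \<longlonglongrightarrow> (\<integral>z. ?I (fst z) * h (snd z) \<partial>?L)"
  proof (rule integral_dominated_convergence[OF _ _ int_I])
    \<comment> \<open>Away from its two endpoints the window indicator is locally constant, so it
      does not notice the vanishing shift.\<close>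
    have "AE u in (lborel :: real measure). u \<noteq> 0 \<and> u \<noteq> 1"
      using AE_lborel_singleton[of 0] AE_lborel_singleton[of 1] by eventually_elim auto
    from AE_pair_fst[OF this sfm]
    show "AE z in ?L. (\<lambda>k. ?I (fst (\<Phi> k (Z k z))) * H k (Z k z)) \<longlonglongrightarrow> ?I (fst z) * h (snd z)"
      using lims_AE
    proof eventually_elim
      case (elim z)
      have "(\<lambda>k. fst (\<Phi> k (Z k z)) - fst z) \<longlonglongrightarrow> 0"
        by (rule tendsto_rabs_zero_cancel, rule tendsto_sandwich[OF _ _ tendsto_const \<theta>0])
          (use shift[of _ "Z _ z"] in \<open>auto simp: Z_def\<close>)
      then have l: "(\<lambda>k. fst (\<Phi> k (Z k z))) \<longlonglongrightarrow> fst z" by (rule Lim_null[THEN iffD2])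
      have "\<forall>\<^sub>F k in sequentially. ?I (fst (\<Phi> k (Z k z))) = ?I (fst z)"
      proof -
        consider "fst z < 0" | "0 < fst z" "fst z < 1" | "1 < fst z" using elim(1) by linarith
        then show ?thesis
        proof cases
          case 1 from order_tendstoD(2)[OF l 1] show ?thesis by eventually_elim (use 1 in auto)
        next
          case 2 from order_tendstoD(1)[OF l 2(1)] order_tendstoD(2)[OF l 2(2)]
          show ?thesis by eventually_elim (use 2 in auto)
        next
          case 3 from order_tendstoD(1)[OF l 3] show ?thesis by eventually_elim (use 3 in auto)
        qed
      qed
      then have "(\<lambda>k. ?I (fst (\<Phi> k (Z k z)))) \<longlonglongrightarrow> ?I (fst z)" by (rule tendsto_eventually)
      then show ?case using elim(2) by (auto intro: tendsto_mult)
    qed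
    show "AE z in ?L. norm (?I (fst (\<Phi> k (Z k z))) * H k (Z k z)) \<le> indicator ({-1..2::real} \<times> space M) z" for k
    proof (rule AE_I2)
      fix z assume z: "z \<in> space ?L"
      have "\<bar>fst (\<Phi> k (Z k z)) - fst z\<bar> \<le> 1" using shift[of k "Z k z"] \<theta>(3)[of k] by (simp add: Z_def)
      then show "norm (?I (fst (\<Phi> k (Z k z))) * H k (Z k z)) \<le> indicator ({-1..2::real} \<times> space M) z"
        using H01[of k "Z k z"] z by (auto simp: indicator_def space_pair_measure mem_Times_iff)
    qed
  qed measurable
  ultimately have "(\<integral>z. ?I (fst z) * hq (snd z) \<partial>?L) = (\<integral>z. ?I (fst z) * h (snd z) \<partial>?L)"
    unfolding exchange by (rule LIMSEQ_unique)
  then have "expectation hq = expectation h"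
    using integral_indicator_times[of h] integral_indicator_times[of hq] prod01 by (auto simp: h_def hq_def abs_le_iff intro: order_trans[of _ 0])
  then show ?thesis unfolding h_def[abs_def] hq_def[abs_def] .
qed

text \<open>Each ramp equals 1 up to \<open>a i\<close> and tends to 0 beyond it, so the limit is
  the closed half-line at every point, including the boundary. The constant factor 1 outside
  \<open>S\<close> gives access to the joint laws of subfamilies.\<close>

lemma expectation_ramps:
  fixes D :: "nat \<Rightarrow> 'a \<Rightarrow> real"
  assumes D[measurable]: "\<And>i. i < m \<Longrightarrow> D i \<in> borel_measurable M" and S: "S \<subseteq> {..<m}"
  shows "(\<lambda>k. expectation (\<lambda>\<omega>. \<Prod>i<m. if i \<in> S then max 0 (min 1 (1 - real k * (D i \<omega> - a i))) else 1))
    \<longlonglongrightarrow> prob {\<omega>\<in>space M. \<forall>i\<in>S. D i \<omega> \<le> a i}"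
proof -
  let ?A = "{\<omega>\<in>space M. \<forall>i\<in>S. D i \<omega> \<le> a i}"
  have S': "finite S" using S finite_subset by blast
  have Dm: "D i \<in> borel_measurable M" if "i \<in> S" for i using D S that by auto
  have A: "?A \<in> events" using S' Dm
    by (intro sets.sets_Collect_finite_All borel_measurable_le borel_measurable_const) auto
  have ramp: "(\<lambda>k. max 0 (min 1 (1 - real k * (x - y)))) \<longlonglongrightarrow> indicator {..y} x" for x y :: real
  proof (cases "x \<le> y")
    case True
    have "max 0 (min 1 (1 - real k * (x - y))) = 1" for k
      using mult_nonneg_nonpos[of "real k" "x - y"] True by (auto simp: max_def min_def)
    then show ?thesis using True by simp
  next
    case False
    have "\<forall>\<^sub>F k in sequentially. 1 / (x - y) \<le> real k"
      using filterlim_real_sequentially by (simp add: filterlim_at_top)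
    then have "\<forall>\<^sub>F k in sequentially. max 0 (min 1 (1 - real k * (x - y))) = indicator {..y} x"
    proof eventually_elim
      case (elim k)
      then have "1 \<le> real k * (x - y)" using False by (simp add: divide_le_eq)
      then show ?case using False by (auto simp: max_def min_def)
    qed
    then show ?thesis by (rule tendsto_eventually)
  qed
  have "(\<lambda>k. expectation (\<lambda>\<omega>. \<Prod>i<m. if i \<in> S then max 0 (min 1 (1 - real k * (D i \<omega> - a i))) else 1))
    \<longlonglongrightarrow> expectation (\<lambda>\<omega>. \<Prod>i<m. if i \<in> S then indicator {..a i} (D i \<omega>) else 1 :: real)"
  proof (rule integral_dominated_convergence[where w="\<lambda>_. 1"])
    show "(\<lambda>\<omega>. \<Prod>i<m. if i \<in> S then indicator {..a i} (D i \<omega>) else 1 :: real) \<in> borel_measurable M"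
      by (intro borel_measurable_prod) auto
    show "(\<lambda>\<omega>. \<Prod>i<m. if i \<in> S then max 0 (min 1 (1 - real k * (D i \<omega> - a i))) else 1) \<in> borel_measurable M" for k
      by (intro borel_measurable_prod) auto
    show "AE \<omega> in M. (\<lambda>k. \<Prod>i<m. if i \<in> S then max 0 (min 1 (1 - real k * (D i \<omega> - a i))) else 1)
      \<longlonglongrightarrow> (\<Prod>i<m. if i \<in> S then indicator {..a i} (D i \<omega>) else 1 :: real)"
      by (intro AE_I2 tendsto_prod) (simp add: ramp)
    show "AE \<omega> in M. norm (\<Prod>i<m. if i \<in> S then max 0 (min 1 (1 - real k * (D i \<omega> - a i))) else 1) \<le> 1" for k
      by (intro AE_I2) (simp add: abs_prod, intro prod_le_1, auto)
  qed simp
  also have "expectation (\<lambda>\<omega>. \<Prod>i<m. if i \<in> S then indicator {..a i} (D i \<omega>) else 1 :: real) = expectation (indicator ?A)"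
  proof (intro Bochner_Integration.integral_cong refl)
    fix \<omega> assume \<omega>: "\<omega> \<in> space M"
    show "(\<Prod>i<m. if i \<in> S then indicator {..a i} (D i \<omega>) else 1 :: real) = (indicator ?A \<omega> :: real)"
    proof (cases "\<omega> \<in> ?A")
      case True then show ?thesis by (auto intro!: prod.neutral)
    next
      case False
      then obtain i where "i \<in> S" "\<not> D i \<omega> \<le> a i" using \<omega> by auto
      then show ?thesis using S False by (auto intro!: bexI[of _ i] simp: prod_zero_iff)
    qed
  qed
  also have "\<dots> = prob ?A" using A sets.sets_into_space[OF A] by (simp add: Int_absorb2)
  finally show ?thesis .
qed

lemma qtr_increments_cdf:
  assumes ts: "\<And>i. i \<le> m \<Longrightarrow> 0 \<le> ts i" and S: "S \<subseteq> {..<m}"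
  shows "prob {\<omega>\<in>space M. \<forall>i\<in>S. qtr (\<lambda>s. W s \<omega>) (ts (Suc i)) - qtr (\<lambda>s. W s \<omega>) (ts i) \<le> a i} =
    prob {\<omega>\<in>space M. \<forall>i\<in>S. W (ts (Suc i)) \<omega> - W (ts i) \<omega> \<le> a i}"
proof (rule LIMSEQ_unique)
  let ?f = "\<lambda>k i x. if i \<in> S then max 0 (min 1 (1 - real k * (x - a i))) else 1"
  show "(\<lambda>k. expectation (\<lambda>\<omega>. \<Prod>i<m. ?f k i (qtr (\<lambda>s. W s \<omega>) (ts (Suc i)) - qtr (\<lambda>s. W s \<omega>) (ts i))))
    \<longlonglongrightarrow> prob {\<omega>\<in>space M. \<forall>i\<in>S. qtr (\<lambda>s. W s \<omega>) (ts (Suc i)) - qtr (\<lambda>s. W s \<omega>) (ts i) \<le> a i}"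
    by (rule expectation_ramps[OF _ S]) (auto intro!: borel_measurable_diff qtr_measurable ts)
  have "expectation (\<lambda>\<omega>. \<Prod>i<m. ?f k i (qtr (\<lambda>s. W s \<omega>) (ts (Suc i)) - qtr (\<lambda>s. W s \<omega>) (ts i))) =
      expectation (\<lambda>\<omega>. \<Prod>i<m. ?f k i (W (ts (Suc i)) \<omega> - W (ts i) \<omega>))" for k
  proof (rule qtr_expectation)
    show "continuous_on UNIV (?f k i)" for i by (cases "i \<in> S") (auto intro!: continuous_intros)
  qed (use ts in auto)
  moreover have "(\<lambda>k. expectation (\<lambda>\<omega>. \<Prod>i<m. ?f k i (W (ts (Suc i)) \<omega> - W (ts i) \<omega>)))
    \<longlonglongrightarrow> prob {\<omega>\<in>space M. \<forall>i\<in>S. W (ts (Suc i)) \<omega> - W (ts i) \<omega> \<le> a i}"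
    by (rule expectation_ramps[OF _ S]) (auto intro!: borel_measurable_diff W_meas ts)
  ultimately show "(\<lambda>k. expectation (\<lambda>\<omega>. \<Prod>i<m. ?f k i (qtr (\<lambda>s. W s \<omega>) (ts (Suc i)) - qtr (\<lambda>s. W s \<omega>) (ts i))))
    \<longlonglongrightarrow> prob {\<omega>\<in>space M. \<forall>i\<in>S. W (ts (Suc i)) \<omega> - W (ts i) \<omega> \<le> a i}" by simp
qed

text \<open>The half-lines form an intersection-stable generator of the Borel sets, so independence
  of the generated families follows from that of the half-line events.\<close>

lemma indep_vars_cdfI:
  fixes X :: "nat \<Rightarrow> 'a \<Rightarrow> real"
  assumes X: "\<And>i. i \<in> I \<Longrightarrow> X i \<in> borel_measurable M"
    and cdf: "\<And>S a. S \<subseteq> I \<Longrightarrow> finite S \<Longrightarrow> S \<noteq> {} \<Longrightarrow>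
      prob {\<omega>\<in>space M. \<forall>i\<in>S. X i \<omega> \<le> a i} = (\<Prod>i\<in>S. prob {\<omega>\<in>space M. X i \<omega> \<le> a i})"
  shows "indep_vars (\<lambda>_. borel) X I"
proof -
  define F where "F i = {X i -` A \<inter> space M | A. A \<in> range (\<lambda>a. {..a})}" for i
  have vim: "X i -` {..a} \<inter> space M = {\<omega>\<in>space M. X i \<omega> \<le> a}" for i a by auto
  have Fe: "B \<in> F i \<longleftrightarrow> (\<exists>a. B = {\<omega>\<in>space M. X i \<omega> \<le> a})" for B i
    unfolding F_def vim[symmetric] by blast
  have "indep_sets F I"
    unfolding indep_sets_def
  proof (intro conjI ballI allI impI)
    show "F i \<subseteq> events" if "i \<in> I" for i
      unfolding F_def using X[OF that] by (auto intro!: measurable_sets[OF X[OF that]])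
    fix S B assume S: "S \<subseteq> I" "S \<noteq> {}" "finite S" and B: "B \<in> Pi S F"
    have "\<forall>i\<in>S. \<exists>a. B i = {\<omega>\<in>space M. X i \<omega> \<le> a}" using B Fe by blast
    then obtain a where a: "\<And>i. i \<in> S \<Longrightarrow> B i = {\<omega>\<in>space M. X i \<omega> \<le> a i}" by metis
    have "(\<Inter>i\<in>S. B i) = {\<omega>\<in>space M. \<forall>i\<in>S. X i \<omega> \<le> a i}" using a S(2) by auto
    then show "prob (\<Inter>i\<in>S. B i) = (\<Prod>i\<in>S. prob (B i))" using cdf[OF S(1,3,2)] a by simp
  qed
  moreover have "Int_stable (F i)" for i
  proof (rule Int_stableI)
    fix A B assume "A \<in> F i" "B \<in> F i"
    obtain a where a: "A = {\<omega>\<in>space M. X i \<omega> \<le> a}" using \<open>A \<in> F i\<close> unfolding Fe ..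
    obtain b where b: "B = {\<omega>\<in>space M. X i \<omega> \<le> b}" using \<open>B \<in> F i\<close> unfolding Fe ..
    have "A \<inter> B = {\<omega>\<in>space M. X i \<omega> \<le> min a b}" unfolding a b by auto
    then show "A \<inter> B \<in> F i" unfolding Fe by (rule exI)
  qed
  ultimately have ind: "indep_sets (\<lambda>i. sigma_sets (space M) (F i)) I" by (intro indep_sets_sigma)
  have borel: "sets (borel :: real measure) = sigma_sets UNIV (range (\<lambda>a. {..a}))"
    by (subst borel_eq_atMost) simp
  have "{X i -` A \<inter> space M | A. A \<in> sets borel} = sigma_sets (space M) (F i)" for i
    unfolding F_def borel by (rule sigma_sets_vimage_commute) simp
  then show ?thesis unfolding indep_vars_def2 using X ind by simp
qed

lemma increments_cdf_prod:
  assumes ts: "0 \<le> ts 0" "\<And>i. i < m \<Longrightarrow> ts i < ts (Suc i)" and S: "S \<subseteq> {..<m}" "finite S" "S \<noteq> {}"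
  shows "prob {\<omega>\<in>space M. \<forall>i\<in>S. W (ts (Suc i)) \<omega> - W (ts i) \<omega> \<le> a i} =
    (\<Prod>i\<in>S. prob {\<omega>\<in>space M. W (ts (Suc i)) \<omega> - W (ts i) \<omega> \<le> a i})"
proof -
  have "indep_sets (\<lambda>i. {(\<lambda>\<omega>. W (ts (Suc i)) \<omega> - W (ts i) \<omega>) -` A \<inter> space M | A. A \<in> sets borel}) {..<m}"
    using W_indep[of ts m] ts unfolding indep_vars_def2 by auto
  moreover have "\<forall>i\<in>S. {\<omega>\<in>space M. W (ts (Suc i)) \<omega> - W (ts i) \<omega> \<le> a i} \<in>
      {(\<lambda>\<omega>. W (ts (Suc i)) \<omega> - W (ts i) \<omega>) -` A \<inter> space M | A. A \<in> sets borel}"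
  proof
    fix i
    show "{\<omega>\<in>space M. W (ts (Suc i)) \<omega> - W (ts i) \<omega> \<le> a i} \<in>
      {(\<lambda>\<omega>. W (ts (Suc i)) \<omega> - W (ts i) \<omega>) -` A \<inter> space M | A. A \<in> sets borel}"
      by (rule CollectI, rule exI[of _ "{..a i}"]) auto
  qed
  ultimately have "prob (\<Inter>i\<in>S. {\<omega>\<in>space M. W (ts (Suc i)) \<omega> - W (ts i) \<omega> \<le> a i}) =
      (\<Prod>i\<in>S. prob {\<omega>\<in>space M. W (ts (Suc i)) \<omega> - W (ts i) \<omega> \<le> a i})"
    using S by (intro indep_setsD)
  moreover have "(\<Inter>i\<in>S. {\<omega>\<in>space M. W (ts (Suc i)) \<omega> - W (ts i) \<omega> \<le> a i}) =
      {\<omega>\<in>space M. \<forall>i\<in>S. W (ts (Suc i)) \<omega> - W (ts i) \<omega> \<le> a i}" using S(3) by auto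
  ultimately show ?thesis by simp
qed

lemma qtr_bm: "std_brownian_motion M (\<lambda>t \<omega>. qtr (\<lambda>s. W s \<omega>) t)"
  unfolding std_brownian_motion_def
proof (intro conjI allI impI ballI)
  let ?X = "\<lambda>t \<omega>. qtr (\<lambda>s. W s \<omega>) t"
  show "?X t \<in> borel_measurable M" if "0 \<le> t" for t by (rule qtr_measurable[OF that])
  show "?X 0 \<omega> = 0" "continuous_on {0..} (\<lambda>t. ?X t \<omega>)" if "\<omega> \<in> space M" for \<omega>
    using qtr_0[OF that] qtr_continuous[OF that] by auto
  show "distributed M lborel (\<lambda>\<omega>. ?X t \<omega> - ?X s \<omega>) (normal_density 0 (sqrt (t - s)))" if st: "0 \<le> s \<and> s < t" for s t
  proof -
    have [measurable]: "?X t \<in> borel_measurable M" "?X s \<in> borel_measurable M" "W t \<in> borel_measurable M" "W s \<in> borel_measurable M"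
      using st by (auto intro!: qtr_measurable W_meas)
    have "distr M borel (\<lambda>\<omega>. ?X t \<omega> - ?X s \<omega>) = distr M borel (\<lambda>\<omega>. W t \<omega> - W s \<omega>)"
    proof (rule cdf_unique)
      show "cdf (distr M borel (\<lambda>\<omega>. ?X t \<omega> - ?X s \<omega>)) = cdf (distr M borel (\<lambda>\<omega>. W t \<omega> - W s \<omega>))"
      proof
        fix x
        \<comment> \<open>A single increment is treated as the case \<open>m = 1\<close>, with the
          times \<open>s\<close> and \<open>t\<close> encoded as a sequence.\<close>
        have "prob {\<omega>\<in>space M. \<forall>i\<in>{0::nat}. ?X (case Suc i of 0 \<Rightarrow> s | Suc _ \<Rightarrow> t) \<omega> - ?X (case i of 0 \<Rightarrow> s | Suc _ \<Rightarrow> t) \<omega> \<le> x} =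
           prob {\<omega>\<in>space M. \<forall>i\<in>{0::nat}. W (case Suc i of 0 \<Rightarrow> s | Suc _ \<Rightarrow> t) \<omega> - W (case i of 0 \<Rightarrow> s | Suc _ \<Rightarrow> t) \<omega> \<le> x}"
          by (rule qtr_increments_cdf[where m=1]) (use st in \<open>auto split: nat.split\<close>)
        then have "prob {\<omega>\<in>space M. ?X t \<omega> - ?X s \<omega> \<le> x} = prob {\<omega>\<in>space M. W t \<omega> - W s \<omega> \<le> x}" by simp
        moreover have "cdf (distr M borel Y) x = prob {\<omega>\<in>space M. Y \<omega> \<le> x}" if "Y \<in> borel_measurable M" for Y
          using that by (auto simp: cdf_def measure_distr intro!: arg_cong[where f=prob])
        ultimately show "cdf (distr M borel (\<lambda>\<omega>. ?X t \<omega> - ?X s \<omega>)) x = cdf (distr M borel (\<lambda>\<omega>. W t \<omega> - W s \<omega>)) x"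
          by simp
      qed
    qed auto
    then show ?thesis using W_dist[of s t] st unfolding distributed_def by (simp cong: distr_cong)
  qed
  show "indep_vars (\<lambda>_. borel) (\<lambda>i \<omega>. ?X (ts (Suc i)) \<omega> - ?X (ts i) \<omega>) {..<m}"
    if ts: "0 \<le> ts 0 \<and> (\<forall>i<m. ts i < ts (Suc i))" for m :: nat and ts :: "nat \<Rightarrow> real"
  proof (rule indep_vars_cdfI)
    have ts0: "0 \<le> ts i" if "i \<le> m" for i
      using that
    proof (induction i)
      case (Suc i) then show ?case using ts by (meson Suc_le_eq less_imp_le order_trans)
    qed (use ts in auto)
    show "(\<lambda>\<omega>. ?X (ts (Suc i)) \<omega> - ?X (ts i) \<omega>) \<in> borel_measurable M" if "i \<in> {..<m}" for i
      using that by (intro borel_measurable_diff qtr_measurable ts0) auto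
    fix S and a :: "nat \<Rightarrow> real" assume S: "S \<subseteq> {..<m}" "finite S" "S \<noteq> {}"
    have eq: "prob {\<omega>\<in>space M. \<forall>i\<in>S. ?X (ts (Suc i)) \<omega> - ?X (ts i) \<omega> \<le> a i} =
        prob {\<omega>\<in>space M. \<forall>i\<in>S. W (ts (Suc i)) \<omega> - W (ts i) \<omega> \<le> a i}" if "S \<subseteq> {..<m}" for S
      using qtr_increments_cdf[OF ts0 that] .
    \<comment> \<open>The equality of joint distribution functions is used twice: on singletons for
      the marginals here, and on all of \<open>S\<close> afterwards. Factorization then passes from
      the increments of \<open>W\<close> to those of the image.\<close>
    have "(\<Prod>i\<in>S. prob {\<omega>\<in>space M. ?X (ts (Suc i)) \<omega> - ?X (ts i) \<omega> \<le> a i}) =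
        (\<Prod>i\<in>S. prob {\<omega>\<in>space M. W (ts (Suc i)) \<omega> - W (ts i) \<omega> \<le> a i})"
      using eq[of "{_}"] S(1) by (intro prod.cong) auto
    then show "prob {\<omega>\<in>space M. \<forall>i\<in>S. ?X (ts (Suc i)) \<omega> - ?X (ts i) \<omega> \<le> a i} =
        (\<Prod>i\<in>S. prob {\<omega>\<in>space M. ?X (ts (Suc i)) \<omega> - ?X (ts i) \<omega> \<le> a i})"
      using eq[OF S(1)] increments_cdf_prod[OF _ _ S, of ts a] ts by simp
  qed
qed

end

theorem theorem2p1:
  fixes M :: "'a measure" and W :: "real \<Rightarrow> 'a \<Rightarrow> real"
  assumes "prob_space M"
    and "std_brownian_motion M W"
  shows "std_brownian_motion M (\<lambda>t \<omega>. qtr (\<lambda>s. W s \<omega>) t)"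
proof -
  interpret std_bm M W using assms by (simp add: std_bm_def std_bm_axioms_def)
  show ?thesis by (rule qtr_bm)
qed

end
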